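(* Let $N\ge 1$ be an integer, $s\in(0,1)$, $T>0$, $p\ge 1$, $\beta>0$, and let $\psi(x):=(1+|x|^2)^{-\beta/2}$ for $x\in\mathbb{R}^N$. Let $\rho\in C(\mathbb{R}^N)$ with $\rho(x)>0$ for all $x\in\mathbb{R}^N$, and suppose that there exist $K>0$ and $\alpha\in\mathbb{R}$ such that $\rho(x)\ge K(1+|x|^2)^{-\alpha/2}$ for all $x\in\mathbb{R}^N$ (this lower bound is replaced by another one in the second alternative of (iii) below). Let $u$ be a solution to the problem $$\rho\,\partial_t u+(-\Delta)^s u=0\ \text{ in } S_T,\qquad u=0\ \text{ in }\mathbb{R}^N\times\{0\},$$ with $|u(\cdot,t)|^p\in\mathcal{L}^s(\mathbb{R}^N)$ for each $t\in(0,T]$. If $u\in L^p_\psi(S_T)$, then $u\equiv 0$ in $S_T$, provided that one of the following conditions holds: (i) $0<\beta\le N-2s$, $\alpha\in\mathbb{R}$; (ii) $N-2s<\beta<N$, $\alpha\le 2s$; (iii) $\beta=N$, and either $\alpha<2s$, or, instead of the lower bound $\rho(x)\ge K(1+|x|^2)^{-\alpha/2}$, there holds $\rho(x)\ge K(1+|x|^2)^{-s}\log(1+|x|^2)$ for all $x\in\mathbb{R}^N$, for some $K>0$; (iv) $\beta>N$, $\alpha+\beta\le 2s+N$.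
   Context: $S_T:=\mathbb{R}^N\times(0,T]$ and $\bar S_T=\mathbb{R}^N\times[0,T]$. $\mathcal{L}^s(\mathbb{R}^N)$ is the space of measurable $v:\mathbb{R}^N\to\mathbb{R}$ with $\|v\|_{\mathcal{L}^s(\mathbb{R}^N)}:=\int_{\mathbb{R}^N}\frac{|v(x)|}{1+|x|^{N+2s}}\,dx<\infty$. For a positive continuous weight $\psi$, $L^p_\psi(S_T)$ is the set of measurable $u:S_T\to\mathbb{R}$ with $\int_0^T\int_{\mathbb{R}^N}|u(x,t)|^p\psi(x)\,dx\,dt<\infty$. The fractional Laplacian is $(-\Delta)^s v(x)=C_{N,s}\,\mathrm{P.V.}\int_{\mathbb{R}^N}\frac{v(x)-v(y)}{|x-y|^{N+2s}}\,dy$, with $C_{N,s}=\left(\int_{\mathbb{R}^N}\frac{1-\cos(\xi_1)}{|\xi|^{N+2s}}d\xi\right)^{-1}>0$. A function $u$ is a solution to the equation $\rho\,\partial_t u+(-\Delta)^s u=0$ in $S_T$ if: $u\in C(S_T)$; for some $\gamma>0$ and each $t\in(0,T]$, $u(\cdot,t)\in\mathcal{L}^s(\mathbb{R}^N)\cap C^{2s+\gamma}(\mathbb{R}^N)$ if $s<\frac12$, or $u(\cdot,t)\in\mathcal{L}^s(\mathbb{R}^N)\cap C^{1,2s+\gamma-1}_{loc}(\mathbb{R}^N)$ if $s\ge\frac12$; $\partial_t u\in C(S_T)$; and $\rho(x)\partial_t u(x,t)+C_{N,s}\,\mathrm{P.V.}\int_{\mathbb{R}^N}\frac{u(x,t)-u(y,t)}{|x-y|^{N+2s}}dy=0$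 for all $(x,t)\in S_T$. A function $u$ is a solution to the problem (with zero initial datum) if $u\in C(\bar S_T)$, $\partial_t u\in L^1_{loc}(\bar S_T)$, $u\in L^1((0,T),\mathcal{L}^s(\mathbb{R}^N))$, $u$ is a solution to the equation $\rho\,\partial_t u+(-\Delta)^s u=0$ in $S_T$ (that is, $u\in C(S_T)$; for some $\gamma>0$ and each $t\in(0,T]$, $u(\cdot,t)\in\mathcal{L}^s(\mathbb{R}^N)\cap C^{2s+\gamma}(\mathbb{R}^N)$ if $s<\frac12$, or $u(\cdot,t)\in\mathcal{L}^s(\mathbb{R}^N)\cap C^{1,2s+\gamma-1}_{loc}(\mathbb{R}^N)$ if $s\ge\frac12$; $\partial_t u\in C(S_T)$; and $\rho(x)\partial_t u(x,t)+C_{N,s}\,\mathrm{P.V.}\int_{\mathbb{R}^N}\frac{u(x,t)-u(y,t)}{|x-y|^{N+2s}}dy=0$ for all $(x,t)\in S_T$), and $u(x,0)=0$ for all $x\in\mathbb{R}^N$. *)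

theory Defs
  imports "HOL-Analysis.Analysis"
begin

(* \<real>^N is an arbitrary Euclidean space 'a, with N = DIM('a).  A function on space-time is written
   in curried form, u x t; the time interval enters only through the sets below. *)

definition slab :: "real \<Rightarrow> ('a::euclidean_space \<times> real) set" where
  "slab T = UNIV \<times> {0<..T}"

definition closed_slab :: "real \<Rightarrow> ('a::euclidean_space \<times> real) set" where
  "closed_slab T = UNIV \<times> {0..T}"

definition Ls_space :: "real \<Rightarrow> ('a::euclidean_space \<Rightarrow> real) set" where
  "Ls_space s = {v. v \<in> borel_measurable lebesgue \<and>
     integrable lebesgue (\<lambda>x. \<bar>v x\<bar> / (1 + norm x powr (real DIM('a) + 2 * s)))}"

definition Ls_norm :: "real \<Rightarrow> ('a::euclidean_space \<Rightarrow> real) \<Rightarrow> real" where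
  "Ls_norm s v = (LINT x|lebesgue. \<bar>v x\<bar> / (1 + norm x powr (real DIM('a) + 2 * s)))"

(* For jointly measurable u this is Bochner integrability of t \<mapsto> u(\<cdot>,t) with values in the
   Banach space L^s: strong measurability follows from joint measurability, since L^s is a
   separable weighted L^1 space. *)
definition L1_time_Ls :: "real \<Rightarrow> real \<Rightarrow> ('a::euclidean_space \<Rightarrow> real \<Rightarrow> real) set" where
  "L1_time_Ls s T = {u.
     set_borel_measurable lebesgue (slab T) (\<lambda>(x, t). u x t) \<and>
     (AE t in lebesgue. t \<in> {0<..<T} \<longrightarrow> (\<lambda>x. u x t) \<in> Ls_space s) \<and>
     set_integrable lebesgue {0<..<T} (\<lambda>t. Ls_norm s (\<lambda>x. u x t))}"

definition weighted_Lp ::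
    "real \<Rightarrow> ('a::euclidean_space \<Rightarrow> real) \<Rightarrow> real \<Rightarrow> ('a \<Rightarrow> real \<Rightarrow> real) set" where
  "weighted_Lp p \<psi> T = {u.
     set_borel_measurable lebesgue (slab T) (\<lambda>(x, t). u x t) \<and>
     (\<integral>\<^sup>+ t \<in> {0<..T}. (\<integral>\<^sup>+ x. ennreal (\<bar>u x t\<bar> powr p * \<psi> x) \<partial>lebesgue) \<partial>lebesgue) < \<infinity>}"

definition holder_on :: "'a::metric_space set \<Rightarrow> real \<Rightarrow> ('a \<Rightarrow> 'b::metric_space) \<Rightarrow> bool" where
  "holder_on S a f \<longleftrightarrow> (\<exists>C. \<forall>x\<in>S. \<forall>y\<in>S. dist (f x) (f y) \<le> C * dist x y powr a)"

(* C^a(\<real>^N) for 0 < a \<le> 1: globally Hoelder continuous functions.  Boundedness is not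
   required, so the space with the norm sup |v| + [v]_a is contained in this one. *)
definition holder_space :: "real \<Rightarrow> ('a::euclidean_space \<Rightarrow> real) set" where
  "holder_space a = {v. holder_on UNIV a v}"

(* C^{1,a}_loc(\<real>^N) for 0 < a \<le> 1; g is the gradient, whose continuity is implied. *)
definition C1_holder_loc :: "real \<Rightarrow> ('a::euclidean_space \<Rightarrow> real) set" where
  "C1_holder_loc a = {v. \<exists>g. (\<forall>x. GDERIV v x :> g x) \<and> (\<forall>K. compact K \<longrightarrow> holder_on K a g)}"

(* The coordinate \<xi>_1 is taken along an arbitrary element of the orthonormal basis; by
   rotation invariance the integral does not depend on that choice. *)
definition frac_const :: "'a::euclidean_space itself \<Rightarrow> real \<Rightarrow> real" where
  "frac_const _ s = inverse (LINT \<xi>|lebesgue.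
     (1 - cos (inner \<xi> (SOME b. b \<in> (Basis :: 'a set)))) / norm \<xi> powr (real DIM('a) + 2 * s))"

definition has_pv_integral ::
    "('a::euclidean_space \<Rightarrow> real) \<Rightarrow> 'a \<Rightarrow> real \<Rightarrow> bool" where
  "has_pv_integral f x I \<longleftrightarrow>
     (\<forall>\<epsilon>>0. set_integrable lebesgue {y. \<epsilon> < dist x y} f) \<and>
     ((\<lambda>\<epsilon>. LINT y:{y. \<epsilon> < dist x y}|lebesgue. f y) \<longlongrightarrow> I) (at_right 0)"

definition has_frac_laplacian ::
    "real \<Rightarrow> ('a::euclidean_space \<Rightarrow> real) \<Rightarrow> 'a \<Rightarrow> real \<Rightarrow> bool" where
  "has_frac_laplacian s v x L \<longleftrightarrow>
     (\<exists>I. has_pv_integral (\<lambda>y. (v x - v y) / norm (x - y) powr (real DIM('a) + 2 * s)) x I \<and>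
          L = frac_const TYPE('a) s * I)"

(* At t = T this is the left derivative; at 0 < t < T it is the ordinary one. *)
definition time_deriv :: "real \<Rightarrow> ('a \<Rightarrow> real \<Rightarrow> real) \<Rightarrow> 'a \<Rightarrow> real \<Rightarrow> real" where
  "time_deriv T u x t = vector_derivative (u x) (at t within {0<..T})"

(* The upper bounds on \<gamma> only keep the Hoelder exponents in (0,1]; \<gamma> is a small number, whose
   value may be decreased. *)
definition space_regular ::
    "real \<Rightarrow> real \<Rightarrow> ('a::euclidean_space \<Rightarrow> real \<Rightarrow> real) \<Rightarrow> bool" where
  "space_regular s T u \<longleftrightarrow>
     (\<exists>\<gamma>>0. \<forall>t\<in>{0<..T}. (\<lambda>x. u x t) \<in> Ls_space s \<and>
        (if s < 1/2
         then 2 * s + \<gamma> \<le> 1 \<and> (\<lambda>x. u x t) \<in> holder_space (2 * s + \<gamma>)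
         else 2 * s + \<gamma> - 1 \<le> 1 \<and> (\<lambda>x. u x t) \<in> C1_holder_loc (2 * s + \<gamma> - 1)))"

definition solves_equation ::
    "real \<Rightarrow> real \<Rightarrow> ('a::euclidean_space \<Rightarrow> real) \<Rightarrow> ('a \<Rightarrow> real \<Rightarrow> real) \<Rightarrow> bool" where
  "solves_equation s T \<rho> u \<longleftrightarrow>
     continuous_on (slab T) (\<lambda>(x, t). u x t) \<and>
     space_regular s T u \<and>
     (\<forall>x. \<forall>t\<in>{0<..T}. u x differentiable (at t within {0<..T})) \<and>
     continuous_on (slab T) (\<lambda>(x, t). time_deriv T u x t) \<and>
     (\<forall>x. \<forall>t\<in>{0<..T}. \<exists>L. has_frac_laplacian s (\<lambda>y. u y t) x L \<and>
        \<rho> x * time_deriv T u x t + L = 0)"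

(* The third conjunct is \<partial>_t u \<in> L^1_loc on the closed slab: the compact sets may touch t = 0,
   but \<partial>_t u itself is only defined for t > 0. *)
definition solves_problem ::
    "real \<Rightarrow> real \<Rightarrow> ('a::euclidean_space \<Rightarrow> real) \<Rightarrow> ('a \<Rightarrow> real \<Rightarrow> real) \<Rightarrow> bool" where
  "solves_problem s T \<rho> u \<longleftrightarrow>
     solves_equation s T \<rho> u \<and>
     continuous_on (closed_slab T) (\<lambda>(x, t). u x t) \<and>
     (\<forall>K. compact K \<and> K \<subseteq> closed_slab T \<longrightarrow>
        set_integrable lebesgue (K \<inter> slab T) (\<lambda>(x, t). time_deriv T u x t)) \<and>
     u \<in> L1_time_Ls s T \<and>
     (\<forall>x. u x 0 = 0)"

end

theory Submission
  imports Defs "HOL-Probability.Distributions"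
begin

text \<open>
  The convexity of the modulus turns the equation into a differential inequality for a function of
  the solution, which is then tested against a negative power of 1 + |x|^2.

  For \<delta> > 0 let G be the convex, continuously differentiable and 1-Lipschitz function
  \<open>level_fun\<close> below: it vanishes exactly on [-\<delta>, \<delta>] and satisfies both G(r) \<le> |r| and
  G(r) \<le> \<delta>^(1-p) |r|^p. Put w = G(u). It suffices to show w = 0 for every \<delta>. The first bound gives
  w \<in> L^1(0,T; L^s) and the second gives w \<in> L^1 with weight \<psi>, so the exponent p plays no role any
  more, and the exponent \<beta> of the weight may be increased, or replaced by N + 2s. This reduces
  the hypotheses to exponents 0 < \<beta> \<le> N + 2s and to two situations: either \<beta> = N - 2s with no condition on
  \<rho>, or E \<le> C \<rho> \<psi>, where E is the weight \<open>op_weight\<close>, a bound for the fractional Laplacian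
  of \<psi>, and \<psi> from here on stands for the weight with the new exponent.

  The test functions \<phi>_m are \<psi> times the cubed positive part of 1 - (1+|x|^2)/m. They are of class C^2,
  compactly supported, and increase to \<psi>; since they are functions of 1+|x|^2, their second
  differences are easily estimated, and |(-\<Delta>)^s \<phi>_m| \<le> K E uniformly in m
  (lemma \<open>frac_op_test_fun_bounds\<close>).

  For a fixed time, convexity gives G'(u) (-\<Delta>)^s u \<ge> (-\<Delta>)^s w already for the truncated operators. These
  are symmetric with respect to integration, and the truncation is removed by dominated
  convergence, where the Hoelder regularity of u enters. The outcome is
    \<integral> \<phi>_m \<rho> \<partial>_t w dx \<le> - c \<integral> w (-\<Delta>)^s \<phi>_m dx
  with (-\<Delta>)^s normalised without its constant and c \<ge> 0. After multiplication by exp(-\<kappa> t) and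
  integration over (0, \<tau>], letting m tend to infinity leaves
    \<integral> \<psi> \<rho> w(\<tau>) exp(-\<kappa> \<tau>) dx \<le> \<integral>\<integral> exp(-\<kappa> t) w (- c (-\<Delta>)^s \<psi> - \<kappa> \<rho> \<psi>) dx dt,
  up to a harmless cut-off of the last term, and the right-hand side is not positive if
  - c (-\<Delta>)^s \<psi> \<le> \<kappa> \<rho> \<psi>.

  If E \<le> C \<rho> \<psi>, this holds for a large \<kappa>. If \<beta> = N - 2s, it holds with \<kappa> = 0 because \<psi> is then
  superharmonic for the fractional Laplacian (lemma \<open>frac_op_bracket_nonneg\<close>): both \<psi> and the kernel
  |z|^(-N-2s) are mixtures of centred Gaussians, the variances add under convolution, and the claim
  becomes a one-dimensional inequality for a fractional derivative on the half-line.
\<close>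

section \<open>Integrals of radial powers\<close>

text \<open>Integration in polar coordinates for radial functions: both measures agree on the intervals
  {..a}, by the volume formula for balls.\<close>

lemma distr_norm_lborel:
  "distr lborel borel (norm :: 'a::euclidean_space \<Rightarrow> real) =
     density lborel (\<lambda>r. ennreal (real DIM('a) * unit_ball_vol (real DIM('a)) * r ^ (DIM('a) - 1)) *
       indicator {0..} r)" (is "?M = ?N")
proof -
  define n where "n = DIM('a)"
  define V where "V = unit_ball_vol (real n)"
  have n: "n > 0" by (simp add: n_def)
  have V: "V \<ge> 0" by (simp add: V_def)
  have M: "emeasure ?M {..a} = (if a < 0 then 0 else ennreal (V * a ^ n))" for a :: real
  proof -
    have "emeasure ?M {..a} = emeasure lborel (cball (0::'a) a)"
      by (subst emeasure_distr) (auto intro!: arg_cong[where f = "emeasure lborel"])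
    also have "\<dots> = (if a < 0 then 0 else ennreal (V * a ^ n))"
      by (auto simp: emeasure_cball V_def n_def)
    finally show ?thesis .
  qed
  have N: "emeasure ?N {..a} = (if a < 0 then 0 else ennreal (V * a ^ n))" for a :: real
  proof -
    have "emeasure ?N {..a} = (\<integral>\<^sup>+r. ennreal (real n * V * r ^ (n - 1)) * indicator {0..a} r \<partial>lborel)"
      by (subst emeasure_density)
         (auto simp: n_def V_def intro!: nn_integral_cong split: split_indicator)
    also have "\<dots> = (if a < 0 then 0 else ennreal (V * a ^ n))"
    proof (cases "a < 0")
      case False
      have "(\<integral>\<^sup>+r. ennreal (real n * V * r ^ (n - 1)) * indicator {0..a} r \<partial>lborel) = V * a ^ n - V * 0 ^ n"
        using False V n
        by (intro nn_integral_FTC_Icc) (auto intro!: derivative_eq_intros)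
      with False n show ?thesis by (simp add: power_0_left)
    qed auto
    finally show ?thesis .
  qed
  show ?thesis
  proof (rule measure_eqI_generator_eq[where E = "range (\<lambda>a::real. {..a})" and \<Omega> = UNIV
           and A = "\<lambda>i. {..real i}"])
    show "Int_stable (range (\<lambda>a::real. {..a}))"
      by (auto simp: Int_stable_def intro!: exI[of _ "min _ _"])
    show "sets ?M = sigma_sets UNIV (range (\<lambda>a::real. {..a}))"
      by (simp add: borel_eq_atMost)
    show "sets ?N = sigma_sets UNIV (range (\<lambda>a::real. {..a}))"
      by (simp add: borel_eq_atMost)
    show "(\<Union>i. {..real i}) = UNIV"
      by (auto intro: real_arch_simple)
    show "emeasure ?M X = emeasure ?N X" if "X \<in> range (\<lambda>a::real. {..a})" for X
      using that by (auto simp only: M N)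
  qed (auto simp: M)
qed

lemma nn_integral_radial:
  fixes f :: "real \<Rightarrow> ennreal"
  assumes [measurable]: "f \<in> borel_measurable borel"
  shows "(\<integral>\<^sup>+x. f (norm (x::'a::euclidean_space)) \<partial>lborel) =
    (\<integral>\<^sup>+r. f r * ennreal (real DIM('a) * unit_ball_vol (real DIM('a)) * r ^ (DIM('a) - 1)) *
       indicator {0..} r \<partial>lborel)"
proof -
  have "(\<integral>\<^sup>+x. f (norm (x::'a)) \<partial>lborel) = (\<integral>\<^sup>+r. f r \<partial>distr lborel borel (norm :: 'a \<Rightarrow> real))"
    by (simp add: nn_integral_distr)
  also have "\<dots> = (\<integral>\<^sup>+r. ennreal (real DIM('a) * unit_ball_vol (real DIM('a)) * r ^ (DIM('a) - 1)) *
       indicator {0..} r * f r \<partial>lborel)"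
    unfolding distr_norm_lborel by (subst nn_integral_density) auto
  also have "\<dots> = (\<integral>\<^sup>+r. f r * ennreal (real DIM('a) * unit_ball_vol (real DIM('a)) * r ^ (DIM('a) - 1)) *
       indicator {0..} r \<partial>lborel)"
    by (intro nn_integral_cong) (simp add: mult_ac)
  finally show ?thesis .
qed

text \<open>The surface measure of the unit sphere.\<close>

definition sphere_area :: "'a::euclidean_space itself \<Rightarrow> real" where
  "sphere_area _ = real DIM('a) * unit_ball_vol (real DIM('a))"

lemma sphere_area_nonneg [simp]: "sphere_area TYPE('a::euclidean_space) \<ge> 0"
  by (simp add: sphere_area_def)

lemma nn_integral_norm_powr:
  assumes [measurable]: "S \<in> sets borel"
  shows "(\<integral>\<^sup>+x. ennreal (norm (x::'a::euclidean_space) powr q) * indicator {x. norm x \<in> S} x \<partial>lborel) =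
    ennreal (sphere_area TYPE('a)) *
      (\<integral>\<^sup>+t. ennreal (t powr (q + real DIM('a) - 1)) * indicator (S \<inter> {0..}) t \<partial>lborel)"
proof -
  have "(\<integral>\<^sup>+x. ennreal (norm (x::'a) powr q) * indicator {x. norm x \<in> S} x \<partial>lborel) =
      (\<integral>\<^sup>+t. (ennreal (t powr q) * indicator S t) *
        ennreal (real DIM('a) * unit_ball_vol (real DIM('a)) * t ^ (DIM('a) - 1)) * indicator {0..} t \<partial>lborel)"
    by (subst nn_integral_radial[symmetric]) (auto intro!: nn_integral_cong split: split_indicator)
  also have "\<dots> = (\<integral>\<^sup>+t. ennreal (sphere_area TYPE('a)) *
      (ennreal (t powr (q + real DIM('a) - 1)) * indicator (S \<inter> {0..}) t) \<partial>lborel)"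
  proof (intro nn_integral_cong)
    fix t :: real
    show "(ennreal (t powr q) * indicator S t) *
        ennreal (real DIM('a) * unit_ball_vol (real DIM('a)) * t ^ (DIM('a) - 1)) * indicator {0..} t =
        ennreal (sphere_area TYPE('a)) * (ennreal (t powr (q + real DIM('a) - 1)) * indicator (S \<inter> {0..}) t)"
    proof (cases "t > 0")
      case True
      have "t ^ (DIM('a) - 1) = t powr (real DIM('a) - 1)"
        using True by (simp add: powr_realpow[symmetric] of_nat_diff Suc_leI)
      moreover have "t powr (q + real DIM('a) - 1) = t powr q * t powr (real DIM('a) - 1)"
        by (simp add: powr_add[symmetric] algebra_simps)
      ultimately show ?thesis using True
        by (auto simp: ennreal_mult'[symmetric] mult_ac sphere_area_def split: split_indicator)
    next
      case False
      then show ?thesis by (cases "t = 0") auto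
    qed
  qed
  finally show ?thesis by (simp add: nn_integral_cmult)
qed

lemma nn_integral_powr_tail:
  fixes e r :: real
  assumes "0 < e" "0 < r"
  shows "(\<integral>\<^sup>+t. ennreal (t powr (- e - 1)) * indicator {r..} t \<partial>lborel) = ennreal (r powr (- e) / e)"
proof -
  have "(\<integral>\<^sup>+t. ennreal (t powr (- e - 1)) * indicator {r..} t \<partial>lborel) = ennreal (0 - (- (r powr (- e)) / e))"
  proof (rule nn_integral_FTC_atLeast)
    show "DERIV (\<lambda>t. - (t powr (- e)) / e) t :> t powr (- e - 1)" if "r \<le> t" for t
    proof -
      have "DERIV (\<lambda>t. - (t powr (- e)) / e) t :> - (- e * t powr (- e - 1)) / e"
        using that assms by (intro DERIV_cdivide DERIV_minus has_real_derivative_powr) auto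
      then show ?thesis using assms by simp
    qed
    have "((\<lambda>t. t powr (- e)) \<longlongrightarrow> 0) at_top"
      using assms by (intro tendsto_neg_powr filterlim_ident) auto
    from tendsto_divide[OF tendsto_minus[OF this] tendsto_const[of e]] assms
    show "((\<lambda>t. - (t powr (- e)) / e) \<longlongrightarrow> 0) at_top" by simp
  qed auto
  then show ?thesis by simp
qed

lemma nn_integral_norm_powr_inside:
  fixes e r :: real
  assumes "0 < e" "0 \<le> r"
  shows "(\<integral>\<^sup>+x. ennreal (norm (x::'a::euclidean_space) powr (e - real DIM('a))) * indicator {x. norm x \<le> r} x \<partial>lborel) =
    ennreal (sphere_area TYPE('a) * r powr e / e)"
proof -
  have "((\<lambda>t. t powr (e - 1)) has_integral r powr e / e) {0..r}"
    using has_integral_powr_from_0[of "e - 1" r] assms by simp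
  then have "(\<integral>\<^sup>+t. ennreal (t powr (e - 1)) * indicator {0..r} t \<partial>lborel) = ennreal (r powr e / e)"
    by (intro nn_integral_has_integral_lebesgue') auto
  moreover have "{..r} \<inter> {0..} = {0..r}" by auto
  ultimately show ?thesis
    using nn_integral_norm_powr[of "{..r}" "e - real DIM('a)", where 'a = 'a]
    by (simp add: ennreal_mult'[symmetric])
qed

lemma nn_integral_norm_powr_outside:
  fixes e r :: real
  assumes "0 < e" "0 < r"
  shows "(\<integral>\<^sup>+x. ennreal (norm (x::'a::euclidean_space) powr (- e - real DIM('a))) * indicator {x. r \<le> norm x} x \<partial>lborel) =
    ennreal (sphere_area TYPE('a) * r powr (- e) / e)"
proof -
  have "{r..} \<inter> {0..} = {r..}" using assms by auto
  then show ?thesis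
    using nn_integral_norm_powr[of "{r..}" "- e - real DIM('a)", where 'a = 'a] nn_integral_powr_tail[OF assms]
    by (simp add: ennreal_mult'[symmetric])
qed

lemma nn_integral_norm_powr_annulus:
  fixes R :: real
  assumes "1 \<le> R"
  shows "(\<integral>\<^sup>+x. ennreal (norm (x::'a::euclidean_space) powr (- real DIM('a))) * indicator {x. 1 \<le> norm x \<and> norm x \<le> R} x \<partial>lborel) =
    ennreal (sphere_area TYPE('a) * ln R)"
proof -
  have "(\<integral>\<^sup>+t. ennreal (t powr (- 1)) * indicator {1..R} t \<partial>lborel) = (\<integral>\<^sup>+t. ennreal (1 / t) * indicator {1..R} t \<partial>lborel)"
    by (intro nn_integral_cong) (auto simp: powr_minus_divide split: split_indicator)
  also have "\<dots> = ennreal (ln R - ln 1)"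
    using assms by (intro nn_integral_FTC_Icc) (auto intro!: derivative_eq_intros)
  finally have "(\<integral>\<^sup>+t. ennreal (t powr (- 1)) * indicator {1..R} t \<partial>lborel) = ennreal (ln R)" by simp
  moreover have "{1..R} \<inter> {0..} = {1..R}" by auto
  ultimately show ?thesis
    using nn_integral_norm_powr[of "{1..R}" "- real DIM('a)", where 'a = 'a]
    by (simp add: ennreal_mult'[symmetric])
qed

section \<open>The weight and the kernel\<close>

lemma nn_integral_lborel_translate:
  fixes f :: "'a::euclidean_space \<Rightarrow> ennreal"
  assumes [measurable]: "f \<in> borel_measurable borel"
  shows "(\<integral>\<^sup>+x. f (a + x) \<partial>lborel) = (\<integral>\<^sup>+x. f x \<partial>lborel)"
proof -
  have "(\<integral>\<^sup>+x. f x \<partial>lborel) = (\<integral>\<^sup>+x. f x \<partial>distr lborel borel ((+) a))"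
    by (simp add: lborel_distr_plus)
  also have "\<dots> = (\<integral>\<^sup>+x. f (a + x) \<partial>lborel)"
    by (simp add: nn_integral_distr)
  finally show ?thesis by simp
qed

lemma lborel_distr_uminus_euclidean:
  "distr lborel borel uminus = (lborel :: 'a::euclidean_space measure)"
  by (subst (2) lborel_affine[of "-1" 0]) (auto simp: density_1)

lemma nn_integral_lborel_uminus:
  fixes f :: "'a::euclidean_space \<Rightarrow> ennreal"
  assumes [measurable]: "f \<in> borel_measurable borel"
  shows "(\<integral>\<^sup>+x. f (- x) \<partial>lborel) = (\<integral>\<^sup>+x. f x \<partial>lborel)"
proof -
  have "(\<integral>\<^sup>+x. f x \<partial>lborel) = (\<integral>\<^sup>+x. f x \<partial>distr lborel borel (uminus :: 'a \<Rightarrow> 'a))"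
    by (simp add: lborel_distr_uminus_euclidean)
  also have "\<dots> = (\<integral>\<^sup>+x. f (- x) \<partial>lborel)"
    by (simp add: nn_integral_distr)
  finally show ?thesis by simp
qed

text \<open>The Japanese bracket of x; the weight \<psi> is its power with exponent -\<beta>. As the norm of
  (1, x) it satisfies the triangle inequality.\<close>

definition bracket :: "'a::euclidean_space \<Rightarrow> real" where
  "bracket x = sqrt (1 + (norm x)\<^sup>2)"

lemma bracket_eq_norm_Pair: "bracket x = norm (1::real, x)"
  by (simp add: bracket_def norm_Pair)

lemma bracket_ge_1: "1 \<le> bracket x"
  by (simp add: bracket_def)

lemma bracket_pos [simp]: "0 < bracket x"
  using bracket_ge_1[of x] by linarith

lemma norm_le_bracket: "norm x \<le> bracket x"
  by (simp add: bracket_def real_le_rsqrt)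

lemma bracket_add_le: "bracket (x + z) \<le> bracket x + norm z"
proof -
  have "norm ((1::real, x) + (0, z)) \<le> norm (1::real, x) + norm (0::real, z)"
    by (rule norm_triangle_ineq)
  then show ?thesis by (simp add: bracket_eq_norm_Pair norm_Pair)
qed

lemma bracket_uminus [simp]: "bracket (- x) = bracket x"
  by (simp add: bracket_def)

lemma bracket_le_add: "bracket x \<le> bracket (x + z) + norm z"
  using bracket_add_le[of "x + z" "- z"] by simp

lemma bracket_sq: "(bracket x)\<^sup>2 = 1 + (norm x)\<^sup>2"
  by (simp add: bracket_def)

lemma continuous_on_bracket [continuous_intros]:
  "continuous_on A f \<Longrightarrow> continuous_on A (\<lambda>x. bracket (f x))"
  unfolding bracket_def by (intro continuous_intros)

lemma borel_measurable_bracket [measurable]: "bracket \<in> borel_measurable borel"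
  unfolding bracket_def by measurable

lemma powr_bracket: "bracket x powr a = (1 + (norm x)\<^sup>2) powr (a / 2)"
  by (simp add: bracket_def powr_half_sqrt[symmetric] powr_powr)

text \<open>The kernel |z|^(-N-2s), without the normalising constant. Its value at z = 0 is 0, by the
  conventions for powers and division.\<close>

definition frac_kernel :: "real \<Rightarrow> 'a::euclidean_space \<Rightarrow> real" where
  "frac_kernel s z = 1 / norm z powr (real DIM('a) + 2 * s)"

lemma frac_kernel_nonneg [simp]: "0 \<le> frac_kernel s z"
  by (simp add: frac_kernel_def)

lemma frac_kernel_uminus [simp]: "frac_kernel s (- z) = frac_kernel s z"
  by (simp add: frac_kernel_def)

lemma borel_measurable_frac_kernel [measurable]: "frac_kernel s \<in> borel_measurable borel"
  unfolding frac_kernel_def by measurable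

lemma frac_kernel_eq: "frac_kernel s (z::'a::euclidean_space) = norm z powr (- (2 * s) - real DIM('a))"
proof -
  have "- (2 * s) - real DIM('a) = - (real DIM('a) + 2 * s)" by simp
  then show ?thesis by (simp only: frac_kernel_def powr_minus_divide)
qed

lemma frac_kernel_times_powr:
  "norm z powr (2 * s + e) * frac_kernel s (z::'a::euclidean_space) = norm z powr (e - real DIM('a))"
  by (simp add: frac_kernel_eq powr_add[symmetric])

text \<open>The order of magnitude of the integral of the weight with exponent -\<beta> over the region where the
  bracket is at most R, for R \<ge> 1. The three regimes of \<beta> below, at and above the dimension
  are the origin of the cases \<beta> < N, \<beta> = N and \<beta> > N of the theorem.\<close>

definition mass_growth :: "'a::euclidean_space itself \<Rightarrow> real \<Rightarrow> real \<Rightarrow> real" where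
  "mass_growth _ \<beta> R =
     (if \<beta> < real DIM('a) then R powr (real DIM('a) - \<beta>)
      else if \<beta> = real DIM('a) then 1 + ln R else 1)"

lemma mass_growth_nonneg: "1 \<le> R \<Longrightarrow> 0 \<le> mass_growth TYPE('a::euclidean_space) \<beta> R"
  by (simp add: mass_growth_def)

lemma borel_measurable_mass_growth [measurable]: "mass_growth TYPE('a::euclidean_space) \<beta> \<in> borel_measurable borel"
  unfolding mass_growth_def by measurable

lemma nn_integral_bracket_powr_le:
  assumes "0 < \<beta>"
  shows "\<exists>C\<ge>0. \<forall>R\<ge>1. (\<integral>\<^sup>+y. ennreal (bracket (y::'a::euclidean_space) powr (- \<beta>)) * indicator {y. bracket y \<le> R} y \<partial>lborel)
           \<le> ennreal (C * mass_growth TYPE('a) \<beta> R)"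
proof -
  define N where "N = real DIM('a)"
  define S where "S = sphere_area TYPE('a)"
  have N: "N > 0" by (simp add: N_def)
  have S: "S \<ge> 0" by (simp add: S_def)
  let ?I = "\<lambda>R. (\<integral>\<^sup>+y. ennreal (bracket (y::'a) powr (- \<beta>)) * indicator {y. bracket y \<le> R} y \<partial>lborel)"
  have mono: "bracket y powr (- \<beta>) \<le> norm y powr (- \<beta>)" if "y \<noteq> 0" for y :: 'a
    using that assms norm_le_bracket[of y] by (intro powr_mono2') auto
  have le1: "bracket y powr (- \<beta>) \<le> 1" for y :: 'a
    using assms bracket_ge_1[of y] powr_mono[of "-\<beta>" 0 "bracket y"] by simp
  have unit: "(\<integral>\<^sup>+y. indicator {y::'a. norm y \<le> 1} y \<partial>lborel) = ennreal (S / N)"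
  proof -
    have "(\<integral>\<^sup>+y. indicator {y::'a. norm y \<le> 1} y \<partial>lborel) =
        (\<integral>\<^sup>+y. ennreal (norm (y::'a) powr (N - real DIM('a))) * indicator {y. norm y \<le> 1} y \<partial>lborel)"
    proof (rule nn_integral_cong_AE)
      show "AE y in lborel. indicator {y::'a. norm y \<le> 1} y =
          ennreal (norm (y::'a) powr (N - real DIM('a))) * indicator {y. norm y \<le> 1} y"
        using AE_lborel_singleton[of "0::'a"]
        by eventually_elim (auto simp: N_def split: split_indicator)
    qed
    also have "\<dots> = ennreal (S * 1 powr N / N)"
      unfolding S_def using N by (intro nn_integral_norm_powr_inside) auto
    finally show ?thesis by simp
  qed
  show ?thesis
  proof (cases "\<beta> < N")
    case True
    have "?I R \<le> ennreal (S / (N - \<beta>) * mass_growth TYPE('a) \<beta> R)" if R: "R \<ge> 1" for R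
    proof -
      have "?I R \<le> (\<integral>\<^sup>+y. ennreal (norm (y::'a) powr ((N - \<beta>) - real DIM('a))) * indicator {y. norm y \<le> R} y \<partial>lborel)"
      proof (rule nn_integral_mono_AE)
        show "AE y in lborel. ennreal (bracket y powr (- \<beta>)) * indicator {y. bracket y \<le> R} y
           \<le> ennreal (norm (y::'a) powr (N - \<beta> - real DIM('a))) * indicator {y. norm y \<le> R} y"
          using AE_lborel_singleton[of "0::'a"]
        proof eventually_elim
          case (elim y)
          then show ?case
            using mono[of y] norm_le_bracket[of y] by (auto simp: N_def ennreal_leI split: split_indicator)
        qed
      qed
      also have "\<dots> = ennreal (S * R powr (N - \<beta>) / (N - \<beta>))"
        using True R unfolding S_def by (intro nn_integral_norm_powr_inside) auto
      finally show ?thesis using True by (simp add: mass_growth_def N_def)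
    qed
    moreover have "0 \<le> S / (N - \<beta>)" using True S by simp
    ultimately show ?thesis by blast
  next
    case False
    have split: "?I R \<le> (\<integral>\<^sup>+y. indicator {y::'a. norm y \<le> 1} y \<partial>lborel) +
         (\<integral>\<^sup>+y. ennreal (norm (y::'a) powr (- \<beta>)) * indicator {y. 1 \<le> norm y \<and> norm y \<le> R} y \<partial>lborel)" for R
    proof -
      have "?I R \<le> (\<integral>\<^sup>+y. indicator {y::'a. norm y \<le> 1} y +
            ennreal (norm (y::'a) powr (- \<beta>)) * indicator {y. 1 \<le> norm y \<and> norm y \<le> R} y \<partial>lborel)"
      proof (rule nn_integral_mono)
        fix y :: 'a
        show "ennreal (bracket y powr (- \<beta>)) * indicator {y. bracket y \<le> R} y \<le> indicator {y::'a. norm y \<le> 1} y +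
            ennreal (norm (y::'a) powr (- \<beta>)) * indicator {y. 1 \<le> norm y \<and> norm y \<le> R} y"
        proof (cases "norm y \<le> 1")
          case True
          have "ennreal (bracket y powr (- \<beta>)) * indicator {y. bracket y \<le> R} y \<le> 1"
            using le1[of y] by (auto split: split_indicator)
          with True show ?thesis by (auto intro: add_increasing2)
        next
          case False
          then have "y \<noteq> 0" by auto
          with False mono[of y] norm_le_bracket[of y] show ?thesis
            by (auto split: split_indicator)
        qed
      qed
      also have "\<dots> = (\<integral>\<^sup>+y. indicator {y::'a. norm y \<le> 1} y \<partial>lborel) +
         (\<integral>\<^sup>+y. ennreal (norm (y::'a) powr (- \<beta>)) * indicator {y. 1 \<le> norm y \<and> norm y \<le> R} y \<partial>lborel)"
        by (intro nn_integral_add) auto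
      finally show ?thesis .
    qed
    show ?thesis
    proof (cases "\<beta> = N")
      case True
      have "?I R \<le> ennreal ((S / N + S) * mass_growth TYPE('a) \<beta> R)" if R: "R \<ge> 1" for R
      proof -
        have "?I R \<le> ennreal (S / N) + ennreal (S * ln R)"
          using split[of R] nn_integral_norm_powr_annulus[of R, where 'a = 'a] R
          by (simp add: unit True N_def S_def)
        also have "\<dots> = ennreal (S / N + S * ln R)"
          using S N R by (simp add: ennreal_plus[symmetric] del: ennreal_plus)
        also have "\<dots> \<le> ennreal ((S / N + S) * mass_growth TYPE('a) \<beta> R)"
          using True S N R by (intro ennreal_leI) (simp add: mass_growth_def N_def[symmetric] algebra_simps)
        finally show ?thesis .
      qed
      moreover have "0 \<le> S / N + S" using S N by simp
      ultimately show ?thesis by blast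
    next
      case False
      with \<open>\<not> \<beta> < N\<close> have b: "\<beta> > N" by simp
      have "?I R \<le> ennreal ((S / N + S / (\<beta> - N)) * mass_growth TYPE('a) \<beta> R)" if R: "R \<ge> 1" for R
      proof -
        have "(\<integral>\<^sup>+y. ennreal (norm (y::'a) powr (- \<beta>)) * indicator {y. 1 \<le> norm y \<and> norm y \<le> R} y \<partial>lborel)
          \<le> (\<integral>\<^sup>+y. ennreal (norm (y::'a) powr (- (\<beta> - N) - real DIM('a))) * indicator {y. 1 \<le> norm y} y \<partial>lborel)"
          by (intro nn_integral_mono) (auto simp: N_def split: split_indicator)
        also have "\<dots> = ennreal (S / (\<beta> - N))"
          using nn_integral_norm_powr_outside[of "\<beta> - N" 1, where 'a = 'a] b by (simp add: S_def)
        finally have "?I R \<le> ennreal (S / N) + ennreal (S / (\<beta> - N))"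
          using split[of R] by (simp add: unit) (meson add_left_mono order_trans)
        also have "\<dots> = ennreal ((S / N + S / (\<beta> - N)) * mass_growth TYPE('a) \<beta> R)"
          using b S N by (simp add: ennreal_plus[symmetric] mass_growth_def N_def[symmetric] del: ennreal_plus)
        finally show ?thesis .
      qed
      moreover have "0 \<le> S / N + S / (\<beta> - N)" using b S N by simp
      ultimately show ?thesis by blast
    qed
  qed
qed

text \<open>A pointwise bound, up to a constant, for the fractional Laplacian of the weight with exponent -\<beta>. The kernel at
  distance of the order of the bracket of x carries the mass of the weight around the origin; by
  lemma \<open>bracket_powr_le_op_weight\<close> this dominates the local contribution as well.\<close>

definition op_weight :: "real \<Rightarrow> real \<Rightarrow> 'a::euclidean_space \<Rightarrow> real" where
  "op_weight s \<beta> x = bracket x powr (- real DIM('a) - 2 * s) * mass_growth TYPE('a) \<beta> (bracket x)"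

lemma op_weight_nonneg: "0 \<le> op_weight s \<beta> x"
  by (simp add: op_weight_def mass_growth_nonneg bracket_ge_1)

lemma borel_measurable_op_weight [measurable]: "op_weight s \<beta> \<in> borel_measurable borel"
  unfolding op_weight_def by measurable

lemma bracket_powr_le_op_weight: "bracket x powr (- \<beta> - 2 * s) \<le> op_weight s \<beta> x"
proof -
  have [simp]: "1 \<le> bracket x" "0 \<le> ln (bracket x)" using bracket_ge_1[of x] by auto
  consider "\<beta> < real DIM('a)" | "\<beta> = real DIM('a)" | "\<beta> > real DIM('a)" by linarith
  then show ?thesis
  proof cases
    case 1
    then show ?thesis by (simp add: op_weight_def mass_growth_def powr_add[symmetric] minus_diff_commute)
  next
    case 2
    then show ?thesis by (simp add: op_weight_def mass_growth_def distrib_left)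
  next
    case 3
    then show ?thesis by (auto simp: op_weight_def mass_growth_def intro!: powr_mono)
  qed
qed

lemma op_weight_le:
  assumes s: "0 < s" and b: "\<beta> \<le> real DIM('a) + 2 * s"
  shows "\<exists>C>0. \<forall>x::'a::euclidean_space. op_weight s \<beta> x \<le> C * bracket x powr (- \<beta>)"
proof -
  have [simp]: "1 \<le> bracket x" for x :: 'a by (rule bracket_ge_1)
  consider "\<beta> < real DIM('a)" | "\<beta> = real DIM('a)" | "\<beta> > real DIM('a)" by linarith
  then show ?thesis
  proof cases
    case 1
    then show ?thesis using s
      by (intro exI[of _ 1]) (auto simp: op_weight_def mass_growth_def powr_add[symmetric] intro!: powr_mono)
  next
    case 2
    have "op_weight s \<beta> x \<le> (1 + 1 / (2 * s)) * bracket x powr (- \<beta>)" for x :: 'a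
    proof -
      have "1 \<le> bracket x powr (2 * s)" using s by (simp add: ge_one_powr_ge_zero)
      moreover have "2 * s * ln (bracket x) \<le> bracket x powr (2 * s)"
        using ln_le_minus_one[of "bracket x powr (2 * s)"] bracket_pos[of x] by (simp add: ln_powr)
      ultimately have "1 + ln (bracket x) \<le> (1 + 1 / (2 * s)) * bracket x powr (2 * s)"
      proof -
        have "ln (bracket x) \<le> bracket x powr (2 * s) / (2 * s)"
          using s \<open>2 * s * ln (bracket x) \<le> bracket x powr (2 * s)\<close> by (simp add: field_simps)
        with \<open>1 \<le> bracket x powr (2 * s)\<close> show ?thesis by (simp add: distrib_right)
      qed
      then have "bracket x powr (- \<beta> - 2 * s) * (1 + ln (bracket x)) \<le>
          bracket x powr (- \<beta> - 2 * s) * ((1 + 1 / (2 * s)) * bracket x powr (2 * s))"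
        by (intro mult_left_mono) auto
      also have "\<dots> = (1 + 1 / (2 * s)) * bracket x powr (- \<beta>)"
        by (simp add: powr_add[symmetric] mult.left_commute[of "bracket x powr _"])
      finally show ?thesis using 2 by (simp add: op_weight_def mass_growth_def)
    qed
    moreover have "0 < 1 + 1 / (2 * s)" using s by (simp add: add_pos_pos)
    ultimately show ?thesis by blast
  next
    case 3
    then show ?thesis using s b
      by (intro exI[of _ 1]) (auto simp: op_weight_def mass_growth_def intro!: powr_mono)
  qed
qed

text \<open>A bound for the second differences of all test functions at x, times the kernel: a C^2 bound for
  increments of length at most half the bracket of x, and the sizes of the three values
  otherwise.\<close>

definition diff_bound :: "real \<Rightarrow> real \<Rightarrow> real \<Rightarrow> 'a::euclidean_space \<Rightarrow> 'a \<Rightarrow> real" where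
  "diff_bound C s \<beta> x z =
     (if norm z \<le> bracket x / 2 then C * (norm z)\<^sup>2 * bracket x powr (- \<beta> - 2)
      else 2 * bracket x powr (- \<beta>) + bracket (x + z) powr (- \<beta>) + bracket (x - z) powr (- \<beta>)) *
     frac_kernel s z"

lemma borel_measurable_diff_bound [measurable]:
  "diff_bound C s \<beta> x \<in> borel_measurable borel"
  unfolding diff_bound_def by measurable

lemma diff_bound_nonneg: "C \<ge> 0 \<Longrightarrow> 0 \<le> diff_bound C s \<beta> x z"
  by (simp add: diff_bound_def)

lemma nn_integral_frac_kernel_far:
  assumes "0 < s" "0 < r"
  shows "(\<integral>\<^sup>+z. ennreal (frac_kernel s (z::'a::euclidean_space)) * indicator {z. r \<le> norm z} z \<partial>lborel) =
    ennreal (sphere_area TYPE('a) * r powr (- (2 * s)) / (2 * s))"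
  unfolding frac_kernel_eq using assms by (intro nn_integral_norm_powr_outside) auto

lemma nn_integral_diff_bound:
  assumes s: "0 < s" "s < 1" and \<beta>: "0 < \<beta>" and C: "0 \<le> C"
  shows "\<exists>K\<ge>0. \<forall>x::'a::euclidean_space. (\<integral>\<^sup>+z. ennreal (diff_bound C s \<beta> x z) \<partial>lborel) \<le> ennreal (K * op_weight s \<beta> x)"
proof -
  define N where "N = real DIM('a)"
  define S where "S = sphere_area TYPE('a)"
  have N: "N > 0" by (simp add: N_def)
  have S: "S \<ge> 0" by (simp add: S_def)
  obtain M where M: "M \<ge> 0" "\<And>R. R \<ge> 1 \<Longrightarrow> (\<integral>\<^sup>+y. ennreal (bracket (y::'a) powr (- \<beta>)) * indicator {y. bracket y \<le> R} y \<partial>lborel)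
           \<le> ennreal (M * mass_growth TYPE('a) \<beta> R)"
    using nn_integral_bracket_powr_le[OF \<beta>, where 'a = 'a] by blast
  define K1 where "K1 = C * S * (1 / 2) powr (2 - 2 * s) / (2 - 2 * s)"
  define K2 where "K2 = 4 * S * (1 / 2) powr (- (2 * s)) / (2 * s)"
  define K3 where "K3 = 2 * M * (1 / 2) powr (- N - 2 * s)"
  have K: "K1 \<ge> 0" "K2 \<ge> 0" "K3 \<ge> 0" using s C S M by (auto simp: K1_def K2_def K3_def)
  have main: "(\<integral>\<^sup>+z. ennreal (diff_bound C s \<beta> x z) \<partial>lborel) \<le> ennreal ((K1 + K2 + K3) * op_weight s \<beta> x)" for x :: 'a
  proof -
    define b where "b = bracket x"
    have b: "b \<ge> 1" "b > 0" using bracket_ge_1[of x] by (auto simp: b_def)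
    let ?near = "\<lambda>z. ennreal (C * b powr (- \<beta> - 2)) * (ennreal (norm (z::'a) powr ((2 - 2 * s) - N)) * indicator {z. norm z \<le> b / 2} z)"
    let ?far = "\<lambda>z. ennreal (4 * b powr (- \<beta>)) * (ennreal (frac_kernel s (z::'a)) * indicator {z. b / 2 \<le> norm z} z)"
    let ?mass = "\<lambda>y. ennreal (bracket (y::'a) powr (- \<beta>)) * indicator {y. bracket y \<le> b} y"
    let ?k = "ennreal ((b / 2) powr (- N - 2 * s))"
    have near: "(\<integral>\<^sup>+z. ?near z \<partial>lborel) = ennreal (K1 * b powr (- \<beta> - 2 * s))"
    proof -
      have "(\<integral>\<^sup>+z. ?near z \<partial>lborel) = ennreal (C * b powr (- \<beta> - 2)) * (\<integral>\<^sup>+z. ennreal (norm (z::'a) powr ((2 - 2 * s) - N)) * indicator {z. norm z \<le> b / 2} z \<partial>lborel)"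
        by (intro nn_integral_cmult) measurable
      also have "(\<integral>\<^sup>+z. ennreal (norm (z::'a) powr ((2 - 2 * s) - N)) * indicator {z. norm z \<le> b / 2} z \<partial>lborel) =
          ennreal (S * (b / 2) powr (2 - 2 * s) / (2 - 2 * s))"
        unfolding N_def S_def using s b by (intro nn_integral_norm_powr_inside) auto
      also have "ennreal (C * b powr (- \<beta> - 2)) * ennreal (S * (b / 2) powr (2 - 2 * s) / (2 - 2 * s)) =
          ennreal ((C * b powr (- \<beta> - 2)) * (S * (b / 2) powr (2 - 2 * s) / (2 - 2 * s)))"
        using C by (intro ennreal_mult'[symmetric]) simp
      also have "(C * b powr (- \<beta> - 2)) * (S * (b / 2) powr (2 - 2 * s) / (2 - 2 * s)) =
           K1 * (b powr (- \<beta> - 2) * b powr (2 - 2 * s))"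
      proof -
        have "(b / 2) powr (2 - 2 * s) = b powr (2 - 2 * s) * (1 / 2) powr (2 - 2 * s)"
          using b powr_mult[of b "1/2" "2 - 2 * s"] by simp
        then show ?thesis by (simp only: K1_def) simp
      qed
      also have "b powr (- \<beta> - 2) * b powr (2 - 2 * s) = b powr (- \<beta> - 2 * s)"
        by (simp add: powr_add[symmetric])
      finally show ?thesis .
    qed
    have far: "(\<integral>\<^sup>+z. ?far z \<partial>lborel) = ennreal (K2 * b powr (- \<beta> - 2 * s))"
    proof -
      have "(\<integral>\<^sup>+z. ?far z \<partial>lborel) = ennreal (4 * b powr (- \<beta>)) * (\<integral>\<^sup>+z. ennreal (frac_kernel s (z::'a)) * indicator {z. b / 2 \<le> norm z} z \<partial>lborel)"
        by (intro nn_integral_cmult) measurable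
      also have "(\<integral>\<^sup>+z. ennreal (frac_kernel s (z::'a)) * indicator {z. b / 2 \<le> norm z} z \<partial>lborel) =
          ennreal (S * (b / 2) powr (- (2 * s)) / (2 * s))"
        unfolding S_def using s b by (intro nn_integral_frac_kernel_far) auto
      also have "ennreal (4 * b powr (- \<beta>)) * ennreal (S * (b / 2) powr (- (2 * s)) / (2 * s)) = ennreal ((4 * b powr (- \<beta>)) * (S * (b / 2) powr (- (2 * s)) / (2 * s)))"
        by (intro ennreal_mult'[symmetric]) simp
      also have "(4 * b powr (- \<beta>)) * (S * (b / 2) powr (- (2 * s)) / (2 * s)) =
           K2 * (b powr (- \<beta>) * b powr (- (2 * s)))"
      proof -
        have "(b / 2) powr (- (2 * s)) = b powr (- (2 * s)) * (1 / 2) powr (- (2 * s))"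
          using b powr_mult[of b "1/2" "- (2 * s)"] by simp
        then show ?thesis by (simp only: K2_def) simp
      qed
      also have "b powr (- \<beta>) * b powr (- (2 * s)) = b powr (- \<beta> - 2 * s)"
        by (simp add: powr_add[symmetric])
      finally show ?thesis .
    qed
    have mass1: "(\<integral>\<^sup>+z. ?mass (x + z) \<partial>lborel) \<le> ennreal (M * mass_growth TYPE('a) \<beta> b)"
      using nn_integral_lborel_translate[of ?mass x] M(2)[of b] b by simp
    have mass2: "(\<integral>\<^sup>+z. ?mass (x - z) \<partial>lborel) \<le> ennreal (M * mass_growth TYPE('a) \<beta> b)"
      using nn_integral_lborel_uminus[of "\<lambda>z. ?mass (x + z)"] mass1 by simp
    \<comment> \<open>For increments longer than b/2, points with bracket larger than b are estimated by the value of the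
      weight at x, the others by the value of the kernel at distance b/2.\<close>
    have pw: "ennreal (diff_bound C s \<beta> x z) \<le> ?near z + (?far z + (?k * ?mass (x + z) + ?k * ?mass (x - z)))" for z
    proof (cases "norm z \<le> b / 2")
      case True
      have "(norm z)\<^sup>2 * frac_kernel s z = norm z powr (2 - 2 * s - N)"
        using frac_kernel_times_powr[of z s "2 - 2 * s"]
        by (cases "z = 0") (auto simp: N_def powr_numeral)
      then have "diff_bound C s \<beta> x z = (C * b powr (- \<beta> - 2)) * norm z powr (2 - 2 * s - N)"
        using True by (simp add: diff_bound_def b_def mult_ac)
      then have "ennreal (diff_bound C s \<beta> x z) = ?near z"
        using True C by (simp add: ennreal_mult')
      then show ?thesis by (simp add: add_increasing2)
    next
      case False
      then have z: "norm z \<ge> b / 2" "norm z > 0" using b by auto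
      have k: "frac_kernel s z \<le> (b / 2) powr (- N - 2 * s)"
      proof -
        have "- (2 * s) - real DIM('a) = - N - 2 * s" by (simp add: N_def)
        then show ?thesis
          unfolding frac_kernel_eq using z b N s by (simp only:) (intro powr_mono2'; simp)
      qed
      have aux: "ennreal (bracket y powr (- \<beta>) * frac_kernel s z) \<le>
           ennreal (b powr (- \<beta>)) * ennreal (frac_kernel s z) + ?k * ?mass y" for y :: 'a
      proof (cases "bracket y \<le> b")
        case True
        then have "ennreal (bracket y powr (- \<beta>) * frac_kernel s z) \<le> ?k * ?mass y"
          using mult_left_mono[OF k, of "bracket y powr (- \<beta>)"]
          by (simp add: ennreal_mult'[symmetric] ennreal_leI mult.commute)
        then show ?thesis by (rule add_increasing[OF zero_le])
      next
        case False
        then have "bracket y powr (- \<beta>) \<le> b powr (- \<beta>)"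
          using b \<beta> by (intro powr_mono2') auto
        then have "ennreal (bracket y powr (- \<beta>) * frac_kernel s z) \<le> ennreal (b powr (- \<beta>)) * ennreal (frac_kernel s z)"
          by (simp add: ennreal_mult'[symmetric] mult_right_mono ennreal_leI)
        then show ?thesis by (simp add: add_increasing2)
      qed
      have "ennreal (diff_bound C s \<beta> x z) = ennreal (2 * b powr (- \<beta>) * frac_kernel s z) +
         (ennreal (bracket (x + z) powr (- \<beta>) * frac_kernel s z) + ennreal (bracket (x - z) powr (- \<beta>) * frac_kernel s z))"
        using False by (simp add: diff_bound_def b_def ennreal_plus[symmetric] distrib_right del: ennreal_plus)
      also have "\<dots> \<le> ennreal (2 * b powr (- \<beta>) * frac_kernel s z) +
         ((ennreal (b powr (- \<beta>)) * ennreal (frac_kernel s z) + ?k * ?mass (x + z)) +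
          (ennreal (b powr (- \<beta>)) * ennreal (frac_kernel s z) + ?k * ?mass (x - z)))"
        by (intro add_mono aux order_refl)
      also have "\<dots> = (ennreal (2 * b powr (- \<beta>) * frac_kernel s z) + ennreal (b powr (- \<beta>)) * ennreal (frac_kernel s z) +
          ennreal (b powr (- \<beta>)) * ennreal (frac_kernel s z)) + (?k * ?mass (x + z) + ?k * ?mass (x - z))"
        by (simp only: ac_simps)
      also have "(ennreal (2 * b powr (- \<beta>) * frac_kernel s z) + ennreal (b powr (- \<beta>)) * ennreal (frac_kernel s z) +
          ennreal (b powr (- \<beta>)) * ennreal (frac_kernel s z)) = ?far z"
        using z by (simp add: ennreal_plus[symmetric] ennreal_mult'[symmetric] del: ennreal_plus)
      finally show ?thesis by (rule order_trans) (simp add: add_increasing)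
    qed
    have "(\<integral>\<^sup>+z. ennreal (diff_bound C s \<beta> x z) \<partial>lborel) \<le>
       (\<integral>\<^sup>+z. ?near z + (?far z + (?k * ?mass (x + z) + ?k * ?mass (x - z))) \<partial>lborel)"
      by (intro nn_integral_mono pw)
    also have "\<dots> = (\<integral>\<^sup>+z. ?near z \<partial>lborel) + ((\<integral>\<^sup>+z. ?far z \<partial>lborel) +
        (?k * (\<integral>\<^sup>+z. ?mass (x + z) \<partial>lborel) + ?k * (\<integral>\<^sup>+z. ?mass (x - z) \<partial>lborel)))"
      by (simp add: nn_integral_add nn_integral_cmult)
    also have "\<dots> \<le> ennreal (K1 * b powr (- \<beta> - 2 * s)) + (ennreal (K2 * b powr (- \<beta> - 2 * s)) +
        (?k * ennreal (M * mass_growth TYPE('a) \<beta> b) + ?k * ennreal (M * mass_growth TYPE('a) \<beta> b)))"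
      unfolding near far by (intro add_mono mult_left_mono mass1 mass2 order_refl) auto
    also have "\<dots> = ennreal (K1 * b powr (- \<beta> - 2 * s) + (K2 * b powr (- \<beta> - 2 * s) +
        (2 * ((b / 2) powr (- N - 2 * s) * (M * mass_growth TYPE('a) \<beta> b)))))"
      using K M b mass_growth_nonneg[of b \<beta>, where 'a = 'a]
      by (simp add: ennreal_plus[symmetric] ennreal_mult'[symmetric] del: ennreal_plus)
    also have "2 * ((b / 2) powr (- N - 2 * s) * (M * mass_growth TYPE('a) \<beta> b)) = K3 * op_weight s \<beta> x"
    proof -
      have "(b / 2) powr (- N - 2 * s) = b powr (- N - 2 * s) * (1 / 2) powr (- N - 2 * s)"
        using b powr_mult[of b "1/2" "- N - 2 * s"] by simp
      then show ?thesis by (simp only: K3_def op_weight_def b_def N_def) simp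
    qed
    also have "ennreal (K1 * b powr (- \<beta> - 2 * s) + (K2 * b powr (- \<beta> - 2 * s) + K3 * op_weight s \<beta> x))
        \<le> ennreal ((K1 + K2 + K3) * op_weight s \<beta> x)"
    proof (rule ennreal_leI)
      have "K1 * b powr (- \<beta> - 2 * s) \<le> K1 * op_weight s \<beta> x" "K2 * b powr (- \<beta> - 2 * s) \<le> K2 * op_weight s \<beta> x"
        unfolding b_def using bracket_powr_le_op_weight[of x \<beta> s] K by (auto intro!: mult_left_mono)
      then show "K1 * b powr (- \<beta> - 2 * s) + (K2 * b powr (- \<beta> - 2 * s) + K3 * op_weight s \<beta> x)
        \<le> (K1 + K2 + K3) * op_weight s \<beta> x" by (simp add: distrib_right)
    qed
    finally show ?thesis .
  qed
  show ?thesis using main K by (intro exI[of _ "K1 + K2 + K3"]) auto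
qed

section \<open>Compactly supported test functions\<close>

text \<open>Gluing a function with a zero of second order at 0 to the zero function.\<close>

lemma DERIV_zero_extend:
  fixes g g' :: "real \<Rightarrow> real"
  assumes g: "\<And>y. y \<ge> 0 \<Longrightarrow> DERIV g y :> g' y" and "g 0 = 0" "g' 0 = 0"
  shows "DERIV (\<lambda>y. if y \<le> 0 then 0 else g y) y :> (if y \<le> 0 then 0 else g' y)"
proof -
  let ?f = "\<lambda>y. if y \<le> 0 then 0 else g y"
  consider "y < 0" | "y > 0" | "y = 0" by linarith
  then show ?thesis
  proof cases
    case 1
    have "DERIV (\<lambda>_. 0) y :> 0" by simp
    then have "DERIV ?f y :> 0"
      by (rule has_field_derivative_transform_within_open[where S = "{..<0}"]) (use 1 in auto)
    with 1 show ?thesis by simp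
  next
    case 2
    have "DERIV g y :> g' y" using 2 by (intro g) simp
    then have "DERIV ?f y :> g' y"
      by (rule has_field_derivative_transform_within_open[where S = "{0<..}"]) (use 2 in auto)
    with 2 show ?thesis by simp
  next
    case 3
    have "(\<lambda>h. (g (0 + h) - g 0) / h) \<midarrow>0\<rightarrow> 0"
      using g[of 0] assms(3) by (simp add: DERIV_def)
    then have "(\<lambda>h. \<bar>(g (0 + h) - g 0) / h\<bar>) \<midarrow>0\<rightarrow> 0"
      by (rule tendsto_rabs_zero)
    then have "(\<lambda>h. (?f (0 + h) - ?f 0) / h) \<midarrow>0\<rightarrow> 0"
      by (rule Lim_null_comparison[rotated]) (auto simp: assms(2) divide_nonneg_nonpos)
    then have "DERIV ?f 0 :> 0" by (simp add: DERIV_def)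
    with 3 show ?thesis by simp
  qed
qed

lemma second_difference_le:
  fixes h h' h'' :: "real \<Rightarrow> real"
  assumes h: "\<And>t. \<bar>t\<bar> \<le> 1 \<Longrightarrow> DERIV h t :> h' t"
    and h': "\<And>t. \<bar>t\<bar> \<le> 1 \<Longrightarrow> DERIV h' t :> h'' t"
    and B: "\<And>t. \<bar>t\<bar> \<le> 1 \<Longrightarrow> \<bar>h'' t\<bar> \<le> B"
  shows "\<bar>2 * h 0 - h 1 - h (- 1)\<bar> \<le> 2 * B"
proof -
  have "\<exists>\<xi>. 0 < \<xi> \<and> \<xi> < 1 \<and> (h 1 + h (- 1)) - (h 0 + h (- 0)) = (1 - 0) * (h' \<xi> - h' (- \<xi>))"
  proof (rule MVT2)
    show "DERIV (\<lambda>t. h t + h (- t)) t :> h' t - h' (- t)" if "0 \<le> t" "t \<le> 1" for t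
    proof -
      have "DERIV (\<lambda>t. h (- t)) t :> h' (- t) * (- 1)"
        using that by (intro DERIV_chain2[OF h]) (auto intro!: derivative_eq_intros)
      from DERIV_add[OF h this] that show ?thesis by simp
    qed
  qed simp
  then obtain \<xi> where \<xi>: "0 < \<xi>" "\<xi> < 1" "h 1 + h (- 1) - 2 * h 0 = h' \<xi> - h' (- \<xi>)"
    by auto
  obtain \<eta> where \<eta>: "- \<xi> < \<eta>" "\<eta> < \<xi>" "h' \<xi> - h' (- \<xi>) = (\<xi> - - \<xi>) * h'' \<eta>"
    using MVT2[of "- \<xi>" \<xi> h' h''] \<xi> h' by force
  have "\<bar>2 * h 0 - h 1 - h (- 1)\<bar> = \<bar>(\<xi> - - \<xi>) * h'' \<eta>\<bar>"
    using \<xi>(3) \<eta>(3) by linarith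
  also have "\<dots> \<le> 2 * B"
    unfolding abs_mult using \<xi> \<eta> B[of \<eta>] by (intro mult_mono) auto
  finally show ?thesis .
qed

text \<open>The symmetric second difference, with the sign of minus the Laplacian.\<close>

definition second_diff :: "('a::euclidean_space \<Rightarrow> real) \<Rightarrow> 'a \<Rightarrow> 'a \<Rightarrow> real" where
  "second_diff f x z = 2 * f x - f (x + z) - f (x - z)"

text \<open>The cube of the positive part, a function of class C^2.\<close>

definition cube_pos :: "real \<Rightarrow> real" where
  "cube_pos y = (if y \<le> 0 then 0 else y ^ 3)"

text \<open>The test function below as a function of q = 1 + |x|^2, with b = \<beta>/2.\<close>

definition cutoff_profile :: "real \<Rightarrow> real \<Rightarrow> real \<Rightarrow> real" where
  "cutoff_profile b m q = q powr (- b) * cube_pos (1 - q / m)"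

text \<open>The derivatives obey the bounds of q^(-b) itself, uniformly in the cut-off parameter m:
  each derivative falling on the cut-off costs 1/m, which is at most 1/q on its support.\<close>

lemma cutoff_profile_derivs:
  assumes b: "b > 0" and m: "m > 0"
  shows "\<exists>F' F''. \<forall>q>0. DERIV (cutoff_profile b m) q :> F' q \<and> DERIV F' q :> F'' q \<and>
     \<bar>F' q\<bar> \<le> (b + 3) * q powr (- b - 1) \<and> \<bar>F'' q\<bar> \<le> (b * (b + 1) + 6 * b + 6) * q powr (- b - 2)"
proof -
  define c1 :: "real \<Rightarrow> real" where "c1 = (\<lambda>y. if y \<le> 0 then 0 else 3 * y\<^sup>2)"
  define c2 :: "real \<Rightarrow> real" where "c2 = (\<lambda>y. if y \<le> 0 then 0 else 6 * y)"
  have d0: "DERIV cube_pos y :> c1 y" for y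
    unfolding cube_pos_def[abs_def] c1_def
    by (rule DERIV_zero_extend) (auto intro!: derivative_eq_intros)
  have d1: "DERIV c1 y :> c2 y" for y
    unfolding c1_def c2_def
    by (rule DERIV_zero_extend) (auto intro!: derivative_eq_intros)
  define F1 where "F1 = (\<lambda>q. - b * q powr (- b - 1) * cube_pos (1 - q / m) - (1 / m) * (q powr (- b) * c1 (1 - q / m)))"
  define F2 where "F2 = (\<lambda>q. b * (b + 1) * q powr (- b - 2) * cube_pos (1 - q / m)
      + (2 * b / m) * (q powr (- b - 1) * c1 (1 - q / m)) + (1 / m\<^sup>2) * (q powr (- b) * c2 (1 - q / m)))"
  have "DERIV (cutoff_profile b m) q :> F1 q \<and> DERIV F1 q :> F2 q \<and>
     \<bar>F1 q\<bar> \<le> (b + 3) * q powr (- b - 1) \<and> \<bar>F2 q\<bar> \<le> (b * (b + 1) + 6 * b + 6) * q powr (- b - 2)" if q: "q > 0" for q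
  proof (intro conjI)
    have dq: "DERIV (\<lambda>q. 1 - q / m) q :> - 1 / m" using m by (auto intro!: derivative_eq_intros)
    have p: "DERIV (\<lambda>q. q powr a) q :> a * q powr (a - 1)" for a
      using q by (rule has_real_derivative_powr)
    show "DERIV (cutoff_profile b m) q :> F1 q"
      unfolding cutoff_profile_def[abs_def] F1_def
      by (rule DERIV_cong[OF DERIV_mult[OF p DERIV_chain2[OF d0 dq]]]) (use m in \<open>simp add: field_simps\<close>)
    have eq: "- b - 1 - 1 = - b - 2" by simp
    show "DERIV F1 q :> F2 q"
      unfolding F1_def F2_def
      by (rule DERIV_cong[OF DERIV_diff[OF DERIV_mult[OF DERIV_cmult[OF p] DERIV_chain2[OF d0 dq]]
            DERIV_cmult[OF DERIV_mult[OF p DERIV_chain2[OF d1 dq]]]]])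
         (use m in \<open>simp add: eq field_simps power2_eq_square\<close>)
    define c where "c = max 0 (1 - q / m)"
    have c: "0 \<le> c" "c \<le> 1" using q m by (auto simp: c_def)
    have cm: "c / m \<le> 1 / q"
    proof (cases "q < m")
      case True
      then have "1 / m \<le> 1 / q" using q by (simp add: frac_le)
      moreover have "c / m \<le> 1 / m" using c m by (simp add: divide_right_mono)
      ultimately show ?thesis by linarith
    next
      case False
      then have "c = 0" using m by (simp add: c_def)
      then show ?thesis using q by simp
    qed
    have e0: "cube_pos (1 - q / m) = c ^ 3" and e1: "c1 (1 - q / m) = 3 * c\<^sup>2" and e2: "c2 (1 - q / m) = 6 * c"
      by (auto simp: cube_pos_def c1_def c2_def c_def)
    have c3: "c ^ 3 \<le> 1" using c by (simp add: power_le_one)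
    have q1: "q powr (- b) * (1 / q) = q powr (- b - 1)"
      using q by (simp add: powr_diff)
    have q2: "q powr (- b - 1) * (1 / q) = q powr (- b - 2)"
      using q by (simp add: powr_diff[of q "- b"] power2_eq_square powr_numeral)
    have t1: "(1 / m) * (q powr (- b) * (3 * c\<^sup>2)) \<le> 3 * q powr (- b - 1)"
    proof -
      have "(1 / m) * (q powr (- b) * (3 * c\<^sup>2)) = 3 * q powr (- b) * (c * (c / m))"
        by (simp add: power2_eq_square)
      also have "\<dots> \<le> 3 * q powr (- b) * (1 * (1 / q))"
        using c cm m by (intro mult_left_mono mult_mono) auto
      finally show ?thesis using q1 by simp
    qed
    have t2: "(2 * b / m) * (q powr (- b - 1) * (3 * c\<^sup>2)) \<le> 6 * b * q powr (- b - 2)"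
    proof -
      have "(2 * b / m) * (q powr (- b - 1) * (3 * c\<^sup>2)) = 6 * b * q powr (- b - 1) * (c * (c / m))"
        by (simp add: power2_eq_square)
      also have "\<dots> \<le> 6 * b * q powr (- b - 1) * (1 * (1 / q))"
        using c cm m b by (intro mult_left_mono mult_mono) auto
      also have "\<dots> = 6 * b * (q powr (- b - 1) * (1 / q))" by simp
      finally show ?thesis unfolding q2 .
    qed
    have t3: "(1 / m\<^sup>2) * (q powr (- b) * (6 * c)) \<le> 6 * q powr (- b - 2)"
    proof (cases "q < m")
      case True
      have "(1 / m\<^sup>2) * (q powr (- b) * (6 * c)) \<le> (1 / q\<^sup>2) * (q powr (- b) * (6 * 1))"
        using True c q m by (intro mult_mono frac_le power_mono) auto
      also have "\<dots> = 6 * q powr (- b - 2)"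
        using q by (simp add: powr_diff powr_numeral)
      finally show ?thesis .
    next
      case False
      then have "c = 0" using m by (simp add: c_def)
      then show ?thesis by simp
    qed
    have t0: "b * q powr (- b - 1) * c ^ 3 \<le> b * q powr (- b - 1) * 1"
      "b * (b + 1) * q powr (- b - 2) * c ^ 3 \<le> b * (b + 1) * q powr (- b - 2) * 1"
      using c3 b by (intro mult_left_mono; simp)+
    have n: "0 \<le> b * q powr (- b - 1) * c ^ 3" "0 \<le> (1 / m) * (q powr (- b) * (3 * c\<^sup>2))"
      "0 \<le> b * (b + 1) * q powr (- b - 2) * c ^ 3" "0 \<le> (2 * b / m) * (q powr (- b - 1) * (3 * c\<^sup>2))"
      "0 \<le> (1 / m\<^sup>2) * (q powr (- b) * (6 * c))"
      using b c m by simp_all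
    show "\<bar>F1 q\<bar> \<le> (b + 3) * q powr (- b - 1)"
      unfolding F1_def e0 e1 using t0(1) t1 n(1,2) by (simp only: distrib_right mult_1_right)
    show "\<bar>F2 q\<bar> \<le> (b * (b + 1) + 6 * b + 6) * q powr (- b - 2)"
      unfolding F2_def e0 e1 e2 using t0(2) t2 t3 n(3,4,5) by (simp only: distrib_right[of "b * (b + 1) + 6 * b"] distrib_right[of "b * (b + 1)"] mult_1_right)
  qed
  then show ?thesis by blast
qed

text \<open>The weight with exponent -\<beta>, cut off to the ball where 1 + |x|^2 < m. These functions are of
  class C^2 and increase with m to the full weight.\<close>

definition test_fun :: "real \<Rightarrow> real \<Rightarrow> 'a::euclidean_space \<Rightarrow> real" where
  "test_fun \<beta> m x = bracket x powr (- \<beta>) * cube_pos (1 - (bracket x)\<^sup>2 / m)"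

lemma cube_pos_nonneg: "0 \<le> cube_pos y"
  by (simp add: cube_pos_def)

lemma cube_pos_le_1: "y \<le> 1 \<Longrightarrow> cube_pos y \<le> 1"
  by (auto simp: cube_pos_def intro: power_le_one)

lemma cube_pos_eq: "cube_pos y = (max 0 y) ^ 3"
  by (auto simp: cube_pos_def)

lemma cube_pos_mono: "x \<le> y \<Longrightarrow> cube_pos x \<le> cube_pos y"
  unfolding cube_pos_eq by (intro power_mono) auto

lemma continuous_on_cube_pos [continuous_intros]:
  "continuous_on A f \<Longrightarrow> continuous_on A (\<lambda>x. cube_pos (f x))"
  unfolding cube_pos_eq by (intro continuous_intros)

lemma test_fun_nonneg: "0 \<le> test_fun \<beta> m x"
  by (simp add: test_fun_def cube_pos_nonneg)

lemma test_fun_le: "m > 0 \<Longrightarrow> test_fun \<beta> m x \<le> bracket x powr (- \<beta>)"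
  by (simp add: test_fun_def mult_left_le cube_pos_le_1)

lemma test_fun_mono: "0 < m \<Longrightarrow> m \<le> m' \<Longrightarrow> test_fun \<beta> m x \<le> test_fun \<beta> m' x"
  by (auto simp: test_fun_def intro!: mult_left_mono cube_pos_mono divide_left_mono)

lemma test_fun_eq_0: "m > 0 \<Longrightarrow> m \<le> (bracket x)\<^sup>2 \<Longrightarrow> test_fun \<beta> m x = 0"
  by (simp add: test_fun_def cube_pos_def)

lemma test_fun_pos: "m > 0 \<Longrightarrow> (bracket x)\<^sup>2 < m \<Longrightarrow> 0 < test_fun \<beta> m x"
  using bracket_pos[of x] by (simp add: test_fun_def cube_pos_def del: bracket_pos)

lemma continuous_on_test_fun: "continuous_on A (test_fun \<beta> m)"
  unfolding test_fun_def[abs_def]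
  by (cases "m = 0") (auto intro!: continuous_intros simp: less_imp_neq[OF bracket_pos, symmetric])

lemma borel_measurable_test_fun [measurable]: "test_fun \<beta> m \<in> borel_measurable borel"
  by (intro borel_measurable_continuous_onI continuous_on_test_fun)

lemma tendsto_test_fun: "(\<lambda>n. test_fun \<beta> (real (Suc n)) x) \<longlonglongrightarrow> bracket x powr (- \<beta>)"
proof -
  have "(\<lambda>n. (bracket x)\<^sup>2 * (1 / real (Suc n))) \<longlonglongrightarrow> (bracket x)\<^sup>2 * 0"
    by (intro tendsto_mult tendsto_const LIMSEQ_Suc lim_1_over_n)
  then have "(\<lambda>n. bracket x powr (- \<beta>) * (max 0 (1 - (bracket x)\<^sup>2 * (1 / real (Suc n)))) ^ 3)
      \<longlonglongrightarrow> bracket x powr (- \<beta>) * (max 0 (1 - 0)) ^ 3"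
    by (intro tendsto_intros) simp
  then show ?thesis by (simp add: test_fun_def cube_pos_eq)
qed

lemma test_fun_eq_profile: "test_fun \<beta> m x = cutoff_profile (\<beta> / 2) m (1 + (norm x)\<^sup>2)"
  by (simp add: test_fun_def cutoff_profile_def powr_bracket bracket_sq)

text \<open>On the segment from x-z to x+z the bracket is at least half its value at x, so the C^2 bound for
  the profile at the points of this segment can be expressed at x.\<close>

lemma second_diff_test_fun_near:
  assumes \<beta>: "0 < \<beta>"
  shows "\<exists>C\<ge>0. \<forall>m>0. \<forall>x z::'a::euclidean_space. norm z \<le> bracket x / 2 \<longrightarrow>
     \<bar>second_diff (test_fun \<beta> m) x z\<bar> \<le> C * (norm z)\<^sup>2 * bracket x powr (- \<beta> - 2)"
proof -
  define b where "b = \<beta> / 2"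
  have b: "b > 0" using \<beta> by (simp add: b_def)
  \<comment> \<open>K bounds the second derivative of the test function along a line: |P'|^2 \<le> 4 |z|^2 P and
    P'' = 2 |z|^2 for the polynomial P below.\<close>
  define K where "K = 4 * (b * (b + 1) + 6 * b + 6) + 2 * (b + 3)"
  have K: "K \<ge> 0" using b by (simp add: K_def)
  have "\<bar>second_diff (test_fun \<beta> m) x z\<bar> \<le> (2 * K * 2 powr (\<beta> + 2)) * (norm z)\<^sup>2 * bracket x powr (- \<beta> - 2)"
    if m: "m > 0" and z: "norm z \<le> bracket x / 2" for m and x z :: 'a
  proof -
    obtain F1 F2 where F: "\<And>q. q > 0 \<Longrightarrow> DERIV (cutoff_profile b m) q :> F1 q"
      "\<And>q. q > 0 \<Longrightarrow> DERIV F1 q :> F2 q"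
      "\<And>q. q > 0 \<Longrightarrow> \<bar>F1 q\<bar> \<le> (b + 3) * q powr (- b - 1)"
      "\<And>q. q > 0 \<Longrightarrow> \<bar>F2 q\<bar> \<le> (b * (b + 1) + 6 * b + 6) * q powr (- b - 2)"
      using cutoff_profile_derivs[OF b m] by metis
    define P where "P = (\<lambda>t. 1 + (norm x)\<^sup>2 + 2 * t * (x \<bullet> z) + t\<^sup>2 * (norm z)\<^sup>2)"
    define P1 where "P1 = (\<lambda>t. 2 * (x \<bullet> z) + 2 * t * (norm z)\<^sup>2)"
    have P: "P t = 1 + (norm (x + t *\<^sub>R z))\<^sup>2" for t
      unfolding P_def power2_norm_eq_inner
      by (simp add: inner_add_left inner_add_right inner_commute[of z x] power2_eq_square algebra_simps del: dot_square_norm)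
    have P1: "P1 t = 2 * ((x + t *\<^sub>R z) \<bullet> z)" for t
      by (simp add: P1_def power2_norm_eq_inner inner_add algebra_simps)
    have Pb: "P t = (bracket (x + t *\<^sub>R z))\<^sup>2" for t by (simp add: P bracket_sq)
    have Ppos: "P t > 0" for t by (simp add: P add_pos_nonneg)
    have dP: "DERIV P t :> P1 t" "DERIV P1 t :> 2 * (norm z)\<^sup>2" for t
      unfolding P_def P1_def by (auto intro!: derivative_eq_intros)
    define h where "h = (\<lambda>t. cutoff_profile b m (P t))"
    define h1 where "h1 = (\<lambda>t. F1 (P t) * P1 t)"
    define h2 where "h2 = (\<lambda>t. F2 (P t) * P1 t * P1 t + 2 * (norm z)\<^sup>2 * F1 (P t))"
    have "\<bar>2 * h 0 - h 1 - h (- 1)\<bar> \<le> 2 * (K * (norm z)\<^sup>2 * (2 powr (\<beta> + 2) * bracket x powr (- \<beta> - 2)))"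
    proof (rule second_difference_le)
      fix t :: real assume t: "\<bar>t\<bar> \<le> 1"
      show "DERIV h t :> h1 t"
        unfolding h_def h1_def by (intro DERIV_chain2[OF F(1)] Ppos dP)
      show "DERIV h1 t :> h2 t"
        unfolding h1_def h2_def
        by (rule DERIV_cong[OF DERIV_mult[OF DERIV_chain2[OF F(2)[OF Ppos] dP(1)] dP(2)]]) simp
      have "P1 t * P1 t \<le> 4 * (norm z)\<^sup>2 * P t"
      proof -
        have "((x + t *\<^sub>R z) \<bullet> z)\<^sup>2 \<le> (norm (x + t *\<^sub>R z))\<^sup>2 * (norm z)\<^sup>2"
          by (metis Cauchy_Schwarz_ineq power2_norm_eq_inner)
        also have "\<dots> \<le> P t * (norm z)\<^sup>2" by (intro mult_right_mono) (auto simp: P)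
        finally show ?thesis by (simp add: P1 power2_eq_square mult_ac)
      qed
      then have a: "\<bar>F2 (P t) * P1 t * P1 t\<bar> \<le> ((b * (b + 1) + 6 * b + 6) * P t powr (- b - 2)) * (4 * (norm z)\<^sup>2 * P t)"
        using mult_mono[OF F(4)[OF Ppos[of t]], of "P1 t * P1 t" "4 * (norm z)\<^sup>2 * P t"] b
        by (simp add: abs_mult mult.assoc)
      have b2: "\<bar>2 * (norm z)\<^sup>2 * F1 (P t)\<bar> \<le> 2 * (norm z)\<^sup>2 * ((b + 3) * P t powr (- b - 1))"
        unfolding abs_mult using F(3)[OF Ppos[of t]] by (intro mult_mono) auto
      have "P t powr (- b - 2) * P t = P t powr (- b - 1)"
      proof -
        have "P t powr (- b - 2) * P t powr 1 = P t powr ((- b - 2) + 1)" by (simp only: powr_add)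
        also have "(- b - 2) + 1 = - b - 1" by simp
        finally show ?thesis using Ppos[of t] by simp
      qed
      then have "((b * (b + 1) + 6 * b + 6) * P t powr (- b - 2)) * (4 * (norm z)\<^sup>2 * P t) =
         4 * (b * (b + 1) + 6 * b + 6) * (norm z)\<^sup>2 * P t powr (- b - 1)"
      proof -
        have "(k * A) * (4 * n * p) = 4 * k * n * (A * p)" for k A n p :: real by simp
        then show ?thesis by (simp only: \<open>P t powr (- b - 2) * P t = P t powr (- b - 1)\<close>)
      qed
      then have "\<bar>h2 t\<bar> \<le> 4 * (b * (b + 1) + 6 * b + 6) * (norm z)\<^sup>2 * P t powr (- b - 1) + 2 * (norm z)\<^sup>2 * ((b + 3) * P t powr (- b - 1))"
        unfolding h2_def using a b2 by linarith
      also have "\<dots> = K * (norm z)\<^sup>2 * P t powr (- b - 1)"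
        by (simp add: K_def algebra_simps)
      also have "\<dots> \<le> K * (norm z)\<^sup>2 * (2 powr (\<beta> + 2) * bracket x powr (- \<beta> - 2))"
      proof (rule mult_left_mono)
        have "norm (t *\<^sub>R z) \<le> norm z" using t by (simp add: mult_left_le_one_le)
        then have "bracket x / 2 \<le> bracket (x + t *\<^sub>R z)"
          using bracket_le_add[of x "t *\<^sub>R z"] z by linarith
        then have "bracket (x + t *\<^sub>R z) powr (- \<beta> - 2) \<le> (bracket x / 2) powr (- \<beta> - 2)"
          using \<beta> by (intro powr_mono2') auto
        also have "\<dots> = bracket x powr (- \<beta> - 2) * (1 / 2) powr (- \<beta> - 2)"
          using powr_mult[of "bracket x" "1 / 2" "- \<beta> - 2"] by simp
        also have "(1 / 2 :: real) powr (- \<beta> - 2) = 2 powr (\<beta> + 2)"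
        proof -
          have "(1 / 2 :: real) powr (- \<beta> - 2) = (2 powr (- 1)) powr (- \<beta> - 2)"
            by (simp add: powr_minus_divide)
          also have "\<dots> = 2 powr ((- 1) * (- \<beta> - 2))" by (rule powr_powr)
          also have "(- 1) * (- \<beta> - 2) = \<beta> + 2" by simp
          finally show ?thesis .
        qed
        also have "bracket (x + t *\<^sub>R z) powr (- \<beta> - 2) = P t powr (- b - 1)"
          unfolding powr_bracket P b_def by (rule arg_cong[where f = "\<lambda>a. _ powr a"]) simp
        finally show "P t powr (- b - 1) \<le> 2 powr (\<beta> + 2) * bracket x powr (- \<beta> - 2)"
          by (simp add: mult.commute)
        show "0 \<le> K * (norm z)\<^sup>2" using K by simp
      qed
      finally show "\<bar>h2 t\<bar> \<le> K * (norm z)\<^sup>2 * (2 powr (\<beta> + 2) * bracket x powr (- \<beta> - 2))" .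
    qed
    moreover have "h 0 = test_fun \<beta> m x" "h 1 = test_fun \<beta> m (x + z)" "h (- 1) = test_fun \<beta> m (x - z)"
      by (simp_all add: h_def test_fun_eq_profile b_def P)
    ultimately show ?thesis by (simp add: second_diff_def mult_ac)
  qed
  moreover have "0 \<le> 2 * K * 2 powr (\<beta> + 2)" using K by simp
  ultimately show ?thesis by blast
qed

lemma second_diff_test_fun_bound:
  assumes \<beta>: "0 < \<beta>"
  shows "\<exists>C\<ge>0. \<forall>m>0. \<forall>x z::'a::euclidean_space.
     \<bar>second_diff (test_fun \<beta> m) x z * frac_kernel s z\<bar> \<le> diff_bound C s \<beta> x z"
proof -
  obtain C where C: "C \<ge> 0" "\<And>m x z::'a. m > 0 \<Longrightarrow> norm z \<le> bracket x / 2 \<Longrightarrow>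
     \<bar>second_diff (test_fun \<beta> m) x z\<bar> \<le> C * (norm z)\<^sup>2 * bracket x powr (- \<beta> - 2)"
    using second_diff_test_fun_near[OF \<beta>, where 'a = 'a] by blast
  have "\<bar>second_diff (test_fun \<beta> m) x z * frac_kernel s z\<bar> \<le> diff_bound C s \<beta> x z" if m: "m > 0" for m and x z :: 'a
  proof -
    have "\<bar>second_diff (test_fun \<beta> m) x z\<bar> \<le> 2 * bracket x powr (- \<beta>) + bracket (x + z) powr (- \<beta>) + bracket (x - z) powr (- \<beta>)"
      using test_fun_le[OF m, of \<beta> x] test_fun_le[OF m, of \<beta> "x + z"] test_fun_le[OF m, of \<beta> "x - z"]
        test_fun_nonneg[of \<beta> m x] test_fun_nonneg[of \<beta> m "x + z"] test_fun_nonneg[of \<beta> m "x - z"]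
      unfolding second_diff_def by linarith
    then show ?thesis
      unfolding diff_bound_def abs_mult using C(2)[OF m, of z x]
      by (auto intro!: mult_right_mono simp del: mult_le_cancel_right)
  qed
  with C(1) show ?thesis by blast
qed

section \<open>The fractional Laplacian of the test functions\<close>

text \<open>The fractional Laplacian without its constant, written with second differences. For functions of
  class C^2 the integral converges absolutely and no principal value is needed.\<close>

definition frac_op :: "real \<Rightarrow> ('a::euclidean_space \<Rightarrow> real) \<Rightarrow> 'a \<Rightarrow> real" where
  "frac_op s f x = (\<integral>z. second_diff f x z * frac_kernel s z \<partial>lborel) / 2"

text \<open>The kernel with the closed ball of radius \<epsilon> removed, which is integrable.\<close>

definition cut_kernel :: "real \<Rightarrow> real \<Rightarrow> 'a::euclidean_space \<Rightarrow> real" where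
  "cut_kernel s \<epsilon> z = frac_kernel s z * indicator {z. \<epsilon> < norm z} z"

text \<open>The truncated fractional Laplacian whose limit for \<epsilon> tending to 0 is the principal value.\<close>

definition trunc_op :: "real \<Rightarrow> real \<Rightarrow> ('a::euclidean_space \<Rightarrow> real) \<Rightarrow> 'a \<Rightarrow> real" where
  "trunc_op s \<epsilon> f x = (\<integral>z. (f x - f (x + z)) * cut_kernel s \<epsilon> z \<partial>lborel)"

lemma borel_measurable_cut_kernel [measurable]: "cut_kernel s \<epsilon> \<in> borel_measurable borel"
  unfolding cut_kernel_def[abs_def] by measurable

lemma cut_kernel_nonneg [simp]: "0 \<le> cut_kernel s \<epsilon> z"
  by (simp add: cut_kernel_def)

lemma cut_kernel_le: "cut_kernel s \<epsilon> z \<le> frac_kernel s z"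
  by (simp add: cut_kernel_def indicator_def)

lemma cut_kernel_uminus [simp]: "cut_kernel s \<epsilon> (- z) = cut_kernel s \<epsilon> z"
  by (simp add: cut_kernel_def indicator_def)

lemma integrable_cut_kernel:
  assumes "0 < s" "0 < \<epsilon>"
  shows "integrable lborel (cut_kernel s \<epsilon> :: 'a::euclidean_space \<Rightarrow> real)"
proof (rule integrableI_nonneg)
  have "(\<integral>\<^sup>+z. ennreal (cut_kernel s \<epsilon> (z::'a)) \<partial>lborel) \<le> (\<integral>\<^sup>+z. ennreal (frac_kernel s (z::'a)) * indicator {z. \<epsilon> \<le> norm z} z \<partial>lborel)"
    by (intro nn_integral_mono) (auto simp: cut_kernel_def split: split_indicator)
  also have "\<dots> < \<infinity>" using nn_integral_frac_kernel_far[OF assms, where 'a = 'a] by simp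
  finally show "(\<integral>\<^sup>+z. ennreal (cut_kernel s \<epsilon> (z::'a)) \<partial>lborel) < \<infinity>" .
qed auto

lemma integrable_lborel_uminus:
  fixes f :: "'a::euclidean_space \<Rightarrow> real"
  assumes "integrable lborel f"
  shows "integrable lborel (\<lambda>z. f (- z))" "(\<integral>z. f (- z) \<partial>lborel) = (\<integral>z. f z \<partial>lborel)"
proof -
  have [measurable]: "f \<in> borel_measurable borel" using assms by auto
  have "integrable (distr lborel borel uminus) f" using assms by (simp add: lborel_distr_uminus_euclidean)
  then show "integrable lborel (\<lambda>z. f (- z))" by (subst (asm) integrable_distr_eq) auto
  have "(\<integral>z. f z \<partial>lborel) = (\<integral>z. f z \<partial>distr lborel borel (uminus :: 'a \<Rightarrow> 'a))"
    by (simp add: lborel_distr_uminus_euclidean)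
  also have "\<dots> = (\<integral>z. f (- z) \<partial>lborel)" by (subst integral_distr) auto
  finally show "(\<integral>z. f (- z) \<partial>lborel) = (\<integral>z. f z \<partial>lborel)" by simp
qed

lemma trunc_op_eq_second_diff:
  fixes f :: "'a::euclidean_space \<Rightarrow> real"
  assumes "integrable lborel (\<lambda>z. (f x - f (x + z)) * cut_kernel s \<epsilon> z)"
  shows "integrable lborel (\<lambda>z. second_diff f x z * cut_kernel s \<epsilon> z)"
    and "trunc_op s \<epsilon> f x = (\<integral>z. second_diff f x z * cut_kernel s \<epsilon> z \<partial>lborel) / 2"
proof -
  let ?g = "\<lambda>z. (f x - f (x + z)) * cut_kernel s \<epsilon> z"
  have eq: "second_diff f x z * cut_kernel s \<epsilon> z = ?g z + ?g (- z)" for z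
    by (simp add: second_diff_def algebra_simps)
  note m = integrable_lborel_uminus[OF assms]
  show "integrable lborel (\<lambda>z. second_diff f x z * cut_kernel s \<epsilon> z)"
    unfolding eq by (intro Bochner_Integration.integrable_add assms m)
  show "trunc_op s \<epsilon> f x = (\<integral>z. second_diff f x z * cut_kernel s \<epsilon> z \<partial>lborel) / 2"
    unfolding eq by (subst Bochner_Integration.integral_add[OF assms m(1)]) (simp only: m(2) trunc_op_def, simp)
qed

lemma integrable_bounded_cut_kernel:
  fixes f :: "'a::euclidean_space \<Rightarrow> real"
  assumes "0 < s" "0 < \<epsilon>" and [measurable]: "f \<in> borel_measurable borel" and B: "\<And>x. \<bar>f x\<bar> \<le> B"
  shows "integrable lborel (\<lambda>z. f z * cut_kernel s \<epsilon> z)"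
proof (rule Bochner_Integration.integrable_bound[OF integrable_mult_right[OF integrable_cut_kernel[OF assms(1,2)], of B]])
  show "AE z in lborel. norm (f z * cut_kernel s \<epsilon> z) \<le> norm (B * cut_kernel s \<epsilon> z)"
    using B by (intro AE_I2) (auto simp: abs_mult intro!: mult_right_mono intro: order_trans[OF _ abs_ge_self])
qed measurable

lemma borel_measurable_frac_op [measurable]:
  fixes f :: "'a::euclidean_space \<Rightarrow> real"
  assumes [measurable]: "f \<in> borel_measurable borel"
  shows "frac_op s f \<in> borel_measurable borel"
  unfolding frac_op_def[abs_def] second_diff_def by measurable

lemma borel_measurable_trunc_op [measurable]:
  fixes f :: "'a::euclidean_space \<Rightarrow> real"
  assumes [measurable]: "f \<in> borel_measurable borel"
  shows "trunc_op s \<epsilon> f \<in> borel_measurable borel"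
  unfolding trunc_op_def[abs_def] by measurable

lemma tendsto_cut_kernel:
  "(\<lambda>n. cut_kernel s (1 / real (Suc n)) z) \<longlonglongrightarrow> frac_kernel s (z::'a::euclidean_space)"
proof (cases "z = 0")
  case True
  then show ?thesis by (simp add: cut_kernel_def frac_kernel_def)
next
  case False
  have "(\<lambda>n. 1 / real (Suc n)) \<longlonglongrightarrow> 0"
    by (rule LIMSEQ_Suc[OF lim_1_over_n])
  then have "eventually (\<lambda>n. 1 / real (Suc n) < norm z) sequentially"
    by (rule order_tendstoD) (use False in auto)
  then have "eventually (\<lambda>n. cut_kernel s (1 / real (Suc n)) z = frac_kernel s z) sequentially"
    by eventually_elim (simp add: cut_kernel_def)
  then show ?thesis by (rule tendsto_eventually)
qed

lemma test_fun_le_1: "0 < \<beta> \<Longrightarrow> 0 < m \<Longrightarrow> test_fun \<beta> m x \<le> 1"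
  using test_fun_le[of m \<beta> x] bracket_ge_1[of x] powr_mono[of "- \<beta>" 0 "bracket x"] by simp

text \<open>One constant K serves all test functions and all truncations. Everything follows from the common
  integrable bound \<^term>\<open>diff_bound C s \<beta> x\<close> by dominated convergence.\<close>

lemma frac_op_test_fun_bounds:
  assumes s: "0 < s" "s < 1" and \<beta>: "0 < \<beta>"
  shows "\<exists>K\<ge>0. (\<forall>m>0. \<forall>x::'a::euclidean_space.
     \<bar>frac_op s (test_fun \<beta> m) x\<bar> \<le> K * op_weight s \<beta> x \<and>
     (\<forall>\<epsilon>>0. \<bar>trunc_op s \<epsilon> (test_fun \<beta> m) x\<bar> \<le> K * op_weight s \<beta> x) \<and>
     (\<lambda>n. trunc_op s (1 / real (Suc n)) (test_fun \<beta> m) x) \<longlonglongrightarrow> frac_op s (test_fun \<beta> m) x) \<and>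
     (\<forall>x::'a. integrable lborel (\<lambda>z. second_diff (\<lambda>y. bracket y powr (- \<beta>)) x z * frac_kernel s z) \<and>
     (\<lambda>n. frac_op s (test_fun \<beta> (real (Suc n))) x) \<longlonglongrightarrow> frac_op s (\<lambda>y. bracket y powr (- \<beta>)) x)"
proof -
  obtain C where C: "C \<ge> 0" "\<And>m x z::'a. m > 0 \<Longrightarrow>
      \<bar>second_diff (test_fun \<beta> m) x z * frac_kernel s z\<bar> \<le> diff_bound C s \<beta> x z"
    using second_diff_test_fun_bound[OF \<beta>, where 'a = 'a and s = s] by metis
  obtain K where K: "K \<ge> 0" "\<And>x::'a. (\<integral>\<^sup>+z. ennreal (diff_bound C s \<beta> x z) \<partial>lborel) \<le> ennreal (K * op_weight s \<beta> x)"
    using nn_integral_diff_bound[OF s \<beta> C(1), where 'a = 'a] by blast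
  have int: "integrable lborel (diff_bound C s \<beta> x)" for x :: 'a
  proof (rule integrableI_nonneg)
    show "(\<integral>\<^sup>+z. ennreal (diff_bound C s \<beta> x z) \<partial>lborel) < \<infinity>"
      using K(2)[of x] by (rule le_less_trans) simp
  qed (auto simp: diff_bound_nonneg C(1))
  have intle: "(\<integral>z. diff_bound C s \<beta> x z \<partial>lborel) \<le> K * op_weight s \<beta> x" for x :: 'a
    using K(2)[of x] K(1) op_weight_nonneg[of s \<beta> x] int[of x]
    by (subst (asm) nn_integral_eq_integral) (auto simp: diff_bound_nonneg C(1))
  have [measurable]: "(\<lambda>z. second_diff (test_fun \<beta> m) x z) \<in> borel_measurable borel" for m and x :: 'a
    unfolding second_diff_def by measurable
  have [measurable]: "(\<lambda>z. second_diff (\<lambda>y. bracket y powr (- \<beta>)) x z) \<in> borel_measurable borel" for x :: 'a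
    unfolding second_diff_def by measurable
  have bound: "\<bar>\<integral>z. f z \<partial>lborel\<bar> \<le> K * op_weight s \<beta> x"
    if "f \<in> borel_measurable borel" "\<And>z. \<bar>f z\<bar> \<le> diff_bound C s \<beta> x z" for f and x :: 'a
  proof -
    have "integrable lborel f"
      using that by (intro Bochner_Integration.integrable_bound[OF int[of x]])
        (auto intro: order_trans[OF _ abs_ge_self])
    then have "\<bar>\<integral>z. f z \<partial>lborel\<bar> \<le> (\<integral>z. diff_bound C s \<beta> x z \<partial>lborel)"
      using Bochner_Integration.integral_norm_bound_integral[OF _ int[of x], of f] that(2) by simp
    with intle[of x] show ?thesis by linarith
  qed
  have Kw: "0 \<le> K * op_weight s \<beta> x" for x :: 'a using K(1) op_weight_nonneg by (rule mult_nonneg_nonneg)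
  have cut: "\<bar>second_diff (test_fun \<beta> m) x z * cut_kernel s \<epsilon> z\<bar> \<le> diff_bound C s \<beta> x z" if m: "m > 0" for m \<epsilon> and x z :: 'a
  proof -
    have "\<bar>second_diff (test_fun \<beta> m) x z * cut_kernel s \<epsilon> z\<bar> \<le> \<bar>second_diff (test_fun \<beta> m) x z * frac_kernel s z\<bar>"
      by (auto simp: abs_mult intro!: mult_left_mono cut_kernel_le)
    with C(2)[OF m, of x z] show ?thesis by linarith
  qed
  have eq: "trunc_op s \<epsilon> (test_fun \<beta> m) x = (\<integral>z. second_diff (test_fun \<beta> m) x z * cut_kernel s \<epsilon> z \<partial>lborel) / 2"
    if "m > 0" "\<epsilon> > 0" for m \<epsilon> and x :: 'a
  proof (rule trunc_op_eq_second_diff(2))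
    have "\<bar>test_fun \<beta> m x - test_fun \<beta> m (x + z)\<bar> \<le> 1" for z
      using test_fun_le_1[OF \<beta> that(1), of x] test_fun_le_1[OF \<beta> that(1), of "x + z"]
        test_fun_nonneg[of \<beta> m x] test_fun_nonneg[of \<beta> m "x + z"] by linarith
    then show "integrable lborel (\<lambda>z. (test_fun \<beta> m x - test_fun \<beta> m (x + z)) * cut_kernel s \<epsilon> z)"
      using s that by (intro integrable_bounded_cut_kernel) auto
  qed
  have b1: "\<bar>frac_op s (test_fun \<beta> m) x\<bar> \<le> K * op_weight s \<beta> x" if m: "m > 0" for m and x :: 'a
    using bound[OF _ C(2)[OF m], where x = x] Kw[of x] by (simp add: frac_op_def)
  have b2: "\<bar>trunc_op s \<epsilon> (test_fun \<beta> m) x\<bar> \<le> K * op_weight s \<beta> x" if m: "m > 0" and e: "\<epsilon> > 0" for m \<epsilon> and x :: 'a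
    using bound[OF _ cut[OF m, where \<epsilon> = \<epsilon>], where x = x] Kw[of x] by (simp add: eq[OF m e])
  have l1: "(\<lambda>n. trunc_op s (1 / real (Suc n)) (test_fun \<beta> m) x) \<longlonglongrightarrow> frac_op s (test_fun \<beta> m) x"
    if m: "m > 0" for m and x :: 'a
  proof -
    have "(\<lambda>n. \<integral>z. second_diff (test_fun \<beta> m) x z * cut_kernel s (1 / real (Suc n)) z \<partial>lborel)
      \<longlonglongrightarrow> (\<integral>z. second_diff (test_fun \<beta> m) x z * frac_kernel s z \<partial>lborel)"
    proof (rule integral_dominated_convergence[where w = "diff_bound C s \<beta> x"])
      show "AE z in lborel. (\<lambda>n. second_diff (test_fun \<beta> m) x z * cut_kernel s (1 / real (Suc n)) z)
          \<longlonglongrightarrow> second_diff (test_fun \<beta> m) x z * frac_kernel s z"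
        by (intro AE_I2 tendsto_mult tendsto_const tendsto_cut_kernel)
      show "AE z in lborel. norm (second_diff (test_fun \<beta> m) x z * cut_kernel s (1 / real (Suc n)) z) \<le> diff_bound C s \<beta> x z" for n
        using cut[OF m, of x _ "1 / real (Suc n)"] by simp
    qed (use int in auto)
    then show ?thesis unfolding frac_op_def
      by (subst eq) (use m in \<open>auto intro!: tendsto_divide\<close>)
  qed
  have lsd: "(\<lambda>n. second_diff (test_fun \<beta> (real (Suc n))) x z * frac_kernel s z) \<longlonglongrightarrow>
        second_diff (\<lambda>y. bracket y powr (- \<beta>)) x z * frac_kernel s z" for x z :: 'a
    unfolding second_diff_def by (intro tendsto_intros tendsto_test_fun)
  have sd: "\<bar>second_diff (\<lambda>y. bracket y powr (- \<beta>)) x z * frac_kernel s z\<bar> \<le> diff_bound C s \<beta> x z" for x z :: 'a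
    using C(2) by (intro tendsto_upperbound[OF tendsto_rabs[OF lsd]] always_eventually allI) auto
  have i2: "integrable lborel (\<lambda>z. second_diff (\<lambda>y. bracket y powr (- \<beta>)) x z * frac_kernel s z)" for x :: 'a
    using sd by (intro Bochner_Integration.integrable_bound[OF int[of x]])
        (auto intro: order_trans[OF _ abs_ge_self])
  have l2: "(\<lambda>n. frac_op s (test_fun \<beta> (real (Suc n))) x) \<longlonglongrightarrow> frac_op s (\<lambda>y. bracket y powr (- \<beta>)) x" for x :: 'a
    unfolding frac_op_def
  proof (intro tendsto_divide tendsto_const integral_dominated_convergence[where w = "diff_bound C s \<beta> x"])
    show "AE z in lborel. (\<lambda>n. second_diff (test_fun \<beta> (real (Suc n))) x z * frac_kernel s z) \<longlonglongrightarrow>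
        second_diff (\<lambda>y. bracket y powr (- \<beta>)) x z * frac_kernel s z"
      by (intro AE_I2 lsd)
    show "AE z in lborel. norm (second_diff (test_fun \<beta> (real (Suc n))) x z * frac_kernel s z) \<le> diff_bound C s \<beta> x z" for n
      using C(2)[of "real (Suc n)" x] by simp
  qed (use int in auto)
  show ?thesis using K(1) b1 b2 l1 i2 l2 by (intro exI[of _ K]) auto
qed

section \<open>Superharmonicity of the critical weight\<close>

text \<open>The density of the centred normal distribution with covariance v times the identity.\<close>

definition gauss :: "real \<Rightarrow> 'a::euclidean_space \<Rightarrow> real" where
  "gauss v x = (\<Prod>b\<in>Basis. normal_density 0 (sqrt v) (x \<bullet> b))"

lemma gauss_nonneg [simp]: "0 \<le> gauss v x"
  by (simp add: gauss_def prod_nonneg)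

lemma gauss_uminus [simp]: "gauss v (- x) = gauss v x"
  by (simp add: gauss_def normal_density_def)

lemma gauss_eq:
  assumes "v > 0"
  shows "gauss v (x::'a::euclidean_space) = (2 * pi * v) powr (- real DIM('a) / 2) * exp (- (norm x)\<^sup>2 / (2 * v))"
proof -
  have "gauss v x = (\<Prod>b\<in>(Basis::'a set). (2 * pi * v) powr (- 1 / 2) * exp (- (x \<bullet> b)\<^sup>2 / (2 * v)))"
  proof -
    have "(2 * pi * v) powr (- 1 / 2) = 1 / sqrt (2 * pi * v)"
      using assms powr_minus_divide[of "2 * pi * v" "1 / 2"] by (simp add: powr_half_sqrt)
    then have "normal_density 0 (sqrt v) t = (2 * pi * v) powr (- 1 / 2) * exp (- t\<^sup>2 / (2 * v))" for t
      using assms by (simp add: normal_density_def)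
    then show ?thesis by (simp only: gauss_def)
  qed
  also have "\<dots> = ((2 * pi * v) powr (- 1 / 2)) ^ DIM('a) * exp (\<Sum>b\<in>Basis. - (x \<bullet> b)\<^sup>2 / (2 * v))"
    by (simp add: prod.distrib exp_sum)
  also have "((2 * pi * v) powr (- 1 / 2)) ^ DIM('a) = (2 * pi * v) powr (- real DIM('a) / 2)"
    using assms by (simp add: powr_realpow[symmetric] powr_powr)
  also have "(\<Sum>b\<in>Basis. - (x \<bullet> b)\<^sup>2 / (2 * v)) = - (norm x)\<^sup>2 / (2 * v)"
    unfolding power2_norm_eq_inner euclidean_inner[of x x]
    by (simp add: power2_eq_square sum_negf sum_divide_distrib)
  finally show ?thesis .
qed

lemma borel_measurable_gauss_pair [measurable]:
  "(\<lambda>(v, x). gauss v (x::'a::euclidean_space)) \<in> borel_measurable (borel \<Otimes>\<^sub>M borel)"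
  unfolding gauss_def normal_density_def by measurable

lemma borel_measurable_gauss [measurable (raw)]:
  assumes [measurable]: "f \<in> borel_measurable M" "g \<in> borel_measurable M"
  shows "(\<lambda>x. gauss (f x) (g x :: 'a::euclidean_space)) \<in> borel_measurable M"
  using measurable_compose[OF measurable_Pair[OF assms] borel_measurable_gauss_pair] by simp

lemma nn_integral_gauss:
  assumes "v > 0"
  shows "(\<integral>\<^sup>+x. ennreal (gauss v (x::'a::euclidean_space)) \<partial>lborel) = 1"
proof -
  have one: "(\<integral>\<^sup>+x. ennreal (normal_density 0 (sqrt v) x) \<partial>lborel) = 1"
    using integrable_normal_density[of "sqrt v" 0] integral_normal_density[of "sqrt v" 0] assms
    by (subst nn_integral_eq_integral) auto
  have "(\<integral>\<^sup>+x. ennreal (gauss v (x::'a)) \<partial>lborel) =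
      (\<integral>\<^sup>+x. (\<Prod>b\<in>Basis. ennreal (normal_density 0 (sqrt v) ((x::'a) \<bullet> b))) \<partial>lborel)"
    unfolding gauss_def by (simp add: prod_ennreal)
  also have "\<dots> = (\<Prod>b\<in>(Basis::'a set). (\<integral>\<^sup>+x. ennreal (normal_density 0 (sqrt v) x) \<partial>lborel))"
    by (rule nn_integral_lborel_prod) auto
  finally show ?thesis by (simp add: one)
qed

lemma nn_integral_gauss_convolution:
  assumes v: "v > 0" and w: "w > 0"
  shows "(\<integral>\<^sup>+z. ennreal (gauss v (x + z) * gauss w z) \<partial>lborel) = ennreal (gauss (v + w) (x::'a::euclidean_space))"
proof -
  have one: "(\<integral>\<^sup>+y. ennreal (normal_density 0 (sqrt v) (a - y) * normal_density 0 (sqrt w) y) \<partial>lborel) =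
      ennreal (normal_density 0 (sqrt (v + w)) a)" for a
    using fun_cong[OF conv_normal_density_zero_mean[of "sqrt v" "sqrt w"], of a] v w by simp
  have "(\<integral>\<^sup>+z. ennreal (gauss v (x + z) * gauss w z) \<partial>lborel) = (\<integral>\<^sup>+z. ennreal (gauss v (x - z) * gauss w z) \<partial>lborel)"
    using nn_integral_lborel_uminus[of "\<lambda>z. ennreal (gauss v (x + z) * gauss w z)"] by simp
  also have "\<dots> = (\<integral>\<^sup>+z. (\<Prod>b\<in>Basis. ennreal (normal_density 0 (sqrt v) (x \<bullet> b - (z::'a) \<bullet> b) * normal_density 0 (sqrt w) (z \<bullet> b))) \<partial>lborel)"
    unfolding gauss_def by (subst prod_ennreal) (auto simp: prod.distrib inner_diff_left)
  also have "\<dots> = (\<Prod>b\<in>(Basis::'a set). (\<integral>\<^sup>+y. ennreal (normal_density 0 (sqrt v) (x \<bullet> b - y) * normal_density 0 (sqrt w) y) \<partial>lborel))"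
    by (rule nn_integral_lborel_prod[where f = "\<lambda>b y. ennreal (normal_density 0 (sqrt v) (x \<bullet> b - y) * normal_density 0 (sqrt w) y)"]) auto
  also have "\<dots> = ennreal (gauss (v + w) x)"
    unfolding one gauss_def by (simp add: prod_ennreal)
  finally show ?thesis .
qed

text \<open>By scaling, the integral is a constant times a power of q; the constant is Gamma(b) 2^b, but
  only its being positive and finite matters.\<close>

lemma nn_integral_inverse_gamma:
  assumes b: "b > 0"
  shows "\<exists>K>0. \<forall>q>0. (\<integral>\<^sup>+v. ennreal (v powr (- b - 1) * exp (- q / (2 * v))) * indicator {0<..} v \<partial>lborel) = ennreal (K * q powr (- b))"
proof -
  let ?g = "\<lambda>q v. ennreal (v powr (- b - 1) * exp (- q / (2 * v))) * indicator {0<..} v"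
  define I where "I = (\<integral>\<^sup>+v. ?g 1 v \<partial>lborel)"
  have scale: "(\<integral>\<^sup>+v. ?g q v \<partial>lborel) = ennreal (q powr (- b)) * I" if q: "q > 0" for q
  proof -
    have "(\<integral>\<^sup>+v. ?g q v \<partial>lborel) = \<bar>q\<bar> * (\<integral>\<^sup>+v. ?g q (0 + q * v) \<partial>lborel)"
      using q by (intro nn_integral_real_affine) auto
    also have "(\<integral>\<^sup>+v. ?g q (0 + q * v) \<partial>lborel) = (\<integral>\<^sup>+v. ennreal (q powr (- b - 1)) * ?g 1 v \<partial>lborel)"
    proof (rule nn_integral_cong)
      fix v :: real
      show "?g q (0 + q * v) = ennreal (q powr (- b - 1)) * ?g 1 v"
      proof (cases "v > 0")
        case True
        then show ?thesis using q
          by (simp add: powr_mult ennreal_mult'[symmetric] mult.assoc)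
      next
        case False
        then show ?thesis using q by (simp add: zero_less_mult_iff)
      qed
    qed
    also have "\<dots> = ennreal (q powr (- b - 1)) * I"
      unfolding I_def by (intro nn_integral_cmult) auto
    also have "ennreal \<bar>q\<bar> * (ennreal (q powr (- b - 1)) * I) = ennreal (q powr (- b)) * I"
    proof -
      have "q * q powr (- b - 1) = q powr (- b)"
        using q powr_add[of q 1 "- b - 1"] by simp
      then show ?thesis using q by (simp add: mult.assoc[symmetric] ennreal_mult'[symmetric])
    qed
    finally show ?thesis .
  qed
  have fin: "I < \<infinity>"
  proof -
    \<comment> \<open>Near 0 the power v^n that bounds the exponential compensates v^(-b-1).\<close>
    define n where "n = nat \<lceil>b + 1\<rceil>"
    have n: "b + 1 \<le> real n" using b unfolding n_def by linarith
    then have n0: "n > 0" using b by simp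
    have e: "exp (- (1 / (2 * v))) \<le> (2 * real n) ^ n * v ^ n" if v: "v > 0" for v :: real
    proof -
      have "1 / (2 * v * real n) \<le> exp (1 / (2 * v * real n))"
        using exp_ge_add_one_self[of "1 / (2 * v * real n)"] by linarith
      then have "(1 / (2 * v * real n)) ^ n \<le> exp (1 / (2 * v * real n)) ^ n"
        using v by (intro power_mono) auto
      also have "\<dots> = exp (1 / (2 * v))"
        using n0 by (simp add: exp_of_nat_mult[symmetric])
      finally show ?thesis using v n0
        by (simp add: exp_minus field_simps)
    qed
    have "I \<le> (\<integral>\<^sup>+v. ennreal ((2 * real n) ^ n) * indicator {0..1} v + ennreal (v powr (- b - 1)) * indicator {1..} v \<partial>lborel)"
      unfolding I_def
    proof (rule nn_integral_mono)
      fix v :: real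
      show "?g 1 v \<le> ennreal ((2 * real n) ^ n) * indicator {0..1} v + ennreal (v powr (- b - 1)) * indicator {1..} v"
      proof (cases "v \<le> 0")
        case True then show ?thesis by simp
      next
        case False
        then have v: "v > 0" by simp
        show ?thesis
        proof (cases "v \<le> 1")
          case True
          have "v powr (- b - 1) * exp (- (1 / (2 * v))) \<le> v powr (- b - 1) * ((2 * real n) ^ n * v ^ n)"
            using e[OF v] by (intro mult_left_mono) auto
          also have "\<dots> = ((2 * real n) ^ n) * v powr (real n - (b + 1))"
            using v by (simp add: powr_realpow[symmetric] powr_add[symmetric] algebra_simps)
          also have "\<dots> \<le> ((2 * real n) ^ n) * 1"
            using v True n by (intro mult_left_mono powr_le1) auto
          finally have "?g 1 v \<le> ennreal ((2 * real n) ^ n) * indicator {0..1} v"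
            using v True by (simp add: ennreal_leI)
          then show ?thesis by (simp add: add_increasing2)
        next
          case False
          then have "?g 1 v \<le> ennreal (v powr (- b - 1)) * indicator {1..} v"
            by (auto intro!: ennreal_leI simp: mult_left_le)
          then show ?thesis by (simp add: add_increasing)
        qed
      qed
    qed
    also have "\<dots> = (\<integral>\<^sup>+v. ennreal ((2 * real n) ^ n) * indicator {0..1::real} v \<partial>lborel) + (\<integral>\<^sup>+v. ennreal (v powr (- b - 1)) * indicator {1..} v \<partial>lborel)"
      by (intro nn_integral_add) auto
    also have "(\<integral>\<^sup>+v. ennreal ((2 * real n) ^ n) * indicator {0..1::real} v \<partial>lborel) = ennreal ((2 * real n) ^ n)"
      by (subst nn_integral_cmult) auto
    also have "(\<integral>\<^sup>+v. ennreal (v powr (- b - 1)) * indicator {1..} v \<partial>lborel) = ennreal (1 powr (- b) / b)"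
      by (intro nn_integral_powr_tail b) simp
    finally show ?thesis by (rule le_less_trans) simp
  qed
  have pos: "I \<noteq> 0"
  proof
    assume "I = 0"
    then have "AE v in lborel. ?g 1 v = 0"
      unfolding I_def by (subst (asm) nn_integral_0_iff_AE) auto
    then have "AE v in lborel. v \<notin> {0<..<1::real}"
    proof eventually_elim
      case (elim v)
      show ?case
      proof
        assume "v \<in> {0<..<1}"
        then have "0 < v powr (- b - 1) * exp (- 1 / (2 * v))" by simp
        then have "ennreal (v powr (- b - 1) * exp (- 1 / (2 * v))) \<noteq> 0"
          by (simp only: ennreal_eq_0_iff not_le)
        with elim \<open>v \<in> {0<..<1}\<close> show False by simp
      qed
    qed
    then have "{0<..<1::real} \<in> null_sets lborel"
      by (subst AE_iff_null_sets) auto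
    then have "emeasure lborel {0<..<1::real} = 0" by auto
    then show False by simp
  qed
  have "(\<integral>\<^sup>+v. ?g q v \<partial>lborel) = ennreal (enn2real I * q powr (- b))" if "q > 0" for q
    using scale[OF that] fin by (simp add: ennreal_mult' ennreal_enn2real mult.commute)
  moreover have "enn2real I > 0" using fin pos by (simp add: enn2real_positive_iff zero_less_iff_neq_zero)
  ultimately show ?thesis by blast
qed

lemma gauss_mixture:
  assumes "0 < real DIM('a) / 2 + a"
  shows "\<exists>c>0. \<forall>h. \<forall>x::'a::euclidean_space. 0 < h + (norm x)\<^sup>2 \<longrightarrow>
    (\<integral>\<^sup>+v. ennreal (gauss v x * (v powr (- 1 - a) * exp (- h / (2 * v)))) * indicator {0<..} v \<partial>lborel) =
      ennreal (c * (h + (norm x)\<^sup>2) powr (- (real DIM('a) / 2 + a)))"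
proof -
  define N where "N = real DIM('a)"
  obtain K where K: "K > 0" "\<And>q. q > 0 \<Longrightarrow>
     (\<integral>\<^sup>+v. ennreal (v powr (- (N / 2 + a) - 1) * exp (- q / (2 * v))) * indicator {0<..} v \<partial>lborel) = ennreal (K * q powr (- (N / 2 + a)))"
    using nn_integral_inverse_gamma[of "N / 2 + a"] assms by (auto simp: N_def)
  have "(\<integral>\<^sup>+v. ennreal (gauss v x * (v powr (- 1 - a) * exp (- h / (2 * v)))) * indicator {0<..} v \<partial>lborel) =
      ennreal ((2 * pi) powr (- N / 2) * K * (h + (norm x)\<^sup>2) powr (- (N / 2 + a)))"
    if q: "0 < h + (norm x)\<^sup>2" for h and x :: 'a
  proof -
    have "(\<integral>\<^sup>+v. ennreal (gauss v x * (v powr (- 1 - a) * exp (- h / (2 * v)))) * indicator {0<..} v \<partial>lborel) =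
      (\<integral>\<^sup>+v. ennreal ((2 * pi) powr (- N / 2)) * (ennreal (v powr (- (N / 2 + a) - 1) * exp (- (h + (norm x)\<^sup>2) / (2 * v))) * indicator {0<..} v) \<partial>lborel)"
    proof (rule nn_integral_cong)
      fix v :: real
      show "ennreal (gauss v x * (v powr (- 1 - a) * exp (- h / (2 * v)))) * indicator {0<..} v =
        ennreal ((2 * pi) powr (- N / 2)) * (ennreal (v powr (- (N / 2 + a) - 1) * exp (- (h + (norm x)\<^sup>2) / (2 * v))) * indicator {0<..} v)"
      proof (cases "v > 0")
        case True
        have "v powr (- (N / 2 + a) - 1) = v powr (- N / 2 + (- 1 - a))"
          by (rule arg_cong[where f = "\<lambda>b. v powr b"]) simp
        also have "\<dots> = v powr (- N / 2) * v powr (- 1 - a)" by (rule powr_add)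
        finally have 1: "v powr (- (N / 2 + a) - 1) = v powr (- N / 2) * v powr (- 1 - a)" .
        have "- (h + (norm x)\<^sup>2) / (2 * v) = - h / (2 * v) + - (norm x)\<^sup>2 / (2 * v)"
          by (simp only: minus_add_distrib add_divide_distrib)
        then have "exp (- (h + (norm x)\<^sup>2) / (2 * v)) = exp (- h / (2 * v)) * exp (- (norm x)\<^sup>2 / (2 * v))"
          by (simp only: exp_add)
        with 1 show ?thesis using True
          by (simp add: gauss_eq powr_mult ennreal_mult'[symmetric] N_def[symmetric] mult_ac)
      qed simp
    qed
    also have "\<dots> = ennreal ((2 * pi) powr (- N / 2)) * ennreal (K * (h + (norm x)\<^sup>2) powr (- (N / 2 + a)))"
      by (subst nn_integral_cmult) (measurable, simp only: K(2)[OF q])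
    finally show ?thesis by (simp add: ennreal_mult'[symmetric] mult.assoc)
  qed
  moreover have "(2 * pi) powr (- N / 2) * K > 0" using K by simp
  ultimately show ?thesis unfolding N_def by blast
qed

text \<open>The kernel |z|^(-N-2s) is, up to a constant, a mixture of centred Gaussians with density v^(-1-s) in the
  variance v.\<close>

lemma gauss_mixture_kernel:
  assumes s: "0 < s"
  shows "\<exists>c>0. \<forall>z::'a::euclidean_space. z \<noteq> 0 \<longrightarrow>
    (\<integral>\<^sup>+v. ennreal (gauss v z * v powr (- 1 - s)) * indicator {0<..} v \<partial>lborel) = ennreal (c * frac_kernel s z)"
proof -
  have "0 < real DIM('a) / 2 + s" using s by (simp add: add_pos_pos)
  then obtain c where c: "c > 0" "\<And>h x::'a. 0 < h + (norm x)\<^sup>2 \<Longrightarrow>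
    (\<integral>\<^sup>+v. ennreal (gauss v x * (v powr (- 1 - s) * exp (- h / (2 * v)))) * indicator {0<..} v \<partial>lborel) =
      ennreal (c * (h + (norm x)\<^sup>2) powr (- (real DIM('a) / 2 + s)))"
    using gauss_mixture by blast
  have "((norm z)\<^sup>2) powr (- (real DIM('a) / 2 + s)) = frac_kernel s z" if "z \<noteq> 0" for z :: 'a
  proof -
    have "((norm z)\<^sup>2) powr (- (real DIM('a) / 2 + s)) = (norm z powr 2) powr (- (real DIM('a) / 2 + s))"
      using that by (simp add: powr_numeral)
    also have "\<dots> = norm z powr (2 * (- (real DIM('a) / 2 + s)))" by (rule powr_powr)
    also have "2 * (- (real DIM('a) / 2 + s)) = - (2 * s) - real DIM('a)" by simp
    finally show ?thesis by (simp only: frac_kernel_eq)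
  qed
  then show ?thesis using c(1) c(2)[of 0] by (intro exI[of _ c]) simp
qed

text \<open>The weight with the critical exponent N - 2s is, up to a constant, a mixture of centred Gaussians
  with density v^(s-1) exp(-1/(2v)).\<close>

lemma gauss_mixture_bracket:
  assumes s: "2 * s < real DIM('a)"
  shows "\<exists>c>0. \<forall>x::'a::euclidean_space.
    (\<integral>\<^sup>+v. ennreal (gauss v x * (v powr (s - 1) * exp (- 1 / (2 * v)))) * indicator {0<..} v \<partial>lborel) =
      ennreal (c * bracket x powr (- (real DIM('a) - 2 * s)))"
proof -
  have "0 < real DIM('a) / 2 + - s" using s by simp
  then obtain c where c: "c > 0" "\<And>h x::'a. 0 < h + (norm x)\<^sup>2 \<Longrightarrow>
    (\<integral>\<^sup>+v. ennreal (gauss v x * (v powr (- 1 - - s) * exp (- h / (2 * v)))) * indicator {0<..} v \<partial>lborel) =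
      ennreal (c * (h + (norm x)\<^sup>2) powr (- (real DIM('a) / 2 + - s)))"
    using gauss_mixture by blast
  have "- 1 - - s = s - 1" "- (real DIM('a) / 2 + - s) = - (real DIM('a) - 2 * s) / 2" by simp_all
  then show ?thesis
    using c(1) c(2)[of 1, unfolded \<open>- 1 - - s = s - 1\<close>]
    by (intro exI[of _ c]) (simp only: powr_bracket add_pos_nonneg zero_less_one zero_le_power2 simp_thms)
qed

text \<open>This inequality says that the Marchaud derivative of order s of the function r^(s-1) on the
  half-line, truncated at \<epsilon>, is not negative: the right-hand side is the value at r times the
  integral of v^(-1-s) over v > \<epsilon>.\<close>

lemma nn_integral_beta_tail:
  assumes s: "0 < s" and e: "0 < \<epsilon>" and r: "0 < r"
  shows "(\<integral>\<^sup>+v. ennreal ((r - v) powr (s - 1) * v powr (- 1 - s)) * indicator {\<epsilon><..<r} v \<partial>lborel) \<le>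
     ennreal (r powr (s - 1) * (\<epsilon> powr (- s) / s))"
proof (cases "\<epsilon> < r")
  case False
  then have "{\<epsilon><..<r} = {}" by auto
  then show ?thesis by simp
next
  case True
  \<comment> \<open>F is an explicit antiderivative of the integrand.\<close>
  define F where "F = (\<lambda>v. - (((r - v) / v) powr s) / (s * r))"
  have "((\<lambda>v. (r - v) powr (s - 1) * v powr (- 1 - s)) has_integral (F r - F \<epsilon>)) {\<epsilon>..r}"
  proof (rule fundamental_theorem_of_calculus_interior)
    show "\<epsilon> \<le> r" using True by simp
    show "continuous_on {\<epsilon>..r} F"
      unfolding F_def using e r s by (intro continuous_intros continuous_on_powr') auto
    fix v assume v: "v \<in> {\<epsilon><..<r}"
    then have v0: "0 < v" "0 < r - v" "0 < (r - v) / v" using e by auto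
    have d: "DERIV (\<lambda>v. (r - v) / v) v :> - r / v\<^sup>2"
      using v0 by (auto intro!: derivative_eq_intros simp: field_simps power2_eq_square)
    have "DERIV F v :> - (s * ((r - v) / v) powr (s - 1) * (- r / v\<^sup>2)) / (s * r)"
      unfolding F_def by (intro DERIV_cdivide DERIV_minus DERIV_chain2[OF has_real_derivative_powr[OF v0(3)] d])
    also have "- (s * ((r - v) / v) powr (s - 1) * (- r / v\<^sup>2)) / (s * r) = ((r - v) / v) powr (s - 1) / v\<^sup>2"
      using s r by (simp add: field_simps)
    also have "\<dots> = (r - v) powr (s - 1) * v powr (- 1 - s)"
    proof -
      have "v powr (s - 1) * v\<^sup>2 = v powr (s - 1) * v powr 2" using v0 by (simp add: powr_numeral)
      also have "\<dots> = v powr (s + 1)" by (simp add: powr_add[symmetric] add.commute)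
      finally have *: "v powr (s - 1) * v\<^sup>2 = v powr (s + 1)" .
      have "((r - v) / v) powr (s - 1) / v\<^sup>2 = (r - v) powr (s - 1) / (v powr (s - 1) * v\<^sup>2)"
        using v0 by (simp add: powr_divide)
      also have "\<dots> = (r - v) powr (s - 1) * v powr (- (s + 1))"
        unfolding * by (simp only: powr_minus_divide) simp
      also have "- (s + 1) = - 1 - s" by simp
      finally show ?thesis .
    qed
    finally show "(F has_vector_derivative (r - v) powr (s - 1) * v powr (- 1 - s)) (at v)"
      by (simp add: has_real_derivative_iff_has_vector_derivative)
  qed
  then have eq: "(\<integral>\<^sup>+v. ennreal ((r - v) powr (s - 1) * v powr (- 1 - s)) * indicator {\<epsilon>..r} v \<partial>lborel) = ennreal (F r - F \<epsilon>)"
    by (intro nn_integral_has_integral_lebesgue') auto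
  have le: "(\<integral>\<^sup>+v. ennreal ((r - v) powr (s - 1) * v powr (- 1 - s)) * indicator {\<epsilon><..<r} v \<partial>lborel) \<le>
      (\<integral>\<^sup>+v. ennreal ((r - v) powr (s - 1) * v powr (- 1 - s)) * indicator {\<epsilon>..r} v \<partial>lborel)"
    by (intro nn_integral_mono) (auto split: split_indicator)
  have bd: "F r - F \<epsilon> \<le> r powr (s - 1) * (\<epsilon> powr (- s) / s)"
  proof -
    have "F r - F \<epsilon> = ((r - \<epsilon>) / \<epsilon>) powr s / (s * r)" using s by (simp add: F_def)
    also have "\<dots> \<le> (r / \<epsilon>) powr s / (s * r)"
      using s r e True by (intro divide_right_mono powr_mono2) (auto simp: divide_right_mono)
    also have "\<dots> = r powr (s - 1) * (\<epsilon> powr (- s) / s)"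
      using r e by (simp add: powr_divide powr_diff powr_minus_divide)
    finally show ?thesis .
  qed
  show ?thesis using le unfolding eq by (rule order_trans) (rule ennreal_leI[OF bd])
qed

text \<open>The kernel |z|^(-N-2s), up to a constant, with the variances v \<le> \<epsilon> removed from the mixture. It is
  integrable, and convolution with it remains explicit on mixtures of Gaussians.\<close>

definition gauss_kernel :: "real \<Rightarrow> real \<Rightarrow> 'a::euclidean_space \<Rightarrow> ennreal" where
  "gauss_kernel s \<epsilon> z = (\<integral>\<^sup>+v. ennreal (gauss v z * v powr (- 1 - s)) * indicator {\<epsilon><..} v \<partial>lborel)"

lemma borel_measurable_gauss_kernel [measurable]: "gauss_kernel s \<epsilon> \<in> borel_measurable borel"
  unfolding gauss_kernel_def[abs_def] by measurable

lemma gauss_kernel_uminus [simp]: "gauss_kernel s \<epsilon> (- z) = gauss_kernel s \<epsilon> z"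
  by (simp add: gauss_kernel_def)

lemma nn_integral_gauss_kernel:
  assumes s: "0 < s" and e: "0 < \<epsilon>"
  shows "(\<integral>\<^sup>+z. gauss_kernel s \<epsilon> (z::'a::euclidean_space) \<partial>lborel) = ennreal (\<epsilon> powr (- s) / s)"
proof -
  have "(\<integral>\<^sup>+z. gauss_kernel s \<epsilon> (z::'a) \<partial>lborel) =
      (\<integral>\<^sup>+v. (\<integral>\<^sup>+z. ennreal (gauss v (z::'a) * v powr (- 1 - s)) * indicator {\<epsilon><..} v \<partial>lborel) \<partial>lborel)"
    unfolding gauss_kernel_def by (rule lborel_pair.Fubini') measurable
  also have "\<dots> = (\<integral>\<^sup>+v. ennreal (v powr (- s - 1)) * indicator {\<epsilon>..} v \<partial>lborel)"
  proof (rule nn_integral_cong_AE)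
    show "AE v in lborel. (\<integral>\<^sup>+z. ennreal (gauss v (z::'a) * v powr (- 1 - s)) * indicator {\<epsilon><..} v \<partial>lborel) =
        ennreal (v powr (- s - 1)) * indicator {\<epsilon>..} v"
      using AE_lborel_singleton[of \<epsilon>]
    proof eventually_elim
      case (elim v)
      show ?case
      proof (cases "\<epsilon> < v")
        case True
        then have v: "v > 0" using e by simp
        have eq: "- 1 - s = - s - 1" by simp
        have "(\<integral>\<^sup>+z. ennreal (gauss v (z::'a) * v powr (- 1 - s)) * indicator {\<epsilon><..} v \<partial>lborel) =
            (\<integral>\<^sup>+z. ennreal (gauss v (z::'a)) * ennreal (v powr (- s - 1)) \<partial>lborel)"
          unfolding eq using True by (simp add: ennreal_mult')
        also have "\<dots> = ennreal (v powr (- s - 1))"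
          by (subst nn_integral_multc) (auto simp: nn_integral_gauss[OF v])
        finally show ?thesis using True by simp
      next
        case False
        with elim show ?thesis by simp
      qed
    qed
  qed
  also have "\<dots> = ennreal (\<epsilon> powr (- s) / s)"
    by (rule nn_integral_powr_tail[OF s e])
  finally show ?thesis .
qed

text \<open>Convolution adds the variances. After the substitution r + v = r' the inner integral over v is the one of
  \<open>nn_integral_beta_tail\<close>; the factor exp(-1/(2(r'-v))) is at most exp(-1/(2r')).\<close>

lemma bracket_gauss_kernel_superharmonic:
  assumes s: "0 < s" "2 * s < real DIM('a)" and e: "0 < \<epsilon>"
  shows "(\<integral>\<^sup>+z. ennreal (bracket (x + z) powr (- (real DIM('a) - 2 * s))) * gauss_kernel s \<epsilon> (z::'a::euclidean_space) \<partial>lborel)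
    \<le> ennreal (bracket x powr (- (real DIM('a) - 2 * s)) * (\<epsilon> powr (- s) / s))"
proof -
  define \<psi> where "\<psi> = (\<lambda>y::'a. bracket y powr (- (real DIM('a) - 2 * s)))"
  define \<mu> :: "real \<Rightarrow> real" where "\<mu> = (\<lambda>r. r powr (s - 1) * exp (- 1 / (2 * r)) * indicator {0<..} r)"
  define \<kappa> :: "real \<Rightarrow> real" where "\<kappa> = (\<lambda>v. v powr (- 1 - s) * indicator {\<epsilon><..} v)"
  have [measurable]: "\<mu> \<in> borel_measurable borel" "\<kappa> \<in> borel_measurable borel" unfolding \<mu>_def \<kappa>_def by measurable
  have nn: "0 \<le> \<mu> r" "0 \<le> \<kappa> r" for r by (auto simp: \<mu>_def \<kappa>_def)
  obtain c where c: "c > 0" "\<And>x::'a. (\<integral>\<^sup>+v. ennreal (gauss v x * (v powr (s - 1) * exp (- 1 / (2 * v)))) * indicator {0<..} v \<partial>lborel) =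
      ennreal (c * bracket x powr (- (real DIM('a) - 2 * s)))"
    using gauss_mixture_bracket[OF s(2)] by metis
  have psi: "ennreal (c * \<psi> y) = (\<integral>\<^sup>+r. ennreal (gauss r y * \<mu> r) \<partial>lborel)" for y
    unfolding \<psi>_def c(2)[symmetric] \<mu>_def by (intro nn_integral_cong) (auto split: split_indicator)
  have ker: "gauss_kernel s \<epsilon> z = (\<integral>\<^sup>+v. ennreal (gauss v z * \<kappa> v) \<partial>lborel)" for z :: 'a
    unfolding gauss_kernel_def \<kappa>_def by (intro nn_integral_cong) (auto split: split_indicator)
  have "ennreal c * (\<integral>\<^sup>+z. ennreal (\<psi> (x + z)) * gauss_kernel s \<epsilon> z \<partial>lborel) =
      (\<integral>\<^sup>+z. ennreal (c * \<psi> (x + z)) * gauss_kernel s \<epsilon> z \<partial>lborel)"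
    using c(1) unfolding \<psi>_def by (subst nn_integral_cmult[symmetric]) (auto simp: ennreal_mult' mult.assoc)
  also have "\<dots> = (\<integral>\<^sup>+z. (\<integral>\<^sup>+v. (\<integral>\<^sup>+r. ennreal (gauss r (x + z) * \<mu> r) * ennreal (gauss v z * \<kappa> v) \<partial>lborel) \<partial>lborel) \<partial>lborel)"
    unfolding psi ker by (simp add: nn_integral_cmult nn_integral_multc)
  also have "\<dots> = (\<integral>\<^sup>+v. (\<integral>\<^sup>+z. (\<integral>\<^sup>+r. ennreal (gauss r (x + z) * \<mu> r) * ennreal (gauss v z * \<kappa> v) \<partial>lborel) \<partial>lborel) \<partial>lborel)"
    by (rule lborel_pair.Fubini') measurable
  also have "\<dots> = (\<integral>\<^sup>+v. (\<integral>\<^sup>+r. (\<integral>\<^sup>+z. ennreal (gauss r (x + z) * \<mu> r) * ennreal (gauss v z * \<kappa> v) \<partial>lborel) \<partial>lborel) \<partial>lborel)"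
    by (intro nn_integral_cong lborel_pair.Fubini') measurable
  also have "\<dots> = (\<integral>\<^sup>+v. (\<integral>\<^sup>+r. ennreal (gauss (v + r) x * \<mu> r * \<kappa> v) \<partial>lborel) \<partial>lborel)"
  proof (intro nn_integral_cong)
    fix v r :: real
    show "(\<integral>\<^sup>+z. ennreal (gauss r (x + z) * \<mu> r) * ennreal (gauss v z * \<kappa> v) \<partial>lborel) = ennreal (gauss (v + r) x * \<mu> r * \<kappa> v)"
    proof (cases "r > 0 \<and> v > 0")
      case True
      have "(\<integral>\<^sup>+z. ennreal (gauss r (x + z) * \<mu> r) * ennreal (gauss v z * \<kappa> v) \<partial>lborel) =
          (\<integral>\<^sup>+z. ennreal (\<mu> r * \<kappa> v) * ennreal (gauss r (x + z) * gauss v z) \<partial>lborel)"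
        using nn by (intro nn_integral_cong) (simp add: ennreal_mult'[symmetric] mult_ac)
      also have "\<dots> = ennreal (\<mu> r * \<kappa> v) * ennreal (gauss (r + v) x)"
        using True by (subst nn_integral_cmult) (auto simp: nn_integral_gauss_convolution)
      finally show ?thesis using nn by (simp add: ennreal_mult'[symmetric] mult_ac add.commute)
    next
      case False
      then have "\<mu> r = 0 \<or> \<kappa> v = 0" using e by (auto simp: \<mu>_def \<kappa>_def)
      then show ?thesis by auto
    qed
  qed
  also have "\<dots> = (\<integral>\<^sup>+v. (\<integral>\<^sup>+r. ennreal (gauss r x * \<mu> (r - v) * \<kappa> v) \<partial>lborel) \<partial>lborel)"
  proof (rule nn_integral_cong)
    fix v :: real
    show "(\<integral>\<^sup>+r. ennreal (gauss (v + r) x * \<mu> r * \<kappa> v) \<partial>lborel) = (\<integral>\<^sup>+r. ennreal (gauss r x * \<mu> (r - v) * \<kappa> v) \<partial>lborel)"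
      using nn_integral_lborel_translate[of "\<lambda>r. ennreal (gauss r x * \<mu> (r - v) * \<kappa> v)" v] by simp
  qed
  also have "\<dots> = (\<integral>\<^sup>+r. (\<integral>\<^sup>+v. ennreal (gauss r x * \<mu> (r - v) * \<kappa> v) \<partial>lborel) \<partial>lborel)"
    by (rule lborel_pair.Fubini') measurable
  also have "\<dots> \<le> (\<integral>\<^sup>+r. ennreal (gauss r x * \<mu> r) * ennreal (\<epsilon> powr (- s) / s) \<partial>lborel)"
  proof (intro nn_integral_mono)
    fix r :: real
    show "(\<integral>\<^sup>+v. ennreal (gauss r x * \<mu> (r - v) * \<kappa> v) \<partial>lborel) \<le> ennreal (gauss r x * \<mu> r) * ennreal (\<epsilon> powr (- s) / s)"
    proof (cases "r > 0")
      case True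
      have "(\<integral>\<^sup>+v. ennreal (gauss r x * \<mu> (r - v) * \<kappa> v) \<partial>lborel) \<le>
        (\<integral>\<^sup>+v. ennreal (gauss r x * exp (- 1 / (2 * r))) * (ennreal ((r - v) powr (s - 1) * v powr (- 1 - s)) * indicator {\<epsilon><..<r} v) \<partial>lborel)"
      proof (intro nn_integral_mono)
        fix v :: real
        show "ennreal (gauss r x * \<mu> (r - v) * \<kappa> v) \<le>
          ennreal (gauss r x * exp (- 1 / (2 * r))) * (ennreal ((r - v) powr (s - 1) * v powr (- 1 - s)) * indicator {\<epsilon><..<r} v)"
        proof (cases "\<epsilon> < v \<and> v < r")
          case True
          then have v: "0 < v" "0 < r - v" "r - v \<le> r" using e by auto
          have ex: "exp (- 1 / (2 * (r - v))) \<le> exp (- 1 / (2 * r))"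
            using v by (simp add: frac_le)
          have "gauss r x * \<mu> (r - v) * \<kappa> v = (gauss r x * ((r - v) powr (s - 1) * v powr (- 1 - s))) * exp (- 1 / (2 * (r - v)))"
            using True by (simp add: \<mu>_def \<kappa>_def)
          also have "\<dots> \<le> (gauss r x * ((r - v) powr (s - 1) * v powr (- 1 - s))) * exp (- 1 / (2 * r))"
            by (intro mult_left_mono[OF ex]) simp
          finally show ?thesis using True
            by (simp add: ennreal_mult'[symmetric] mult_ac ennreal_leI)
        next
          case False
          then have "\<mu> (r - v) = 0 \<or> \<kappa> v = 0" by (auto simp: \<mu>_def \<kappa>_def)
          then show ?thesis by auto
        qed
      qed
      also have "\<dots> = ennreal (gauss r x * exp (- 1 / (2 * r))) *
          (\<integral>\<^sup>+v. ennreal ((r - v) powr (s - 1) * v powr (- 1 - s)) * indicator {\<epsilon><..<r} v \<partial>lborel)"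
        by (intro nn_integral_cmult) measurable
      also have "\<dots> \<le> ennreal (gauss r x * exp (- 1 / (2 * r))) * ennreal (r powr (s - 1) * (\<epsilon> powr (- s) / s))"
        by (intro mult_left_mono nn_integral_beta_tail s e True) simp
      also have "\<dots> = ennreal (gauss r x * \<mu> r) * ennreal (\<epsilon> powr (- s) / s)"
        using True s by (simp add: \<mu>_def ennreal_mult'[symmetric] mult_ac)
      finally show ?thesis .
    next
      case False
      then have "\<mu> (r - v) = 0 \<or> \<kappa> v = 0" for v using e by (auto simp: \<mu>_def \<kappa>_def indicator_def)
      then have "gauss r x * \<mu> (r - v) * \<kappa> v = 0" for v by auto
      then have "(\<integral>\<^sup>+v. ennreal (gauss r x * \<mu> (r - v) * \<kappa> v) \<partial>lborel) = 0" by (simp only: ennreal_0 nn_integral_const mult_zero_left)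
      then show ?thesis by (simp only: zero_le)
    qed
  qed
  also have "\<dots> = ennreal (c * \<psi> x) * ennreal (\<epsilon> powr (- s) / s)"
    unfolding psi by (intro nn_integral_multc) measurable
  also have "\<dots> = ennreal c * ennreal (\<psi> x * (\<epsilon> powr (- s) / s))"
    using c(1) s by (simp add: \<psi>_def ennreal_mult'[symmetric] mult.assoc)
  finally have "ennreal c * (\<integral>\<^sup>+z. ennreal (\<psi> (x + z)) * gauss_kernel s \<epsilon> z \<partial>lborel) \<le> ennreal c * ennreal (\<psi> x * (\<epsilon> powr (- s) / s))" .
  then have "(\<integral>\<^sup>+z. ennreal (\<psi> (x + z)) * gauss_kernel s \<epsilon> z \<partial>lborel) \<le> ennreal (\<psi> x * (\<epsilon> powr (- s) / s))"
    using c(1) by (subst (asm) ennreal_mult_le_mult_iff) auto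
  then show ?thesis by (simp only: \<psi>_def)
qed

text \<open>The weight with exponent -(N-2s) is superharmonic for the fractional Laplacian: this holds for the
  kernels truncated in the variance, which increase to the full kernel.\<close>

lemma frac_op_bracket_nonneg:
  assumes s: "0 < s" "2 * s < real DIM('a)"
    and int: "integrable lborel (\<lambda>z. second_diff (\<lambda>y. bracket y powr (- (real DIM('a) - 2 * s))) x z * frac_kernel s (z::'a::euclidean_space))"
  shows "0 \<le> frac_op s (\<lambda>y. bracket y powr (- (real DIM('a) - 2 * s))) x"
proof -
  define \<psi> where "\<psi> = (\<lambda>y::'a. bracket y powr (- (real DIM('a) - 2 * s)))"
  have psi1: "0 \<le> \<psi> y" "\<psi> y \<le> 1" for y
    using s bracket_ge_1[of y] powr_mono[of "- (real DIM('a) - 2 * s)" 0 "bracket y"] by (auto simp: \<psi>_def)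
  have [measurable]: "\<psi> \<in> borel_measurable borel" unfolding \<psi>_def by measurable
  have [measurable]: "(\<lambda>z. second_diff \<psi> x z) \<in> borel_measurable borel" for x unfolding second_diff_def by measurable
  obtain c where c: "c > 0" "\<And>z::'a. z \<noteq> 0 \<Longrightarrow>
    (\<integral>\<^sup>+v. ennreal (gauss v z * v powr (- 1 - s)) * indicator {0<..} v \<partial>lborel) = ennreal (c * frac_kernel s z)"
    using gauss_mixture_kernel[OF s(1)] by metis
  let ?e = "\<lambda>n. 1 / real (Suc n)"
  have le: "gauss_kernel s \<epsilon> z \<le> ennreal (c * frac_kernel s z)" if "z \<noteq> 0" "0 < \<epsilon>" for z :: 'a and \<epsilon>
    unfolding c(2)[OF that(1), symmetric] gauss_kernel_def using that(2)
    by (intro nn_integral_mono) (auto split: split_indicator)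
  define k where "k = (\<lambda>n (z::'a). enn2real (gauss_kernel s (?e n) z))"
  have [measurable]: "k n \<in> borel_measurable borel" for n unfolding k_def by measurable
  have k0: "0 \<le> k n z" for n z by (simp add: k_def)
  have k: "ennreal (k n z) = gauss_kernel s (?e n) z" if "z \<noteq> 0" for n z
    unfolding k_def using le[OF that, of "?e n"] by (intro ennreal_enn2real) (auto simp: le_less_trans)
  have kle: "k n z \<le> c * frac_kernel s z" if "z \<noteq> 0" for n z
    using le[OF that, of "?e n"] c(1) k[OF that, of n, symmetric] by (simp add: ennreal_le_iff)
  have klim: "(\<lambda>n. k n z) \<longlonglongrightarrow> c * frac_kernel s z" if z: "z \<noteq> 0" for z
  proof -
    have "(\<lambda>n. gauss_kernel s (?e n) z) \<longlonglongrightarrow> (\<integral>\<^sup>+v. ennreal (gauss v z * v powr (- 1 - s)) * indicator {0<..} v \<partial>lborel)"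
      unfolding gauss_kernel_def
    proof (rule nn_integral_LIMSEQ)
      show "incseq (\<lambda>n v. ennreal (gauss v z * v powr (- 1 - s)) * indicator {?e n<..} v)"
      proof (rule incseq_SucI, rule le_funI)
        fix n and v :: real
        have "?e (Suc n) \<le> ?e n" by (simp add: frac_le)
        then show "ennreal (gauss v z * v powr (- 1 - s)) * indicator {?e n<..} v \<le>
            ennreal (gauss v z * v powr (- 1 - s)) * indicator {?e (Suc n)<..} v"
          by (intro mult_left_mono) (auto split: split_indicator)
      qed
      show "(\<lambda>n. ennreal (gauss v z * v powr (- 1 - s)) * indicator {?e n<..} v) \<longlonglongrightarrow>
          ennreal (gauss v z * v powr (- 1 - s)) * indicator {0<..} v" for v
      proof (cases "v > 0")
        case True
        have "eventually (\<lambda>n. ?e n < v) sequentially"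
          by (rule order_tendstoD(2)[OF LIMSEQ_Suc[OF lim_1_over_n] True])
        then have "eventually (\<lambda>n. ennreal (gauss v z * v powr (- 1 - s)) * indicator {?e n<..} v =
            ennreal (gauss v z * v powr (- 1 - s)) * indicator {0<..} v) sequentially"
          by eventually_elim (use True in simp)
        then show ?thesis by (rule tendsto_eventually)
      next
        case False
        moreover have "\<not> ?e n < v" for n using False by (meson less_trans of_nat_0_less_iff zero_less_Suc zero_less_divide_1_iff)
        ultimately show ?thesis by simp
      qed
    qed auto
    then have "(\<lambda>n. ennreal (k n z)) \<longlonglongrightarrow> ennreal (c * frac_kernel s z)"
      by (simp add: k[OF z] c(2)[OF z])
    then show ?thesis using c(1) k0 by (subst (asm) tendsto_ennreal_iff) auto
  qed
  have nz: "AE z in lborel. z \<noteq> (0::'a)" by (rule AE_lborel_singleton)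
  have "(\<lambda>n. \<integral>z. second_diff \<psi> x z * k n z \<partial>lborel) \<longlonglongrightarrow> (\<integral>z. second_diff \<psi> x z * (c * frac_kernel s z) \<partial>lborel)"
  proof (rule integral_dominated_convergence[where w = "\<lambda>z. c * \<bar>second_diff \<psi> x z * frac_kernel s z\<bar>"])
    show "integrable lborel (\<lambda>z. c * \<bar>second_diff \<psi> x z * frac_kernel s z\<bar>)"
      using int unfolding \<psi>_def by (intro integrable_mult_right integrable_abs)
    show "AE z in lborel. (\<lambda>n. second_diff \<psi> x z * k n z) \<longlonglongrightarrow> second_diff \<psi> x z * (c * frac_kernel s z)"
      using nz by eventually_elim (intro tendsto_intros klim)
    show "AE z in lborel. norm (second_diff \<psi> x z * k n z) \<le> c * \<bar>second_diff \<psi> x z * frac_kernel s z\<bar>" for n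
      using nz
    proof eventually_elim
      case (elim z)
      have "\<bar>second_diff \<psi> x z\<bar> * k n z \<le> \<bar>second_diff \<psi> x z\<bar> * (c * frac_kernel s z)"
        using kle[OF elim] by (intro mult_left_mono) auto
      then show ?case using k0[of n z] by (simp add: abs_mult mult_ac)
    qed
  qed auto
  moreover have "0 \<le> (\<integral>z. second_diff \<psi> x z * k n z \<partial>lborel)" for n
  proof -
    have e: "0 < ?e n" by simp
    have tot: "(\<integral>\<^sup>+z. ennreal (k n z) \<partial>lborel) = ennreal (?e n powr (- s) / s)"
      unfolding nn_integral_gauss_kernel[OF s(1) e, where 'a = 'a, symmetric]
      by (rule nn_integral_cong_AE) (use nz in eventually_elim, rule k)
    have ik: "integrable lborel (k n)"
      using tot k0 by (intro integrableI_nonneg) auto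
    have Ik: "(\<integral>z. k n z \<partial>lborel) = ?e n powr (- s) / s"
      using tot k0 s(1) by (intro integral_eq_nn_integral[THEN trans]) auto
    have ib: "integrable lborel (\<lambda>z. f z * k n z)" if [measurable]: "f \<in> borel_measurable borel" and "\<And>z. \<bar>f z\<bar> \<le> 1" for f
      using that(2) k0
      by (intro Bochner_Integration.integrable_bound[OF ik]) (auto simp: abs_mult intro!: mult_left_le_one_le)
    have i1: "integrable lborel (\<lambda>z. \<psi> (x + z) * k n z)"
      using psi1 by (intro ib) auto
    have le1: "(\<integral>z. \<psi> (x + z) * k n z \<partial>lborel) \<le> \<psi> x * (?e n powr (- s) / s)"
    proof -
      have "ennreal (\<integral>z. \<psi> (x + z) * k n z \<partial>lborel) = (\<integral>\<^sup>+z. ennreal (\<psi> (x + z) * k n z) \<partial>lborel)"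
        using psi1 k0 by (intro nn_integral_eq_integral[symmetric] i1) auto
      also have "\<dots> = (\<integral>\<^sup>+z. ennreal (\<psi> (x + z)) * gauss_kernel s (?e n) z \<partial>lborel)"
      proof (rule nn_integral_cong_AE)
        show "AE z in lborel. ennreal (\<psi> (x + z) * k n z) = ennreal (\<psi> (x + z)) * gauss_kernel s (?e n) z"
          using nz by eventually_elim (simp only: ennreal_mult'[OF psi1(1)] k not_False_eq_True)
      qed
      also have "\<dots> \<le> ennreal (\<psi> x * (?e n powr (- s) / s))"
        unfolding \<psi>_def by (rule bracket_gauss_kernel_superharmonic[OF s e])
      finally show ?thesis using psi1 s by (subst (asm) ennreal_le_iff) auto
    qed
    have sym: "k n (- z) = k n z" for z by (simp add: k_def)
    have i2: "integrable lborel (\<lambda>z. \<psi> (x - z) * k n z)"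
      using integrable_lborel_uminus(1)[OF i1] by (simp add: sym)
    have le2: "(\<integral>z. \<psi> (x - z) * k n z \<partial>lborel) \<le> \<psi> x * (?e n powr (- s) / s)"
      using integrable_lborel_uminus(2)[OF i1] le1 by (simp add: sym)
    have "(\<integral>z. second_diff \<psi> x z * k n z \<partial>lborel) = (\<integral>z. 2 * \<psi> x * k n z - \<psi> (x + z) * k n z - \<psi> (x - z) * k n z \<partial>lborel)"
      by (simp add: second_diff_def algebra_simps)
    also have "\<dots> = 2 * \<psi> x * (?e n powr (- s) / s) - (\<integral>z. \<psi> (x + z) * k n z \<partial>lborel) - (\<integral>z. \<psi> (x - z) * k n z \<partial>lborel)"
      using ik i1 i2 Ik by simp
    finally show ?thesis using le1 le2 by linarith
  qed
  ultimately have "0 \<le> (\<integral>z. second_diff \<psi> x z * (c * frac_kernel s z) \<partial>lborel)"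
    by (intro LIMSEQ_le_const) auto
  also have "\<dots> = c * (2 * frac_op s \<psi> x)"
    by (simp add: frac_op_def mult.left_commute)
  finally show ?thesis using c(1) by (simp add: \<psi>_def zero_le_mult_iff)
qed

section \<open>Convexity and the weak inequality at a fixed time\<close>

text \<open>A convex C^1 function that vanishes on the negative half-line and grows linearly.\<close>

definition pos_profile :: "real \<Rightarrow> real" where
  "pos_profile y = (if y \<le> 0 then 0 else y\<^sup>2 / (1 + y))"

text \<open>The derivative of the preceding function.\<close>

definition pos_profile_deriv :: "real \<Rightarrow> real" where
  "pos_profile_deriv y = (if y \<le> 0 then 0 else 1 - 1 / (1 + y)\<^sup>2)"

text \<open>An even convex function of class C^1 that vanishes exactly on [-\<delta>, \<delta>]. It is at most |r|, and for
  \<delta> > 0, as it vanishes near 0, at most a multiple of |r|^p for every p \<ge> 1.\<close>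

definition level_fun :: "real \<Rightarrow> real \<Rightarrow> real" where
  "level_fun \<delta> r = pos_profile (r - \<delta>) + pos_profile (- r - \<delta>)"

text \<open>The derivative of the preceding function.\<close>

definition level_deriv :: "real \<Rightarrow> real \<Rightarrow> real" where
  "level_deriv \<delta> r = pos_profile_deriv (r - \<delta>) - pos_profile_deriv (- r - \<delta>)"

lemma DERIV_pos_profile: "DERIV pos_profile y :> pos_profile_deriv y"
  unfolding pos_profile_def[abs_def] pos_profile_deriv_def
proof (rule DERIV_zero_extend)
  fix y :: real assume "0 \<le> y"
  then have [simp]: "1 + y \<noteq> 0" by simp
  have "DERIV (\<lambda>y. y\<^sup>2 / (1 + y)) y :> (2 * y * (1 + y) - y\<^sup>2 * 1) / ((1 + y) * (1 + y))"
    by (rule DERIV_divide) (auto intro!: derivative_eq_intros)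
  also have "(2 * y * (1 + y) - y\<^sup>2 * 1) / ((1 + y) * (1 + y)) = 1 - 1 / (1 + y)\<^sup>2"
    using \<open>0 \<le> y\<close> by (simp add: divide_simps) (simp add: algebra_simps power2_eq_square)
  finally show "DERIV (\<lambda>y. y\<^sup>2 / (1 + y)) y :> 1 - 1 / (1 + y)\<^sup>2" .
qed auto

lemma pos_profile_bounds: "0 \<le> pos_profile y" "pos_profile y \<le> max 0 y"
proof -
  show "0 \<le> pos_profile y" by (simp add: pos_profile_def)
  show "pos_profile y \<le> max 0 y"
    by (auto simp: pos_profile_def field_simps power2_eq_square)
qed

lemma pos_profile_deriv_bounds: "0 \<le> pos_profile_deriv y" "pos_profile_deriv y \<le> 1"
  by (auto simp: pos_profile_deriv_def divide_le_eq_1 intro!: one_le_power)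

lemma continuous_on_pos_profile_deriv: "continuous_on UNIV pos_profile_deriv"
proof -
  have "pos_profile_deriv = (\<lambda>y. 1 - 1 / (1 + max 0 y)\<^sup>2)"
    by (auto simp: pos_profile_deriv_def fun_eq_iff max_def)
  moreover have "continuous_on UNIV (\<lambda>y::real. 1 - 1 / (1 + max 0 y)\<^sup>2)"
    by (intro continuous_intros) (auto simp: add_pos_nonneg less_imp_neq[symmetric])
  ultimately show ?thesis by (simp only:)
qed

lemma pos_profile_tangent: "pos_profile a - pos_profile b \<le> pos_profile_deriv a * (a - b)"
proof -
  consider "a \<le> 0" | "a > 0" "b \<le> 0" | "a > 0" "b > 0" by linarith
  then show ?thesis
  proof cases
    case 1
    then show ?thesis using pos_profile_bounds(1)[of b] by (simp add: pos_profile_deriv_def pos_profile_def)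
  next
    case 2
    have "(1 - 1 / (1 + a)\<^sup>2) * a - a\<^sup>2 / (1 + a) = a\<^sup>2 / (1 + a)\<^sup>2"
      using 2 by (simp add: divide_simps) (simp add: algebra_simps power2_eq_square)
    moreover have "0 \<le> a\<^sup>2 / (1 + a)\<^sup>2" by simp
    ultimately have "a\<^sup>2 / (1 + a) \<le> (1 - 1 / (1 + a)\<^sup>2) * a" by linarith
    also have "\<dots> \<le> (1 - 1 / (1 + a)\<^sup>2) * (a - b)"
      using 2 pos_profile_deriv_bounds(1)[of a]
      by (intro mult_left_mono) (auto simp: pos_profile_deriv_def)
    finally show ?thesis using 2 by (simp add: pos_profile_deriv_def pos_profile_def)
  next
    case 3
    have e: "y\<^sup>2 / (1 + y) = y - 1 + 1 / (1 + y)" if "y > 0" for y :: real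
      using that by (simp add: field_simps power2_eq_square)
    have "(1 - 1 / (1 + a)\<^sup>2) * (a - b) - (a\<^sup>2 / (1 + a) - b\<^sup>2 / (1 + b)) = (a - b)\<^sup>2 / ((1 + a)\<^sup>2 * (1 + b))"
      unfolding e[OF 3(1)] e[OF 3(2)] using 3 by (simp add: divide_simps) (simp add: algebra_simps power2_eq_square)
    moreover have "0 \<le> (a - b)\<^sup>2 / ((1 + a)\<^sup>2 * (1 + b))" using 3 by simp
    ultimately have "a\<^sup>2 / (1 + a) - b\<^sup>2 / (1 + b) \<le> (1 - 1 / (1 + a)\<^sup>2) * (a - b)" by linarith
    then show ?thesis using 3 by (simp add: pos_profile_deriv_def pos_profile_def)
  qed
qed

lemma DERIV_level_fun: "DERIV (level_fun \<delta>) r :> level_deriv \<delta> r"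
proof -
  have "DERIV (\<lambda>r. pos_profile (r - \<delta>)) r :> pos_profile_deriv (r - \<delta>) * 1"
    by (intro DERIV_chain2[OF DERIV_pos_profile]) (auto intro!: derivative_eq_intros)
  moreover have "DERIV (\<lambda>r. pos_profile (- r - \<delta>)) r :> pos_profile_deriv (- r - \<delta>) * (- 1)"
    by (intro DERIV_chain2[OF DERIV_pos_profile]) (auto intro!: derivative_eq_intros)
  ultimately show ?thesis
    unfolding level_fun_def[abs_def] level_deriv_def by (auto dest: DERIV_add)
qed

lemma level_fun_nonneg [simp]: "0 \<le> level_fun \<delta> r"
  by (simp add: level_fun_def pos_profile_bounds)

lemma level_fun_le_abs: "0 \<le> \<delta> \<Longrightarrow> level_fun \<delta> r \<le> \<bar>r\<bar>"
  using pos_profile_bounds(2)[of "r - \<delta>"] pos_profile_bounds(2)[of "- r - \<delta>"]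
  by (auto simp: level_fun_def)

lemma level_fun_eq_0: "\<bar>r\<bar> \<le> \<delta> \<Longrightarrow> level_fun \<delta> r = 0"
  by (auto simp: level_fun_def pos_profile_def)

lemma level_fun_eq_0_iff: "level_fun \<delta> r = 0 \<longleftrightarrow> \<bar>r\<bar> \<le> \<delta>"
proof
  assume "level_fun \<delta> r = 0"
  then have "pos_profile (r - \<delta>) = 0" "pos_profile (- r - \<delta>) = 0"
    using pos_profile_bounds(1)[of "r - \<delta>"] pos_profile_bounds(1)[of "- r - \<delta>"] by (auto simp: level_fun_def)
  then have "r - \<delta> \<le> 0" "- r - \<delta> \<le> 0"
    by (auto simp: pos_profile_def split: if_splits)
  then show "\<bar>r\<bar> \<le> \<delta>" by linarith
qed (rule level_fun_eq_0)

lemma level_fun_le_powr: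
  assumes "0 < \<delta>" "1 \<le> p"
  shows "level_fun \<delta> r \<le> \<delta> powr (1 - p) * \<bar>r\<bar> powr p"
proof (cases "\<bar>r\<bar> \<le> \<delta>")
  case True
  then show ?thesis by (simp add: level_fun_eq_0)
next
  case False
  then have r: "\<bar>r\<bar> > \<delta>" "\<bar>r\<bar> > 0" using assms by auto
  have "level_fun \<delta> r \<le> \<bar>r\<bar>" using assms by (intro level_fun_le_abs) simp
  also have "\<bar>r\<bar> = \<bar>r\<bar> powr (1 - p) * \<bar>r\<bar> powr p"
    using r by (simp add: powr_add[symmetric])
  also have "\<dots> \<le> \<delta> powr (1 - p) * \<bar>r\<bar> powr p"
    using r assms by (intro mult_right_mono powr_mono2') auto
  finally show ?thesis .
qed

lemma level_deriv_abs_le: "\<bar>level_deriv \<delta> r\<bar> \<le> 1"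
  using pos_profile_deriv_bounds[of "r - \<delta>"] pos_profile_deriv_bounds[of "- r - \<delta>"]
  by (auto simp: level_deriv_def)

lemma level_fun_tangent: "level_fun \<delta> a - level_fun \<delta> b \<le> level_deriv \<delta> a * (a - b)"
  using pos_profile_tangent[of "a - \<delta>" "b - \<delta>"] pos_profile_tangent[of "- a - \<delta>" "- b - \<delta>"]
  by (simp add: level_fun_def level_deriv_def algebra_simps)

lemma continuous_on_level_fun [continuous_intros]:
  "continuous_on A f \<Longrightarrow> continuous_on A (\<lambda>x. level_fun \<delta> (f x))"
  by (rule continuous_on_compose2[where t = UNIV])
     (auto intro!: DERIV_continuous_on DERIV_level_fun intro: has_field_derivative_at_within)

lemma continuous_on_level_deriv [continuous_intros]:
  "continuous_on A f \<Longrightarrow> continuous_on A (\<lambda>x. level_deriv \<delta> (f x))"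
  unfolding level_deriv_def
  by (intro continuous_intros continuous_on_compose2[OF continuous_on_pos_profile_deriv]) auto

lemma borel_measurable_level_fun [measurable]: "level_fun \<delta> \<in> borel_measurable borel"
  by (intro borel_measurable_continuous_onI continuous_intros)

lemma borel_measurable_level_deriv [measurable]: "level_deriv \<delta> \<in> borel_measurable borel"
  by (intro borel_measurable_continuous_onI continuous_intros)

lemma integrable_continuous_vanishing:
  fixes f :: "'a::euclidean_space \<Rightarrow> real"
  assumes "continuous_on UNIV f" "\<And>x. R < norm x \<Longrightarrow> f x = 0"
  shows "integrable lborel f"
proof -
  have "integrable lborel (\<lambda>x. indicator (cball 0 R) x *\<^sub>R f x)"
    using assms by (intro borel_integrable_compact continuous_on_subset[OF assms(1)]) auto
  also have "(\<lambda>x. indicator (cball 0 R) x *\<^sub>R f x) = f"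
    using assms(2) by (auto simp: fun_eq_iff indicator_def not_le)
  finally show ?thesis .
qed

lemma test_fun_vanishing: "0 < m \<Longrightarrow> m < norm x \<Longrightarrow> test_fun \<beta> m (x::'a::euclidean_space) = 0"
proof (rule test_fun_eq_0)
  assume m: "0 < m" "m < norm x"
  have "m \<le> bracket x" using m norm_le_bracket[of x] by linarith
  also have "\<dots> \<le> bracket x * bracket x"
    using bracket_ge_1[of x] by (simp add: mult_le_cancel_left1)
  finally show "m \<le> (bracket x)\<^sup>2" by (simp add: power2_eq_square)
qed

lemma nn_integral_convolution_swap:
  fixes f g k :: "'a::euclidean_space \<Rightarrow> ennreal"
  assumes [measurable]: "f \<in> borel_measurable borel" "g \<in> borel_measurable borel" "k \<in> borel_measurable borel"
    and k: "\<And>z. k (- z) = k z"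
  shows "(\<integral>\<^sup>+x. f x * (\<integral>\<^sup>+z. g (x + z) * k z \<partial>lborel) \<partial>lborel) = (\<integral>\<^sup>+x. g x * (\<integral>\<^sup>+z. f (x + z) * k z \<partial>lborel) \<partial>lborel)"
proof -
  have "(\<integral>\<^sup>+x. f x * (\<integral>\<^sup>+z. g (x + z) * k z \<partial>lborel) \<partial>lborel) =
      (\<integral>\<^sup>+x. (\<integral>\<^sup>+z. f x * (g (x + z) * k z) \<partial>lborel) \<partial>lborel)"
    by (simp add: nn_integral_cmult)
  also have "\<dots> = (\<integral>\<^sup>+z. (\<integral>\<^sup>+x. f x * (g (x + z) * k z) \<partial>lborel) \<partial>lborel)"
    by (rule lborel_pair.Fubini') measurable
  also have "\<dots> = (\<integral>\<^sup>+z. (\<integral>\<^sup>+x. g x * (f (x - z) * k z) \<partial>lborel) \<partial>lborel)"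
  proof (rule nn_integral_cong)
    fix z :: 'a
    show "(\<integral>\<^sup>+x. f x * (g (x + z) * k z) \<partial>lborel) = (\<integral>\<^sup>+x. g x * (f (x - z) * k z) \<partial>lborel)"
      using nn_integral_lborel_translate[of "\<lambda>x. g x * (f (x - z) * k z)" z]
      by (simp add: ac_simps)
  qed
  also have "\<dots> = (\<integral>\<^sup>+x. (\<integral>\<^sup>+z. g x * (f (x - z) * k z) \<partial>lborel) \<partial>lborel)"
    by (rule lborel_pair.Fubini') measurable
  also have "\<dots> = (\<integral>\<^sup>+x. g x * (\<integral>\<^sup>+z. f (x + z) * k z \<partial>lborel) \<partial>lborel)"
  proof (rule nn_integral_cong)
    fix x :: 'a
    have "(\<integral>\<^sup>+z. g x * (f (x - z) * k z) \<partial>lborel) = g x * (\<integral>\<^sup>+z. f (x - z) * k z \<partial>lborel)"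
      by (simp add: nn_integral_cmult)
    also have "(\<integral>\<^sup>+z. f (x - z) * k z \<partial>lborel) = (\<integral>\<^sup>+z. f (x + z) * k z \<partial>lborel)"
      using nn_integral_lborel_uminus[of "\<lambda>z. f (x + z) * k z"] by (simp add: k)
    finally show "(\<integral>\<^sup>+z. g x * (f (x - z) * k z) \<partial>lborel) = g x * (\<integral>\<^sup>+z. f (x + z) * k z \<partial>lborel)" .
  qed
  finally show ?thesis .
qed

text \<open>The truncated operators are symmetric. The integrability of w against the test function's
  truncated Laplacian, which is not compactly supported, is where the weight \<open>op_weight\<close> enters.\<close>

lemma integral_test_fun_trunc_op:
  fixes w :: "'a::euclidean_space \<Rightarrow> real"
  assumes s: "0 < s" "s < 1" and \<beta>: "0 < \<beta>" and m: "0 < m" and e: "0 < \<epsilon>"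
    and w: "continuous_on UNIV w" "\<And>x. 0 \<le> w x"
    and K: "0 \<le> K" "\<And>x::'a. \<bar>trunc_op s \<epsilon> (test_fun \<beta> m) x\<bar> \<le> K * op_weight s \<beta> x"
    and fin: "integrable lborel (\<lambda>x. w x * op_weight s \<beta> x)"
    and wi: "\<And>x. integrable lborel (\<lambda>z. w (x + z) * cut_kernel s \<epsilon> z)"
  shows "integrable lborel (\<lambda>x. test_fun \<beta> m x * trunc_op s \<epsilon> w x)"
    and "(\<integral>x. test_fun \<beta> m x * trunc_op s \<epsilon> w x \<partial>lborel) = (\<integral>x. w x * trunc_op s \<epsilon> (test_fun \<beta> m) x \<partial>lborel)"
proof -
  have [measurable]: "w \<in> borel_measurable borel" using w(1) by (rule borel_measurable_continuous_onI)
  let ?\<phi> = "test_fun \<beta> m :: 'a \<Rightarrow> real"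
  let ?k = "cut_kernel s \<epsilon> :: 'a \<Rightarrow> real"
  define \<kappa> where "\<kappa> = (\<integral>z. ?k z \<partial>lborel)"
  define A where "A = (\<lambda>x. \<integral>z. w (x + z) * ?k z \<partial>lborel)"
  define B where "B = (\<lambda>x. \<integral>z. ?\<phi> (x + z) * ?k z \<partial>lborel)"
  have [measurable]: "A \<in> borel_measurable borel" "B \<in> borel_measurable borel"
    unfolding A_def B_def by measurable
  have ik: "integrable lborel ?k" by (rule integrable_cut_kernel[OF s(1) e])
  have \<phi>1: "\<bar>?\<phi> x\<bar> \<le> 1" for x using test_fun_nonneg[of \<beta> m x] test_fun_le_1[OF \<beta> m, of x] by simp
  have ib: "integrable lborel (\<lambda>z. ?\<phi> (x + z) * ?k z)" for x
    using \<phi>1 by (intro integrable_bounded_cut_kernel s e) auto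
  have tw: "trunc_op s \<epsilon> w x = \<kappa> * w x - A x" for x
    unfolding trunc_op_def A_def \<kappa>_def left_diff_distrib using ik wi[of x] by simp
  have tp: "trunc_op s \<epsilon> ?\<phi> x = \<kappa> * ?\<phi> x - B x" for x
    unfolding trunc_op_def B_def \<kappa>_def left_diff_distrib using ik ib[of x] by simp
  have A0: "0 \<le> A x" and B0: "0 \<le> B x" for x
    unfolding A_def B_def
    by (intro Bochner_Integration.integral_nonneg mult_nonneg_nonneg w(2) test_fun_nonneg cut_kernel_nonneg)+
  have \<kappa>0: "0 \<le> \<kappa>" unfolding \<kappa>_def by simp
  have iwp: "integrable lborel (\<lambda>x. w x * ?\<phi> x)"
    by (rule integrable_continuous_vanishing[where R = m])
       (auto intro!: continuous_intros w(1) continuous_on_test_fun simp: test_fun_vanishing m)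
  have iwt: "integrable lborel (\<lambda>x. w x * trunc_op s \<epsilon> ?\<phi> x)"
  proof (rule Bochner_Integration.integrable_bound[OF integrable_mult_right[OF fin, of K]])
    show "AE x in lborel. norm (w x * trunc_op s \<epsilon> ?\<phi> x) \<le> norm (K * (w x * op_weight s \<beta> x))"
    proof (rule AE_I2)
      fix x
      have "w x * \<bar>trunc_op s \<epsilon> ?\<phi> x\<bar> \<le> w x * (K * op_weight s \<beta> x)"
        by (intro mult_left_mono K(2) w(2))
      then show "norm (w x * trunc_op s \<epsilon> ?\<phi> x) \<le> norm (K * (w x * op_weight s \<beta> x))"
        using K(1) w(2)[of x] op_weight_nonneg[of s \<beta> x] by (simp add: abs_mult mult.left_commute)
    qed
  qed measurable
  have iwB: "integrable lborel (\<lambda>x. w x * B x)"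
  proof -
    have "(\<lambda>x. w x * B x) = (\<lambda>x. \<kappa> * (w x * ?\<phi> x) - w x * trunc_op s \<epsilon> ?\<phi> x)"
      by (auto simp: tp algebra_simps)
    then show ?thesis using iwp iwt by simp
  qed
  have nn: "(\<integral>\<^sup>+x. ennreal (?\<phi> x * A x) \<partial>lborel) = (\<integral>\<^sup>+x. ennreal (w x * B x) \<partial>lborel)"
  proof -
    have eA: "ennreal (A x) = (\<integral>\<^sup>+z. ennreal (w (x + z)) * ennreal (?k z) \<partial>lborel)" for x
      unfolding A_def using w(2) wi[of x]
      by (subst nn_integral_eq_integral[symmetric]) (auto simp: ennreal_mult')
    have eB: "ennreal (B x) = (\<integral>\<^sup>+z. ennreal (?\<phi> (x + z)) * ennreal (?k z) \<partial>lborel)" for x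
      unfolding B_def using test_fun_nonneg ib[of x]
      by (subst nn_integral_eq_integral[symmetric]) (auto simp: ennreal_mult' test_fun_nonneg)
    show ?thesis
      using nn_integral_convolution_swap[of "\<lambda>x. ennreal (?\<phi> x)" "\<lambda>x. ennreal (w x)" "\<lambda>z. ennreal (?k z)"]
      by (simp add: ennreal_mult' test_fun_nonneg w(2) eA eB)
  qed
  have ipA: "integrable lborel (\<lambda>x. ?\<phi> x * A x)"
  proof (rule integrableI_nonneg)
    show "(\<integral>\<^sup>+x. ennreal (?\<phi> x * A x) \<partial>lborel) < \<infinity>"
      unfolding nn using iwB w(2) B0 by (subst nn_integral_eq_integral) auto
  qed (auto simp: test_fun_nonneg A0)
  have eqAB: "(\<integral>x. ?\<phi> x * A x \<partial>lborel) = (\<integral>x. w x * B x \<partial>lborel)"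
  proof -
    have "ennreal (\<integral>x. ?\<phi> x * A x \<partial>lborel) = ennreal (\<integral>x. w x * B x \<partial>lborel)"
      using nn ipA iwB by (subst (asm) (1 2) nn_integral_eq_integral) (auto simp: test_fun_nonneg A0 B0 w(2))
    then show ?thesis
      by (subst (asm) ennreal_inj) (auto intro!: integral_nonneg simp: test_fun_nonneg A0 B0 w(2))
  qed
  have 1: "(\<lambda>x. ?\<phi> x * trunc_op s \<epsilon> w x) = (\<lambda>x. \<kappa> * (w x * ?\<phi> x) - ?\<phi> x * A x)"
    by (auto simp: tw algebra_simps)
  have 2: "(\<lambda>x. w x * trunc_op s \<epsilon> ?\<phi> x) = (\<lambda>x. \<kappa> * (w x * ?\<phi> x) - w x * B x)"
    by (auto simp: tp algebra_simps)
  show "integrable lborel (\<lambda>x. ?\<phi> x * trunc_op s \<epsilon> w x)"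
    unfolding 1 using iwp ipA by simp
  show "(\<integral>x. ?\<phi> x * trunc_op s \<epsilon> w x \<partial>lborel) = (\<integral>x. w x * trunc_op s \<epsilon> ?\<phi> x \<partial>lborel)"
    unfolding 1 2 using iwp ipA iwB eqAB by simp
qed

text \<open>The truncated operators satisfy the pointwise inequality given by the tangent to the convex function
  at v(x). Symmetry moves the operator to the test function before the truncation is removed.\<close>

lemma weak_level_inequality:
  fixes v :: "'a::euclidean_space \<Rightarrow> real"
  assumes s: "0 < s" "s < 1" and \<beta>: "0 < \<beta>" and m: "0 < m" and \<delta>: "0 \<le> \<delta>"
    and v: "continuous_on UNIV v"
    and vi: "\<And>x \<epsilon>. 0 < \<epsilon> \<Longrightarrow> integrable lborel (\<lambda>z. (v x - v (x + z)) * cut_kernel s \<epsilon> z)"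
    and lim: "\<And>x. (\<lambda>n. trunc_op s (1 / real (Suc n)) v x) \<longlonglongrightarrow> I x"
    and bd: "\<And>x n. norm x \<le> m \<Longrightarrow> \<bar>trunc_op s (1 / real (Suc n)) v x\<bar> \<le> B"
    and fin: "integrable lborel (\<lambda>x. level_fun \<delta> (v x) * op_weight s \<beta> x)"
  shows "integrable lborel (\<lambda>x. test_fun \<beta> m x * (level_deriv \<delta> (v x) * I x))"
    and "(\<integral>x. level_fun \<delta> (v x) * frac_op s (test_fun \<beta> m) x \<partial>lborel) \<le>
      (\<integral>x. test_fun \<beta> m x * (level_deriv \<delta> (v x) * I x) \<partial>lborel)"
proof -
  obtain K where K: "0 \<le> K" "\<And>m x. 0 < m \<Longrightarrow> \<bar>frac_op s (test_fun \<beta> m) (x::'a)\<bar> \<le> K * op_weight s \<beta> x"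
    "\<And>m x \<epsilon>. 0 < m \<Longrightarrow> 0 < \<epsilon> \<Longrightarrow> \<bar>trunc_op s \<epsilon> (test_fun \<beta> m) (x::'a)\<bar> \<le> K * op_weight s \<beta> x"
    "\<And>m x. 0 < m \<Longrightarrow> (\<lambda>n. trunc_op s (1 / real (Suc n)) (test_fun \<beta> m) (x::'a)) \<longlonglongrightarrow> frac_op s (test_fun \<beta> m) x"
    using frac_op_test_fun_bounds[OF s \<beta>, where 'a = 'a] by blast
  have [measurable]: "v \<in> borel_measurable borel" using v by (rule borel_measurable_continuous_onI)
  let ?\<phi> = "test_fun \<beta> m :: 'a \<Rightarrow> real"
  let ?e = "\<lambda>n. 1 / real (Suc n)"
  define w where "w = (\<lambda>x. level_fun \<delta> (v x))"
  have cw: "continuous_on UNIV w" unfolding w_def by (intro continuous_intros v)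
  have [measurable]: "w \<in> borel_measurable borel" using cw by (rule borel_measurable_continuous_onI)
  have w0: "0 \<le> w x" for x by (simp add: w_def)
  have fin': "integrable lborel (\<lambda>x. w x * op_weight s \<beta> x)" using fin by (simp add: w_def)
  have e0: "0 < ?e n" for n by simp
  have wi: "integrable lborel (\<lambda>z. w (x + z) * cut_kernel s \<epsilon> z)" if e: "0 < \<epsilon>" for x \<epsilon>
  proof -
    have "integrable lborel (\<lambda>z. v x * cut_kernel s \<epsilon> z - (v x - v (x + z)) * cut_kernel s \<epsilon> z)"
      by (intro Bochner_Integration.integrable_diff integrable_mult_right integrable_cut_kernel[OF s(1) e] vi[OF e])
    also have "(\<lambda>z. v x * cut_kernel s \<epsilon> z - (v x - v (x + z)) * cut_kernel s \<epsilon> z) = (\<lambda>z. v (x + z) * cut_kernel s \<epsilon> z)"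
      by (auto simp: algebra_simps)
    finally have "integrable lborel (\<lambda>z. v (x + z) * cut_kernel s \<epsilon> z)" .
    then show ?thesis
      by (rule Bochner_Integration.integrable_bound)
         (auto simp: abs_mult w_def intro!: mult_right_mono level_fun_le_abs \<delta>)
  qed
  have pw: "trunc_op s (?e n) w x \<le> level_deriv \<delta> (v x) * trunc_op s (?e n) v x" for n x
  proof -
    have "trunc_op s (?e n) w x \<le> (\<integral>z. level_deriv \<delta> (v x) * ((v x - v (x + z)) * cut_kernel s (?e n) z) \<partial>lborel)"
      unfolding trunc_op_def
    proof (rule integral_mono)
      show "integrable lborel (\<lambda>z. (w x - w (x + z)) * cut_kernel s (?e n) z)"
        unfolding left_diff_distrib
        by (intro Bochner_Integration.integrable_diff integrable_mult_right wi e0 integrable_cut_kernel s(1))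
      show "integrable lborel (\<lambda>z. level_deriv \<delta> (v x) * ((v x - v (x + z)) * cut_kernel s (?e n) z))"
        by (intro integrable_mult_right vi e0)
      show "(w x - w (x + z)) * cut_kernel s (?e n) z \<le> level_deriv \<delta> (v x) * ((v x - v (x + z)) * cut_kernel s (?e n) z)" for z
        using mult_right_mono[OF level_fun_tangent[of \<delta> "v x" "v (x + z)"], of "cut_kernel s (?e n) z"]
        by (simp add: w_def mult.assoc)
    qed
    then show ?thesis by (simp add: trunc_op_def)
  qed
  have ip: "integrable lborel (\<lambda>x. \<bar>B\<bar> * ?\<phi> x)"
    by (rule integrable_continuous_vanishing[where R = m])
       (auto intro!: continuous_intros continuous_on_test_fun simp: test_fun_vanishing m)
  have [measurable]: "I \<in> borel_measurable borel"
    by (rule borel_measurable_LIMSEQ_real[OF lim]) measurable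
  have dom: "\<bar>?\<phi> x * (level_deriv \<delta> (v x) * trunc_op s (?e n) v x)\<bar> \<le> \<bar>B\<bar> * ?\<phi> x" for n x
  proof (cases "norm x \<le> m")
    case True
    have "\<bar>level_deriv \<delta> (v x)\<bar> * \<bar>trunc_op s (?e n) v x\<bar> \<le> 1 * \<bar>B\<bar>"
      using level_deriv_abs_le[of \<delta> "v x"] bd[OF True, of n] by (intro mult_mono) auto
    from mult_right_mono[OF this test_fun_nonneg[of \<beta> m x]]
    show ?thesis
      using test_fun_nonneg[of \<beta> m x] by (simp add: abs_mult mult.commute)
  next
    case False
    then show ?thesis by (simp add: test_fun_vanishing m)
  qed
  have il: "integrable lborel (\<lambda>x. ?\<phi> x * (level_deriv \<delta> (v x) * trunc_op s (?e n) v x))" for n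
    using dom by (intro Bochner_Integration.integrable_bound[OF ip]) (auto intro: order_trans[OF _ abs_ge_self])
  have limpt: "(\<lambda>n. ?\<phi> x * (level_deriv \<delta> (v x) * trunc_op s (?e n) v x)) \<longlonglongrightarrow> ?\<phi> x * (level_deriv \<delta> (v x) * I x)" for x
    by (intro tendsto_intros lim)
  have L: "(\<lambda>n. \<integral>x. ?\<phi> x * (level_deriv \<delta> (v x) * trunc_op s (?e n) v x) \<partial>lborel) \<longlonglongrightarrow>
      (\<integral>x. ?\<phi> x * (level_deriv \<delta> (v x) * I x) \<partial>lborel)"
    by (rule integral_dominated_convergence[where w = "\<lambda>x. \<bar>B\<bar> * ?\<phi> x"]) (use ip limpt dom in auto)
  show "integrable lborel (\<lambda>x. ?\<phi> x * (level_deriv \<delta> (v x) * I x))"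
    by (rule integrable_dominated_convergence[where w = "\<lambda>x. \<bar>B\<bar> * ?\<phi> x" and
          s = "\<lambda>n x. ?\<phi> x * (level_deriv \<delta> (v x) * trunc_op s (?e n) v x)"]) (use ip limpt dom in auto)
  have R: "(\<lambda>n. \<integral>x. w x * trunc_op s (?e n) ?\<phi> x \<partial>lborel) \<longlonglongrightarrow> (\<integral>x. w x * frac_op s ?\<phi> x \<partial>lborel)"
  proof (rule integral_dominated_convergence[where w = "\<lambda>x. K * (w x * op_weight s \<beta> x)"])
    show "AE x in lborel. (\<lambda>n. w x * trunc_op s (?e n) ?\<phi> x) \<longlonglongrightarrow> w x * frac_op s ?\<phi> x"
      by (intro AE_I2 tendsto_intros K(4)[OF m])
    show "AE x in lborel. norm (w x * trunc_op s (?e n) ?\<phi> x) \<le> K * (w x * op_weight s \<beta> x)" for n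
    proof (rule AE_I2)
      fix x
      have "w x * \<bar>trunc_op s (?e n) ?\<phi> x\<bar> \<le> w x * (K * op_weight s \<beta> x)"
        by (intro mult_left_mono K(3)[OF m] w0 e0)
      then show "norm (w x * trunc_op s (?e n) ?\<phi> x) \<le> K * (w x * op_weight s \<beta> x)"
        using w0[of x] by (simp only: real_norm_def abs_mult abs_of_nonneg mult.left_commute)
    qed
  qed (use fin' in auto)
  have "(\<integral>x. w x * trunc_op s (?e n) ?\<phi> x \<partial>lborel) \<le> (\<integral>x. ?\<phi> x * (level_deriv \<delta> (v x) * trunc_op s (?e n) v x) \<partial>lborel)" for n
  proof -
    note id = integral_test_fun_trunc_op[OF s \<beta> m e0[of n] cw w0 K(1) K(3)[OF m e0[of n]] fin' wi[OF e0[of n]]]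
    show ?thesis
      unfolding id(2)[symmetric]
      by (intro integral_mono id(1) il mult_left_mono pw test_fun_nonneg)
  qed
  then show "(\<integral>x. level_fun \<delta> (v x) * frac_op s ?\<phi> x \<partial>lborel) \<le> (\<integral>x. ?\<phi> x * (level_deriv \<delta> (v x) * I x) \<partial>lborel)"
    using LIMSEQ_le[OF R L] by (auto simp: w_def)
qed

section \<open>Regularity and the principal value\<close>

text \<open>The principal value as a limit of truncated operators with respect to Borel measure.\<close>

lemma has_frac_laplacian_imp_trunc_op:
  fixes v :: "'a::euclidean_space \<Rightarrow> real"
  assumes v: "continuous_on UNIV v" and L: "has_frac_laplacian s v x L"
  shows "\<exists>I. L = frac_const TYPE('a) s * I \<and>
    (\<forall>\<epsilon>>0. integrable lborel (\<lambda>z. (v x - v (x + z)) * cut_kernel s \<epsilon> z)) \<and>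
    (\<lambda>n. trunc_op s (1 / real (Suc n)) v x) \<longlonglongrightarrow> I"
proof -
  have [measurable]: "v \<in> borel_measurable borel" using v by (rule borel_measurable_continuous_onI)
  define f where "f = (\<lambda>y. (v x - v y) / norm (x - y) powr (real DIM('a) + 2 * s))"
  obtain I where I: "L = frac_const TYPE('a) s * I" "has_pv_integral f x I"
    using L unfolding has_frac_laplacian_def f_def by blast
  define h where "h = (\<lambda>\<epsilon> y. indicator {y. \<epsilon> < dist x y} y *\<^sub>R f y)"
  have [measurable]: "h \<epsilon> \<in> borel_measurable borel" for \<epsilon> unfolding h_def f_def by measurable
  have hz: "h \<epsilon> (x + z) = (v x - v (x + z)) * cut_kernel s \<epsilon> z" for \<epsilon> z
    by (simp add: h_def f_def cut_kernel_def frac_kernel_def dist_norm indicator_def)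
  have ih: "integrable lborel (h \<epsilon>)" if "\<epsilon> > 0" for \<epsilon>
  proof -
    have "integrable lebesgue (h \<epsilon>)"
      using I(2) that unfolding has_pv_integral_def set_integrable_def h_def by blast
    then show ?thesis by (subst (asm) integrable_completion) auto
  qed
  have tr: "integrable lborel (\<lambda>z. h \<epsilon> (x + z)) \<and> (\<integral>z. h \<epsilon> (x + z) \<partial>lborel) = (\<integral>y. h \<epsilon> y \<partial>lborel)" if "\<epsilon> > 0" for \<epsilon>
  proof
    have "integrable (distr lborel borel ((+) x)) (h \<epsilon>)" using ih[OF that] by (simp add: lborel_distr_plus)
    then show "integrable lborel (\<lambda>z. h \<epsilon> (x + z))" by (subst (asm) integrable_distr_eq) auto
    have "(\<integral>y. h \<epsilon> y \<partial>lborel) = (\<integral>y. h \<epsilon> y \<partial>distr lborel borel ((+) x))" by (simp add: lborel_distr_plus)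
    also have "\<dots> = (\<integral>z. h \<epsilon> (x + z) \<partial>lborel)" by (subst integral_distr) auto
    finally show "(\<integral>z. h \<epsilon> (x + z) \<partial>lborel) = (\<integral>y. h \<epsilon> y \<partial>lborel)" by simp
  qed
  have eq: "(LINT y:{y. \<epsilon> < dist x y}|lebesgue. f y) = trunc_op s \<epsilon> v x" if "\<epsilon> > 0" for \<epsilon>
  proof -
    have "(LINT y:{y. \<epsilon> < dist x y}|lebesgue. f y) = (\<integral>y. h \<epsilon> y \<partial>lebesgue)"
      by (simp add: set_lebesgue_integral_def h_def)
    also have "\<dots> = (\<integral>y. h \<epsilon> y \<partial>lborel)" by (rule integral_completion) measurable
    also have "\<dots> = trunc_op s \<epsilon> v x" using tr[OF that] by (simp add: trunc_op_def hz)
    finally show ?thesis .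
  qed
  have "filterlim (\<lambda>n. 1 / real (Suc n)) (at_right 0) sequentially"
    by (rule tendsto_imp_filterlim_at_right[OF LIMSEQ_Suc[OF lim_1_over_n]]) simp
  moreover have "((\<lambda>\<epsilon>. LINT y:{y. \<epsilon> < dist x y}|lebesgue. f y) \<longlongrightarrow> I) (at_right 0)"
    using I(2) by (simp add: has_pv_integral_def)
  ultimately have "(\<lambda>n. LINT y:{y. 1 / real (Suc n) < dist x y}|lebesgue. f y) \<longlonglongrightarrow> I"
    by (rule filterlim_compose[rotated])
  then have "(\<lambda>n. trunc_op s (1 / real (Suc n)) v x) \<longlonglongrightarrow> I"
    by (subst (asm) eq) auto
  with I(1) tr show ?thesis by (auto simp: hz)
qed

lemma frac_const_nonneg: "0 \<le> frac_const TYPE('a::euclidean_space) s"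
  unfolding frac_const_def
  by (intro iffD2[OF inverse_nonnegative_iff_nonnegative] Bochner_Integration.integral_nonneg divide_nonneg_nonneg) auto

text \<open>Locally in x, second differences with increments of length at most 1 are of order |z|^a. Both
  regularity classes of the solution provide this with an exponent a > 2s.\<close>

definition second_diff_power_bound :: "real \<Rightarrow> ('a::euclidean_space \<Rightarrow> real) \<Rightarrow> bool" where
  "second_diff_power_bound a v \<longleftrightarrow>
     (\<forall>R. \<exists>C\<ge>0. \<forall>x z. norm x \<le> R \<and> norm z \<le> 1 \<longrightarrow> \<bar>second_diff v x z\<bar> \<le> C * norm z powr a)"

lemma holder_space_second_diff:
  assumes "v \<in> holder_space a"
  shows "second_diff_power_bound a (v :: 'a::euclidean_space \<Rightarrow> real)"
proof -
  obtain C where C: "\<And>x y. dist (v x) (v y) \<le> C * dist x y powr a"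
    using assms unfolding holder_space_def holder_on_def by auto
  have "\<bar>second_diff v x z\<bar> \<le> (2 * \<bar>C\<bar>) * norm z powr a" for x z
  proof -
    have "\<bar>second_diff v x z\<bar> \<le> \<bar>v x - v (x + z)\<bar> + \<bar>v x - v (x - z)\<bar>"
      by (simp add: second_diff_def)
    also have "\<dots> \<le> 2 * C * norm z powr a"
      using C[of x "x + z"] C[of x "x - z"] by (simp add: dist_norm)
    also have "\<dots> \<le> (2 * \<bar>C\<bar>) * norm z powr a" by (intro mult_right_mono) auto
    finally show ?thesis .
  qed
  then show ?thesis unfolding second_diff_power_bound_def by (intro allI exI[of _ "2 * \<bar>C\<bar>"]) auto
qed

lemma C1_holder_loc_second_diff:
  assumes v: "v \<in> C1_holder_loc a" and a: "0 \<le> a"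
  shows "second_diff_power_bound (1 + a) (v :: 'a::euclidean_space \<Rightarrow> real)"
  unfolding second_diff_power_bound_def
proof
  fix R :: real
  obtain g where g: "\<And>x. GDERIV v x :> g x" "\<And>K. compact K \<Longrightarrow> holder_on K a g"
    using v unfolding C1_holder_loc_def by blast
  obtain C where C: "\<And>x y. x \<in> cball 0 (R + 1) \<Longrightarrow> y \<in> cball 0 (R + 1) \<Longrightarrow> dist (g x) (g y) \<le> C * dist x y powr a"
    using g(2)[OF compact_cball[of 0 "R + 1"]] unfolding holder_on_def by blast
  have "\<bar>second_diff v x z\<bar> \<le> (\<bar>C\<bar> * 2 powr a) * norm z powr (1 + a)" if x: "norm x \<le> R" and z: "norm z \<le> 1" for x z
  proof -
    have "\<exists>\<theta>. 0 < \<theta> \<and> \<theta> < 1 \<and> (v (x + 1 *\<^sub>R z) + v (x - 1 *\<^sub>R z)) - (v (x + 0 *\<^sub>R z) + v (x - 0 *\<^sub>R z)) =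
        (1 - 0) * (z \<bullet> g (x + \<theta> *\<^sub>R z) - z \<bullet> g (x - \<theta> *\<^sub>R z))"
    proof (rule MVT2)
      fix t :: real
      have "((\<lambda>t. v (x + t *\<^sub>R z)) has_derivative (\<lambda>h. (h *\<^sub>R z) \<bullet> g (x + t *\<^sub>R z))) (at t)"
        by (rule has_derivative_compose[OF _ g(1)[unfolded gderiv_def]]) (auto intro!: derivative_eq_intros)
      moreover have "((\<lambda>t. v (x - t *\<^sub>R z)) has_derivative (\<lambda>h. (- (h *\<^sub>R z)) \<bullet> g (x - t *\<^sub>R z))) (at t)"
        by (rule has_derivative_compose[OF _ g(1)[unfolded gderiv_def]]) (auto intro!: derivative_eq_intros)
      ultimately have "((\<lambda>t. v (x + t *\<^sub>R z) + v (x - t *\<^sub>R z)) has_derivative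
          (\<lambda>h. (h *\<^sub>R z) \<bullet> g (x + t *\<^sub>R z) + (- (h *\<^sub>R z)) \<bullet> g (x - t *\<^sub>R z))) (at t)"
        by (rule has_derivative_add)
      then show "DERIV (\<lambda>t. v (x + t *\<^sub>R z) + v (x - t *\<^sub>R z)) t :> z \<bullet> g (x + t *\<^sub>R z) - z \<bullet> g (x - t *\<^sub>R z)"
        unfolding has_field_derivative_def
        by (rule has_derivative_eq_rhs) (auto simp: fun_eq_iff algebra_simps)
    qed simp
    then obtain \<theta> where \<theta>: "0 < \<theta>" "\<theta> < 1"
      "v (x + z) + v (x - z) - 2 * v x = z \<bullet> g (x + \<theta> *\<^sub>R z) - z \<bullet> g (x - \<theta> *\<^sub>R z)"
      by auto
    have nz: "norm (\<theta> *\<^sub>R z) \<le> norm z" using \<theta> by (simp add: mult_left_le_one_le)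
    have in1: "x + \<theta> *\<^sub>R z \<in> cball 0 (R + 1)" "x - \<theta> *\<^sub>R z \<in> cball 0 (R + 1)"
      using norm_triangle_ineq[of x "\<theta> *\<^sub>R z"] norm_triangle_ineq4[of x "\<theta> *\<^sub>R z"] nz x z by auto
    have "\<bar>second_diff v x z\<bar> = \<bar>z \<bullet> (g (x + \<theta> *\<^sub>R z) - g (x - \<theta> *\<^sub>R z))\<bar>"
      using \<theta>(3) by (simp add: second_diff_def inner_diff_right)
    also have "\<dots> \<le> norm z * norm (g (x + \<theta> *\<^sub>R z) - g (x - \<theta> *\<^sub>R z))"
      by (rule Cauchy_Schwarz_ineq2)
    also have "norm (g (x + \<theta> *\<^sub>R z) - g (x - \<theta> *\<^sub>R z)) \<le> \<bar>C\<bar> * (2 * norm z) powr a"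
    proof -
      have d: "dist (x + \<theta> *\<^sub>R z) (x - \<theta> *\<^sub>R z) = 2 * norm (\<theta> *\<^sub>R z)"
        by (simp add: dist_norm scaleR_2[symmetric] abs_mult)
      have "norm (g (x + \<theta> *\<^sub>R z) - g (x - \<theta> *\<^sub>R z)) \<le> C * (2 * norm (\<theta> *\<^sub>R z)) powr a"
        using C[OF in1] unfolding d by (simp only: dist_norm)
      also have "\<dots> \<le> \<bar>C\<bar> * (2 * norm z) powr a"
        using nz a by (intro mult_mono powr_mono2) auto
      finally show ?thesis .
    qed
    also have "norm z * (\<bar>C\<bar> * (2 * norm z) powr a) = (\<bar>C\<bar> * 2 powr a) * norm z powr (1 + a)"
      by (cases "z = 0") (auto simp: powr_mult powr_add)
    finally show ?thesis by (simp add: mult_left_mono)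
  qed
  then show "\<exists>C\<ge>0. \<forall>x z. norm x \<le> R \<and> norm z \<le> 1 \<longrightarrow> \<bar>second_diff v x z\<bar> \<le> C * norm z powr (1 + a)"
    by (intro exI[of _ "\<bar>C\<bar> * 2 powr a"]) auto
qed

text \<open>The truncated operators are bounded uniformly in the truncation and locally uniformly in x: small
  increments are controlled by the second differences, large ones by the L^s norm.\<close>

lemma trunc_op_locally_bounded:
  fixes v :: "'a::euclidean_space \<Rightarrow> real"
  assumes s: "0 < s" and e: "0 < e" and v: "continuous_on UNIV v" "v \<in> Ls_space s"
    and sd: "second_diff_power_bound (2 * s + e) v"
    and vi: "\<And>x \<epsilon>. 0 < \<epsilon> \<Longrightarrow> integrable lborel (\<lambda>z. (v x - v (x + z)) * cut_kernel s \<epsilon> z)"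
  shows "\<exists>B. \<forall>x n. norm x \<le> R \<longrightarrow> \<bar>trunc_op s (1 / real (Suc n)) v x\<bar> \<le> B"
proof -
  have [measurable]: "v \<in> borel_measurable borel" using v(1) by (rule borel_measurable_continuous_onI)
  define q where "q = real DIM('a) + 2 * s"
  have q: "q > 0" using s by (simp add: q_def add_nonneg_pos)
  obtain C where C: "C \<ge> 0" "\<And>x z. norm x \<le> R \<Longrightarrow> norm z \<le> 1 \<Longrightarrow> \<bar>second_diff v x z\<bar> \<le> C * norm z powr (2 * s + e)"
    using sd unfolding second_diff_power_bound_def by blast
  have "bounded (v ` cball 0 R)"
    by (intro compact_imp_bounded compact_continuous_image continuous_on_subset[OF v(1)]) auto
  then obtain M where M: "M > 0" "\<And>x. norm x \<le> R \<Longrightarrow> \<bar>v x\<bar> \<le> M"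
    by (auto simp: bounded_pos)
  define J where "J = (\<integral>\<^sup>+y. ennreal (\<bar>v y\<bar> / (1 + norm y powr q)) \<partial>lborel)"
  have J: "J < \<infinity>"
  proof -
    have "integrable lebesgue (\<lambda>x. \<bar>v x\<bar> / (1 + norm x powr q))"
      using v(2) by (simp add: Ls_space_def q_def)
    then have "integrable lborel (\<lambda>x. \<bar>v x\<bar> / (1 + norm x powr q))"
      by (subst (asm) integrable_completion) measurable
    then show ?thesis unfolding J_def by (simp add: integrable_iff_bounded)
  qed
  define A where "A = 1 + (\<bar>R\<bar> + 1) powr q"
  have A: "A \<ge> 0" by (simp add: A_def)
  define F where "F = (\<integral>\<^sup>+z. ennreal (frac_kernel s (z::'a)) * indicator {z. 1 \<le> norm z} z \<partial>lborel)"
  define N where "N = (\<integral>\<^sup>+z. ennreal (norm (z::'a) powr (e - real DIM('a))) * indicator {z. norm z \<le> 1} z \<partial>lborel)"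
  have F: "F < \<infinity>" unfolding F_def by (subst nn_integral_frac_kernel_far[OF s]) auto
  have N: "N < \<infinity>" unfolding N_def by (subst nn_integral_norm_powr_inside[OF e]) auto
  let ?far = "\<lambda>y. ennreal A * ennreal (\<bar>v y\<bar> / (1 + norm y powr q))"
  define T where "T = ennreal C * N + (ennreal (2 * M) * F + (ennreal A * J + ennreal A * J))"
  have T: "T < \<infinity>" using F N J by (simp add: T_def ennreal_mult_less_top)
  have fark: "ennreal (\<bar>v (x + z)\<bar> * frac_kernel s z) \<le> ?far (x + z)" if x: "norm x \<le> R" and z: "1 \<le> norm z" for x z
  proof -
    have "norm (x + z) \<le> (\<bar>R\<bar> + 1) * norm z"
    proof -
      have "norm (x + z) \<le> \<bar>R\<bar> * 1 + norm z" using norm_triangle_ineq[of x z] x by linarith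
      also have "\<dots> \<le> \<bar>R\<bar> * norm z + norm z" using z by (intro add_right_mono mult_left_mono) auto
      finally show ?thesis by (simp add: distrib_right)
    qed
    then have "norm (x + z) powr q \<le> ((\<bar>R\<bar> + 1) * norm z) powr q" using q by (intro powr_mono2) auto
    also have "\<dots> = (\<bar>R\<bar> + 1) powr q * norm z powr q" by (rule powr_mult)
    finally have "1 + norm (x + z) powr q \<le> 1 * norm z powr q + (\<bar>R\<bar> + 1) powr q * norm z powr q"
      using ge_one_powr_ge_zero[OF z, of q] q by linarith
    then have *: "1 + norm (x + z) powr q \<le> A * norm z powr q" by (simp add: A_def distrib_right)
    have "1 / norm z powr q \<le> A / (1 + norm (x + z) powr q)"
    proof -
      have "0 < norm z powr q" using z by auto
      then show ?thesis using * by (simp add: field_simps add_pos_nonneg)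
    qed
    then have "\<bar>v (x + z)\<bar> * (1 / norm z powr q) \<le> \<bar>v (x + z)\<bar> * (A / (1 + norm (x + z) powr q))"
      by (rule mult_left_mono) simp
    then show ?thesis using A by (simp add: frac_kernel_def q_def ennreal_mult'[symmetric] mult.commute ennreal_leI)
  qed
  have main: "\<bar>trunc_op s (1 / real (Suc n)) v x\<bar> \<le> enn2real T" if x: "norm x \<le> R" for x n
  proof -
    let ?c = "cut_kernel s (1 / real (Suc n)) :: 'a \<Rightarrow> real"
    have e0: "0 < 1 / real (Suc n)" by simp
    note t = trunc_op_eq_second_diff[OF vi[OF e0, of x]]
    have [measurable]: "(\<lambda>z. second_diff v x z) \<in> borel_measurable borel"
      unfolding second_diff_def by measurable
    have pw: "ennreal \<bar>second_diff v x z * ?c z\<bar> \<le>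
      ennreal C * (ennreal (norm z powr (e - real DIM('a))) * indicator {z. norm z \<le> 1} z) +
      (ennreal (2 * M) * (ennreal (frac_kernel s z) * indicator {z. 1 \<le> norm z} z) + (?far (x + z) + ?far (x - z)))" for z
    proof (cases "norm z \<le> 1")
      case True
      have "\<bar>second_diff v x z * ?c z\<bar> \<le> (C * norm z powr (2 * s + e)) * frac_kernel s z"
        unfolding abs_mult using C(2)[OF x True] C(1)
        by (intro mult_mono) (auto simp: cut_kernel_le)
      also have "\<dots> = C * norm z powr (e - real DIM('a))"
        by (simp only: mult.assoc frac_kernel_times_powr)
      finally have "ennreal \<bar>second_diff v x z * ?c z\<bar> \<le> ennreal C * (ennreal (norm z powr (e - real DIM('a))) * indicator {z. norm z \<le> 1} z)"
        using True C(1) by (simp add: ennreal_mult'[symmetric] ennreal_leI)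
      then show ?thesis by (rule order_trans) (simp add: add_increasing2)
    next
      case False
      then have z: "1 \<le> norm z" "1 \<le> norm (- z)" by auto
      have "\<bar>second_diff v x z\<bar> \<le> 2 * M + \<bar>v (x + z)\<bar> + \<bar>v (x - z)\<bar>"
        using M(2)[OF x] by (simp add: second_diff_def)
      then have "\<bar>second_diff v x z * ?c z\<bar> \<le> (2 * M + \<bar>v (x + z)\<bar> + \<bar>v (x - z)\<bar>) * frac_kernel s z"
        unfolding abs_mult using M(1) by (intro mult_mono) (auto simp: cut_kernel_le)
      then have "ennreal \<bar>second_diff v x z * ?c z\<bar> \<le> ennreal (2 * M * frac_kernel s z + (\<bar>v (x + z)\<bar> * frac_kernel s z + \<bar>v (x - z)\<bar> * frac_kernel s z))"
        by (intro ennreal_leI) (simp add: algebra_simps)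
      also have "\<dots> = ennreal (2 * M * frac_kernel s z) + (ennreal (\<bar>v (x + z)\<bar> * frac_kernel s z) + ennreal (\<bar>v (x - z)\<bar> * frac_kernel s z))"
        using M(1) by (simp add: ennreal_plus[symmetric] del: ennreal_plus)
      also have "\<dots> \<le> ennreal (2 * M) * (ennreal (frac_kernel s z) * indicator {z. 1 \<le> norm z} z) + (?far (x + z) + ?far (x - z))"
        using fark[OF x z(1)] fark[OF x z(2)] M(1) z by (intro add_mono) (auto simp: ennreal_mult')
      finally show ?thesis by (rule order_trans) (simp add: add_increasing)
    qed
    have "(\<integral>\<^sup>+z. ennreal \<bar>second_diff v x z * ?c z\<bar> \<partial>lborel) \<le> (\<integral>\<^sup>+z.
      ennreal C * (ennreal (norm z powr (e - real DIM('a))) * indicator {z. norm z \<le> 1} z) +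
      (ennreal (2 * M) * (ennreal (frac_kernel s z) * indicator {z. 1 \<le> norm z} z) + (?far (x + z) + ?far (x - z))) \<partial>lborel)"
      by (intro nn_integral_mono pw)
    also have "\<dots> = ennreal C * N + (ennreal (2 * M) * F + ((\<integral>\<^sup>+z. ?far (x + z) \<partial>lborel) + (\<integral>\<^sup>+z. ?far (x - z) \<partial>lborel)))"
      unfolding N_def F_def by (simp add: nn_integral_add nn_integral_cmult)
    also have "(\<integral>\<^sup>+z. ?far (x - z) \<partial>lborel) = (\<integral>\<^sup>+z. ?far (x + z) \<partial>lborel)"
      using nn_integral_lborel_uminus[of "\<lambda>z. ?far (x + z)"] by simp
    also have "(\<integral>\<^sup>+z. ?far (x + z) \<partial>lborel) = ennreal A * J"
      using nn_integral_lborel_translate[of ?far x] by (simp add: J_def nn_integral_cmult)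
    finally have le: "(\<integral>\<^sup>+z. ennreal \<bar>second_diff v x z * ?c z\<bar> \<partial>lborel) \<le> T" by (simp add: T_def)
    have "ennreal \<bar>\<integral>z. second_diff v x z * ?c z \<partial>lborel\<bar> \<le> (\<integral>\<^sup>+z. ennreal \<bar>second_diff v x z * ?c z\<bar> \<partial>lborel)"
      using integral_norm_bound_ennreal[OF t(1)] by simp
    with le have "ennreal \<bar>\<integral>z. second_diff v x z * ?c z \<partial>lborel\<bar> \<le> T" by (rule order_trans[rotated])
    also have "T = ennreal (enn2real T)" using T by simp
    finally have "\<bar>\<integral>z. second_diff v x z * ?c z \<partial>lborel\<bar> \<le> enn2real T" by (simp add: ennreal_le_iff)
    then show ?thesis unfolding t(2) by simp
  qed
  then show ?thesis by (intro exI[of _ "enn2real T"]) auto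
qed

section \<open>Integration in time\<close>

lemma continuous_AE_zero:
  fixes f :: "'a::euclidean_space \<Rightarrow> real"
  assumes f: "continuous_on UNIV f" and ae: "AE x in lborel. f x = 0"
  shows "f x = 0"
proof (rule ccontr)
  assume x: "f x \<noteq> 0"
  have op: "open {x. f x \<noteq> 0}"
    using f by (intro open_Collect_neq) (auto intro: continuous_intros)
  then obtain r where r: "r > 0" "ball x r \<subseteq> {x. f x \<noteq> 0}"
    using x open_contains_ball by blast
  have null: "{x. f x \<noteq> 0} \<in> null_sets lborel"
    using ae op by (subst AE_iff_null_sets) auto
  have "emeasure lborel (ball x r) = 0"
    by (rule null_setsD1[OF null_sets_subset[OF null _ r(2)]]) simp
  moreover have "0 < unit_ball_vol (real DIM('a)) * r ^ DIM('a)"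
    using r(1) by simp
  ultimately show False using r(1) by (simp add: emeasure_ball)
qed

text \<open>A solution with zero initial datum, together with the standing assumptions on the coefficients.\<close>

locale fractional_solution =
  fixes s T :: real and \<rho> :: "'a::euclidean_space \<Rightarrow> real" and u :: "'a \<Rightarrow> real \<Rightarrow> real"
  assumes s: "0 < s" "s < 1" and T: "0 < T"
    and rho_cont: "continuous_on UNIV \<rho>" and rho_pos: "\<And>x. 0 < \<rho> x"
    and sol: "solves_problem s T \<rho> u"
begin

lemma solution_continuous: "continuous_on (closed_slab T) (\<lambda>(x, t). u x t)"
  using sol by (simp add: solves_problem_def)

lemma solution_initial: "u x 0 = 0"
  using sol by (simp add: solves_problem_def)

lemma solution_continuous_compose [continuous_intros]:
  assumes "continuous_on A f" "continuous_on A g" "\<And>y. y \<in> A \<Longrightarrow> 0 \<le> g y \<and> g y \<le> T"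
  shows "continuous_on A (\<lambda>y. u (f y) (g y))"
proof -
  have "continuous_on A (\<lambda>y. (\<lambda>(x, t). u x t) (f y, g y))"
    using assms by (intro continuous_on_compose2[OF solution_continuous] continuous_intros)
      (auto simp: closed_slab_def)
  then show ?thesis by simp
qed

lemma time_deriv_continuous_compose [continuous_intros]:
  assumes "continuous_on A f" "continuous_on A g" "\<And>y. y \<in> A \<Longrightarrow> 0 < g y \<and> g y \<le> T"
  shows "continuous_on A (\<lambda>y. time_deriv T u (f y) (g y))"
proof -
  have *: "continuous_on (slab T) (\<lambda>(x, t). time_deriv T u x t)"
    using sol by (simp add: solves_problem_def solves_equation_def)
  have "continuous_on A (\<lambda>y. (\<lambda>(x, t). time_deriv T u x t) (f y, g y))"
    using assms by (intro continuous_on_compose2[OF *] continuous_intros) (auto simp: slab_def)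
  then show ?thesis by simp
qed

lemma solution_DERIV:
  assumes "0 < t" "t \<le> T"
  shows "(u x has_real_derivative time_deriv T u x t) (at t within {0<..T})"
proof -
  have "u x differentiable (at t within {0<..T})"
    using sol assms by (simp add: solves_problem_def solves_equation_def)
  then show ?thesis
    unfolding time_deriv_def has_real_derivative_iff_has_vector_derivative
    by (rule vector_derivative_works[THEN iffD1])
qed

lemma spatial_weak_inequality:
  assumes t: "0 < t" "t \<le> T" and \<beta>: "0 < \<beta>" and m: "0 < m" and \<delta>: "0 \<le> \<delta>"
    and fin: "integrable lborel (\<lambda>x. level_fun \<delta> (u x t) * op_weight s \<beta> x)"
  shows "(\<integral>x. test_fun \<beta> m x * (\<rho> x * (level_deriv \<delta> (u x t) * time_deriv T u x t)) \<partial>lborel) \<le>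
    (\<integral>x. level_fun \<delta> (u x t) * (- frac_const TYPE('a) s * frac_op s (test_fun \<beta> m) x) \<partial>lborel)"
proof -
  let ?c = "frac_const TYPE('a) s"
  define v where "v = (\<lambda>x. u x t)"
  have v: "continuous_on UNIV v" unfolding v_def using t by (intro continuous_intros) auto
  have eqn: "solves_equation s T \<rho> u" using sol by (simp add: solves_problem_def)
  have "\<exists>L. has_frac_laplacian s v x L \<and> \<rho> x * time_deriv T u x t + L = 0" for x
    using eqn t unfolding solves_equation_def v_def by auto
  then obtain L where L: "\<And>x. has_frac_laplacian s v x (L x)" "\<And>x. \<rho> x * time_deriv T u x t + L x = 0"
    by metis
  have ex: "\<forall>x. \<exists>I. L x = ?c * I \<and>
    (\<forall>\<epsilon>>0. integrable lborel (\<lambda>z. (v x - v (x + z)) * cut_kernel s \<epsilon> z)) \<and>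
    (\<lambda>n. trunc_op s (1 / real (Suc n)) v x) \<longlonglongrightarrow> I"
    by (intro allI has_frac_laplacian_imp_trunc_op[OF v L(1)])
  obtain I where I0: "\<forall>x. L x = ?c * I x \<and>
    (\<forall>\<epsilon>>0. integrable lborel (\<lambda>z. (v x - v (x + z)) * cut_kernel s \<epsilon> z)) \<and>
    (\<lambda>n. trunc_op s (1 / real (Suc n)) v x) \<longlonglongrightarrow> I x"
    using choice[OF ex] by (rule exE)
  have I: "\<And>x. L x = ?c * I x"
    "\<And>x \<epsilon>. 0 < \<epsilon> \<Longrightarrow> integrable lborel (\<lambda>z. (v x - v (x + z)) * cut_kernel s \<epsilon> z)"
    "\<And>x. (\<lambda>n. trunc_op s (1 / real (Suc n)) v x) \<longlonglongrightarrow> I x"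
    using I0 by auto
  obtain \<gamma> where \<gamma>: "\<gamma> > 0" "v \<in> Ls_space s" "second_diff_power_bound (2 * s + \<gamma>) v"
  proof -
    obtain \<gamma> where g: "\<gamma> > 0" "v \<in> Ls_space s"
      "if s < 1/2 then 2 * s + \<gamma> \<le> 1 \<and> v \<in> holder_space (2 * s + \<gamma>)
       else 2 * s + \<gamma> - 1 \<le> 1 \<and> v \<in> C1_holder_loc (2 * s + \<gamma> - 1)"
      using eqn t unfolding solves_equation_def space_regular_def v_def by fastforce
    have "second_diff_power_bound (2 * s + \<gamma>) v"
    proof (cases "s < 1/2")
      case True
      with g(3) show ?thesis by (intro holder_space_second_diff) auto
    next
      case False
      then have "second_diff_power_bound (1 + (2 * s + \<gamma> - 1)) v"
        using g by (intro C1_holder_loc_second_diff) auto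
      then show ?thesis by simp
    qed
    with g that show ?thesis by blast
  qed
  obtain B where B: "\<And>x n. norm x \<le> m \<Longrightarrow> \<bar>trunc_op s (1 / real (Suc n)) v x\<bar> \<le> B"
    using trunc_op_locally_bounded[OF s(1) \<gamma>(1) v \<gamma>(2,3) I(2), of m] by blast
  have fin': "integrable lborel (\<lambda>x. level_fun \<delta> (v x) * op_weight s \<beta> x)"
    using fin by (simp add: v_def)
  have W: "(\<integral>x. level_fun \<delta> (v x) * frac_op s (test_fun \<beta> m) x \<partial>lborel) \<le>
      (\<integral>x. test_fun \<beta> m x * (level_deriv \<delta> (v x) * I x) \<partial>lborel)"
    by (rule weak_level_inequality(2)[where I = I and B = B, OF s \<beta> m \<delta> v I(2,3) B fin'])
  have "(\<integral>x. test_fun \<beta> m x * (\<rho> x * (level_deriv \<delta> (u x t) * time_deriv T u x t)) \<partial>lborel) =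
      (\<integral>x. (- ?c) * (test_fun \<beta> m x * (level_deriv \<delta> (v x) * I x)) \<partial>lborel)"
  proof (rule Bochner_Integration.integral_cong[OF refl])
    fix x
    have "\<rho> x * time_deriv T u x t = - ?c * I x" using L(2)[of x] I(1)[of x] by simp
    then have "test_fun \<beta> m x * level_deriv \<delta> (v x) * (\<rho> x * time_deriv T u x t) =
        test_fun \<beta> m x * level_deriv \<delta> (v x) * (- ?c * I x)" by simp
    then show "test_fun \<beta> m x * (\<rho> x * (level_deriv \<delta> (u x t) * time_deriv T u x t)) =
        (- ?c) * (test_fun \<beta> m x * (level_deriv \<delta> (v x) * I x))"
      by (simp add: v_def mult_ac)
  qed
  also have "\<dots> = (- ?c) * (\<integral>x. test_fun \<beta> m x * (level_deriv \<delta> (v x) * I x) \<partial>lborel)"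
    by (rule integral_mult_right_zero)
  also have "\<dots> \<le> (- ?c) * (\<integral>x. level_fun \<delta> (v x) * frac_op s (test_fun \<beta> m) x \<partial>lborel)"
    using W frac_const_nonneg[of s, where 'a = 'a] by (intro mult_left_mono_neg) auto
  also have "\<dots> = (\<integral>x. (- ?c) * (level_fun \<delta> (v x) * frac_op s (test_fun \<beta> m) x) \<partial>lborel)"
    by (rule integral_mult_right_zero[symmetric])
  also have "\<dots> = (\<integral>x. level_fun \<delta> (u x t) * (- ?c * frac_op s (test_fun \<beta> m) x) \<partial>lborel)"
    by (simp only: v_def mult.left_commute)
  finally show ?thesis .
qed

text \<open>The function exp(-\<kappa> t) G(u) on the slab, extended by 0 in time. The time variable comes
  first.\<close>

definition level_weight :: "real \<Rightarrow> real \<Rightarrow> real \<times> 'a \<Rightarrow> real" where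
  "level_weight \<delta> \<kappa> = (\<lambda>(t, x). indicator {0<..T} t * (exp (- \<kappa> * t) * level_fun \<delta> (u x t)))"

lemma borel_measurable_solution:
  "(\<lambda>(t, x). indicator {0<..T} t * u x t) \<in> borel_measurable (lborel \<Otimes>\<^sub>M lborel)"
proof -
  have "(\<lambda>y. indicator ({0<..T} \<times> UNIV) y *\<^sub>R u (snd y) (fst y)) \<in> borel_measurable borel"
    by (intro borel_measurable_continuous_on_indicator continuous_intros) (auto intro!: borel_Times)
  also have "(\<lambda>y. indicator ({0<..T} \<times> UNIV) y *\<^sub>R u (snd y) (fst y)) = (\<lambda>(t, x). indicator {0<..T} t * u x t)"
    by (auto simp: fun_eq_iff indicator_def)
  finally show ?thesis by (simp add: lborel_prod)
qed

lemma level_weight_eq: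
  assumes "0 \<le> \<delta>"
  shows "level_weight \<delta> \<kappa> = (\<lambda>y. exp (- \<kappa> * fst y) * level_fun \<delta> ((\<lambda>(t, x). indicator {0<..T} t * u x t) y))"
  using assms level_fun_eq_0[of 0 \<delta>] by (auto simp: level_weight_def fun_eq_iff indicator_def)

lemma borel_measurable_level_weight [measurable]:
  assumes "0 \<le> \<delta>"
  shows "level_weight \<delta> \<kappa> \<in> borel_measurable (lborel \<Otimes>\<^sub>M lborel)"
proof -
  note borel_measurable_solution [measurable]
  show ?thesis unfolding level_weight_eq[OF assms] by measurable
qed

lemma level_weight_nonneg: "0 \<le> level_weight \<delta> \<kappa> y"
  by (auto simp: level_weight_def split: prod.split)

lemma integrable_slab_vanishing:
  fixes f :: "real \<Rightarrow> 'a \<Rightarrow> real"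
  assumes c: "continuous_on ({a..b} \<times> UNIV) (\<lambda>(t, x). f t x)" and z: "\<And>t x. m < norm x \<Longrightarrow> f t x = 0"
  shows "integrable (lborel \<Otimes>\<^sub>M lborel) (\<lambda>(t, x). indicator {a..b} t * f t x)"
proof -
  have "integrable lborel (\<lambda>y. indicator ({a..b} \<times> cball 0 m) y *\<^sub>R (\<lambda>(t, x). f t x) y)"
    by (intro borel_integrable_compact compact_Times continuous_on_subset[OF c]) auto
  also have "(\<lambda>y. indicator ({a..b} \<times> cball 0 m) y *\<^sub>R (\<lambda>(t, x). f t x) y) = (\<lambda>(t, x). indicator {a..b} t * f t x)"
    using z by (auto simp: fun_eq_iff indicator_def not_le)
  finally show ?thesis by (simp add: lborel_prod)
qed

text \<open>The weak inequality at almost every time, multiplied by exp(-\<kappa> t) and integrated over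
  (0, \<tau>]. The time derivative of u is continuous for t > 0 only, so the integration starts
  at a positive time, which then tends to 0.\<close>

lemma integrated_weak_inequality:
  assumes \<tau>: "0 < \<tau>" "\<tau> \<le> T" and \<beta>: "0 < \<beta>" and m: "0 < m" and \<delta>: "0 \<le> \<delta>" and \<kappa>: "0 \<le> \<kappa>"
    and fin: "integrable (lborel \<Otimes>\<^sub>M lborel) (\<lambda>y. level_weight \<delta> 0 y * op_weight s \<beta> (snd y))"
  defines "g \<equiv> \<lambda>y. level_weight \<delta> \<kappa> y *
      (- frac_const TYPE('a) s * frac_op s (test_fun \<beta> m) (snd y) - \<kappa> * (\<rho> (snd y) * test_fun \<beta> m (snd y)))"
  shows "integrable (lborel \<Otimes>\<^sub>M lborel) g"
    and "(\<integral>x. test_fun \<beta> m x * \<rho> x * exp (- \<kappa> * \<tau>) * level_fun \<delta> (u x \<tau>) \<partial>lborel) \<le>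
      (\<integral>y. indicator {0<..\<tau>} (fst y) * g y \<partial>(lborel \<Otimes>\<^sub>M lborel))"
proof -
  let ?c = "frac_const TYPE('a) s"
  let ?\<phi> = "test_fun \<beta> m :: 'a \<Rightarrow> real"
  obtain K where K: "0 \<le> K" "\<And>m x. 0 < m \<Longrightarrow> \<bar>frac_op s (test_fun \<beta> m) (x::'a)\<bar> \<le> K * op_weight s \<beta> x"
    using frac_op_test_fun_bounds[OF s \<beta>, where 'a = 'a] by blast
  have c0: "0 \<le> ?c" by (rule frac_const_nonneg)
  note borel_measurable_level_weight[OF \<delta>, measurable]
  have [measurable]: "\<rho> \<in> borel_measurable borel" by (rule borel_measurable_continuous_onI[OF rho_cont])
  have lw_le: "level_weight \<delta> \<kappa> y \<le> level_weight \<delta> 0 y" for y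
    using \<kappa> by (auto simp: level_weight_def indicator_def mult_left_le_one_le split: prod.split)
  have cont_rho: "continuous_on A (\<lambda>y. \<rho> (f y))" if "continuous_on A f" for A :: "'c::topological_space set" and f
    using that by (intro continuous_on_compose2[OF rho_cont]) auto
  have cont_phi: "continuous_on A (\<lambda>y. ?\<phi> (f y))" if "continuous_on A f" for A :: "'c::topological_space set" and f
    using that by (intro continuous_on_compose2[OF continuous_on_test_fun]) auto
  define g1 where "g1 = (\<lambda>y. level_weight \<delta> \<kappa> y * (- ?c * frac_op s ?\<phi> (snd y)))"
  define g2 where "g2 = (\<lambda>y. level_weight \<delta> \<kappa> y * (\<rho> (snd y) * ?\<phi> (snd y)))"
  have i1: "integrable (lborel \<Otimes>\<^sub>M lborel) g1"
  proof (rule Bochner_Integration.integrable_bound[OF integrable_mult_right[OF fin, of "?c * K"]])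
    show "AE y in lborel \<Otimes>\<^sub>M lborel. norm (g1 y) \<le> norm (?c * K * (level_weight \<delta> 0 y * op_weight s \<beta> (snd y)))"
    proof (rule AE_I2)
      fix y
      have "\<bar>g1 y\<bar> = level_weight \<delta> \<kappa> y * (?c * \<bar>frac_op s ?\<phi> (snd y)\<bar>)"
        using c0 level_weight_nonneg[of \<delta> \<kappa> y] by (simp add: g1_def abs_mult)
      also have "\<dots> \<le> level_weight \<delta> 0 y * (?c * (K * op_weight s \<beta> (snd y)))"
        using c0 K(1) K(2)[OF m] level_weight_nonneg lw_le by (intro mult_mono mult_left_mono) auto
      also have "\<dots> = ?c * K * (level_weight \<delta> 0 y * op_weight s \<beta> (snd y))" by simp
      finally show "norm (g1 y) \<le> norm (?c * K * (level_weight \<delta> 0 y * op_weight s \<beta> (snd y)))"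
        by simp
    qed
    show "g1 \<in> borel_measurable (lborel \<Otimes>\<^sub>M lborel)" unfolding g1_def by measurable
  qed
  have i2: "integrable (lborel \<Otimes>\<^sub>M lborel) g2"
  proof -
    have "integrable (lborel \<Otimes>\<^sub>M lborel) (\<lambda>(t, x). indicator {0..T} t * (exp (- \<kappa> * t) * level_fun \<delta> (u x t) * (\<rho> x * ?\<phi> x)))"
    proof (rule integrable_slab_vanishing[where m = m])
      show "continuous_on ({0..T} \<times> UNIV) (\<lambda>(t, x). exp (- \<kappa> * t) * level_fun \<delta> (u x t) * (\<rho> x * ?\<phi> x))"
        unfolding split_beta by (intro continuous_intros cont_rho cont_phi) auto
    qed (simp add: test_fun_vanishing m)
    also have "(\<lambda>(t, x). indicator {0..T} t * (exp (- \<kappa> * t) * level_fun \<delta> (u x t) * (\<rho> x * ?\<phi> x))) = g2"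
    proof (rule ext)
      fix y :: "real \<times> 'a"
      obtain t x where y: "y = (t, x)" by (cases y)
      show "(\<lambda>(t, x). indicator {0..T} t * (exp (- \<kappa> * t) * level_fun \<delta> (u x t) * (\<rho> x * ?\<phi> x))) y = g2 y"
        using level_fun_eq_0[of 0 \<delta>] \<delta>
        by (cases "t = 0") (auto simp: y g2_def level_weight_def indicator_def solution_initial)
    qed
    finally show ?thesis .
  qed
  have gsplit: "g y = g1 y - \<kappa> * g2 y" for y
    by (simp add: g_def g1_def g2_def algebra_simps)
  show ig: "integrable (lborel \<Otimes>\<^sub>M lborel) g"
    unfolding gsplit[abs_def] using i1 i2 by simp
  have [measurable]: "g \<in> borel_measurable (lborel \<Otimes>\<^sub>M lborel)" using ig by auto
  define F where "F = (\<lambda>x t. ?\<phi> x * \<rho> x * exp (- \<kappa> * t) * level_fun \<delta> (u x t))"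
  have F_int: "integrable lborel (\<lambda>x. F x t)" if "0 \<le> t" "t \<le> T" for t
    unfolding F_def using that
    by (intro integrable_continuous_vanishing[where R = m] continuous_intros cont_rho cont_phi)
       (auto simp: test_fun_vanishing m)
  \<comment> \<open>The derivative of F in time is the function q in the following proof; the order of integration is
    exchanged, and the weak inequality is applied in x.\<close>
  have step: "(\<integral>x. F x \<tau> \<partial>lborel) - (\<integral>x. F x \<sigma> \<partial>lborel) \<le> (\<integral>y. indicator {\<sigma>..\<tau>} (fst y) * g y \<partial>(lborel \<Otimes>\<^sub>M lborel))"
    if \<sigma>: "0 < \<sigma>" "\<sigma> \<le> \<tau>" for \<sigma>
  proof -
    define q where "q = (\<lambda>t x. ?\<phi> x * \<rho> x * exp (- \<kappa> * t) *
        (level_deriv \<delta> (u x t) * time_deriv T u x t - \<kappa> * level_fun \<delta> (u x t)))"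
    have ftc: "(\<integral>t. indicator {\<sigma>..\<tau>} t * q t x \<partial>lborel) = F x \<tau> - F x \<sigma>" for x
    proof -
      have "(\<integral>t. indicator {\<sigma>..\<tau>} t *\<^sub>R q t x \<partial>lborel) = F x \<tau> - F x \<sigma>"
      proof (rule integral_FTC_Icc)
        show "\<sigma> \<le> \<tau>" by fact
        show "continuous_on {\<sigma>..\<tau>} (\<lambda>t. q t x)"
          unfolding q_def using \<sigma> \<tau> by (intro continuous_intros) auto
        fix t assume t: "\<sigma> \<le> t" "t \<le> \<tau>"
        have "(u x has_real_derivative time_deriv T u x t) (at t within {\<sigma>..\<tau>})"
          using t \<sigma> \<tau> by (intro DERIV_subset[OF solution_DERIV]) auto
        then have "((\<lambda>t. level_fun \<delta> (u x t)) has_real_derivative level_deriv \<delta> (u x t) * time_deriv T u x t) (at t within {\<sigma>..\<tau>})"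
          by (rule DERIV_chain2[OF DERIV_level_fun])
        moreover have "((\<lambda>t. ?\<phi> x * \<rho> x * exp (- \<kappa> * t)) has_real_derivative ?\<phi> x * \<rho> x * (exp (- \<kappa> * t) * - \<kappa>)) (at t within {\<sigma>..\<tau>})"
          by (auto intro!: derivative_eq_intros)
        ultimately have "(F x has_real_derivative ?\<phi> x * \<rho> x * (exp (- \<kappa> * t) * - \<kappa>) * level_fun \<delta> (u x t) +
            level_deriv \<delta> (u x t) * time_deriv T u x t * (?\<phi> x * \<rho> x * exp (- \<kappa> * t))) (at t within {\<sigma>..\<tau>})"
          unfolding F_def by (intro DERIV_mult)
        then show "(F x has_vector_derivative q t x) (at t within {\<sigma>..\<tau>})"
          unfolding has_real_derivative_iff_has_vector_derivative[symmetric]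
          by (rule DERIV_cong) (simp add: q_def algebra_simps)
      qed
      then show ?thesis by simp
    qed
    have iq: "integrable (lborel \<Otimes>\<^sub>M lborel) (\<lambda>(t, x). indicator {\<sigma>..\<tau>} t * q t x)"
    proof (rule integrable_slab_vanishing[where m = m])
      show "continuous_on ({\<sigma>..\<tau>} \<times> UNIV) (\<lambda>(t, x). q t x)"
        unfolding split_beta q_def using \<sigma> \<tau> by (intro continuous_intros cont_rho cont_phi) auto
    qed (simp add: q_def test_fun_vanishing m)
    have igs: "integrable (lborel \<Otimes>\<^sub>M lborel) (\<lambda>y. indicator {\<sigma>..\<tau>} (fst y) * g y)"
      using ig by (rule Bochner_Integration.integrable_bound) (measurable, auto simp: indicator_def)
    have ae: "AE t in lborel. integrable lborel (\<lambda>x. level_weight \<delta> 0 (t, x) * op_weight s \<beta> x)"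
      using lborel_pair.AE_integrable_fst'[OF fin] by simp
    have "(\<integral>x. F x \<tau> \<partial>lborel) - (\<integral>x. F x \<sigma> \<partial>lborel) = (\<integral>x. (\<integral>t. indicator {\<sigma>..\<tau>} t * q t x \<partial>lborel) \<partial>lborel)"
      unfolding ftc using \<sigma> \<tau> by (intro Bochner_Integration.integral_diff[symmetric] F_int) auto
    also have "\<dots> = (\<integral>t. (\<integral>x. indicator {\<sigma>..\<tau>} t * q t x \<partial>lborel) \<partial>lborel)"
      by (rule lborel_pair.Fubini_integral[OF iq])
    also have "\<dots> \<le> (\<integral>t. (\<integral>x. indicator {\<sigma>..\<tau>} t * g (t, x) \<partial>lborel) \<partial>lborel)"
    proof (rule integral_mono_AE)
      show "integrable lborel (\<lambda>t. \<integral>x. indicator {\<sigma>..\<tau>} t * q t x \<partial>lborel)"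
        using lborel_pair.integrable_fst'[OF iq] by simp
      show "integrable lborel (\<lambda>t. \<integral>x. indicator {\<sigma>..\<tau>} t * g (t, x) \<partial>lborel)"
        using lborel_pair.integrable_fst'[OF igs] by simp
      show "AE t in lborel. (\<integral>x. indicator {\<sigma>..\<tau>} t * q t x \<partial>lborel) \<le> (\<integral>x. indicator {\<sigma>..\<tau>} t * g (t, x) \<partial>lborel)"
        using ae
      proof eventually_elim
        case (elim t)
        show ?case
        proof (cases "t \<in> {\<sigma>..\<tau>}")
          case True
          then have t: "0 < t" "t \<le> T" using \<sigma> \<tau> by auto
          let ?w = "\<lambda>x. level_fun \<delta> (u x t)"
          have wi: "integrable lborel (\<lambda>x. ?w x * op_weight s \<beta> x)"
            using elim t by (simp add: level_weight_def)
          have ia: "integrable lborel (\<lambda>x. ?\<phi> x * (\<rho> x * (level_deriv \<delta> (u x t) * time_deriv T u x t)))"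
            using t by (intro integrable_continuous_vanishing[where R = m] continuous_intros cont_rho cont_phi)
              (auto simp: test_fun_vanishing m)
          have ib: "integrable lborel (\<lambda>x. ?w x * (\<rho> x * ?\<phi> x))"
            using t by (intro integrable_continuous_vanishing[where R = m] continuous_intros cont_rho cont_phi)
              (auto simp: test_fun_vanishing m)
          have [measurable]: "(\<lambda>x. u x t) \<in> borel_measurable borel"
            using t by (intro borel_measurable_continuous_onI continuous_intros) auto
          have ic: "integrable lborel (\<lambda>x. ?w x * (- ?c * frac_op s ?\<phi> x))"
          proof (rule Bochner_Integration.integrable_bound[OF integrable_mult_right[OF wi, of "?c * K"]])
            show "AE x in lborel. norm (?w x * (- ?c * frac_op s ?\<phi> x)) \<le> norm (?c * K * (?w x * op_weight s \<beta> x))"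
            proof (rule AE_I2)
              fix x
              have "?w x * (?c * \<bar>frac_op s ?\<phi> x\<bar>) \<le> ?w x * (?c * (K * op_weight s \<beta> x))"
                by (intro mult_left_mono K(2)[OF m] c0 level_fun_nonneg)
              then show "norm (?w x * (- ?c * frac_op s ?\<phi> x)) \<le> norm (?c * K * (?w x * op_weight s \<beta> x))"
                using c0 K(1) op_weight_nonneg[of s \<beta> x] by (simp add: abs_mult mult_ac)
            qed
          qed measurable
          note sp = spatial_weak_inequality[OF t \<beta> m \<delta> wi]
          have "(\<integral>x. indicator {\<sigma>..\<tau>} t * q t x \<partial>lborel) =
              (\<integral>x. exp (- \<kappa> * t) * (?\<phi> x * (\<rho> x * (level_deriv \<delta> (u x t) * time_deriv T u x t)) - \<kappa> * (?w x * (\<rho> x * ?\<phi> x))) \<partial>lborel)"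
            using True by (intro Bochner_Integration.integral_cong refl) (simp add: q_def algebra_simps)
          also have "\<dots> = exp (- \<kappa> * t) * ((\<integral>x. ?\<phi> x * (\<rho> x * (level_deriv \<delta> (u x t) * time_deriv T u x t)) \<partial>lborel) - \<kappa> * (\<integral>x. ?w x * (\<rho> x * ?\<phi> x) \<partial>lborel))"
            using ia ib by simp
          also have "\<dots> \<le> exp (- \<kappa> * t) * ((\<integral>x. ?w x * (- ?c * frac_op s ?\<phi> x) \<partial>lborel) - \<kappa> * (\<integral>x. ?w x * (\<rho> x * ?\<phi> x) \<partial>lborel))"
            using sp by (intro mult_left_mono diff_right_mono) auto
          also have "\<dots> = (\<integral>x. exp (- \<kappa> * t) * (?w x * (- ?c * frac_op s ?\<phi> x) - \<kappa> * (?w x * (\<rho> x * ?\<phi> x))) \<partial>lborel)"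
            using ib by (simp only: integral_mult_right_zero Bochner_Integration.integral_diff[OF ic integrable_mult_right[OF ib]])
          also have "\<dots> = (\<integral>x. indicator {\<sigma>..\<tau>} t * g (t, x) \<partial>lborel)"
            using True t by (intro Bochner_Integration.integral_cong refl) (simp add: g_def level_weight_def algebra_simps)
          finally show ?thesis .
        qed simp
      qed
    qed
    also have "\<dots> = (\<integral>y. indicator {\<sigma>..\<tau>} (fst y) * g y \<partial>(lborel \<Otimes>\<^sub>M lborel))"
      using lborel_pair.integral_fst'[OF igs] by simp
    finally show ?thesis .
  qed
  define \<sigma> where "\<sigma> = (\<lambda>n. \<tau> * (1 / real (Suc n)))"
  have \<sigma>: "0 < \<sigma> n" "\<sigma> n \<le> \<tau>" for n
    using \<tau> by (auto simp: \<sigma>_def field_simps)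
  have \<sigma>lim: "\<sigma> \<longlonglongrightarrow> 0"
    using tendsto_mult[OF tendsto_const[of \<tau>] LIMSEQ_Suc[OF lim_1_over_n]] by (simp add: \<sigma>_def)
  have "bounded ((\<lambda>(t, x). u x t) ` ({0..T} \<times> cball 0 m))"
    unfolding split_beta
    by (intro compact_imp_bounded compact_continuous_image continuous_intros compact_Times) auto
  then obtain M where M: "\<And>t x. 0 \<le> t \<Longrightarrow> t \<le> T \<Longrightarrow> norm x \<le> m \<Longrightarrow> \<bar>u x t\<bar> \<le> M"
    unfolding bounded_iff by (fastforce simp: image_iff)
  have L: "(\<lambda>n. (\<integral>x. F x \<tau> \<partial>lborel) - (\<integral>x. F x (\<sigma> n) \<partial>lborel)) \<longlonglongrightarrow> (\<integral>x. F x \<tau> \<partial>lborel) - (\<integral>x. 0 \<partial>(lborel :: 'a measure))"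
  proof (intro tendsto_diff tendsto_const integral_dominated_convergence[where w = "\<lambda>x. ?\<phi> x * \<rho> x * M"])
    show "integrable lborel (\<lambda>x. ?\<phi> x * \<rho> x * M)"
      by (intro integrable_continuous_vanishing[where R = m] continuous_intros cont_rho cont_phi)
        (auto simp: test_fun_vanishing m)
    show "(\<lambda>x. F x (\<sigma> n)) \<in> borel_measurable lborel" for n
      using F_int[of "\<sigma> n"] \<sigma>[of n] \<tau> by auto
    show "AE x in lborel. (\<lambda>n. F x (\<sigma> n)) \<longlonglongrightarrow> 0"
    proof (rule AE_I2)
      fix x
      have "continuous_on {0..T} (F x)"
        unfolding F_def by (intro continuous_intros) auto
      then have "(\<lambda>n. F x (\<sigma> n)) \<longlonglongrightarrow> F x 0"
        using \<sigma> \<tau> T order_trans[OF \<sigma>(2) \<tau>(2)]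
        by (intro continuous_on_tendsto_compose[of "{0..T}" "F x" \<sigma>] \<sigma>lim always_eventually allI) (auto intro: less_imp_le)
      then show "(\<lambda>n. F x (\<sigma> n)) \<longlonglongrightarrow> 0"
        using level_fun_eq_0[of 0 \<delta>] \<delta> by (simp add: F_def solution_initial)
    qed
    show "AE x in lborel. norm (F x (\<sigma> n)) \<le> ?\<phi> x * \<rho> x * M" for n
    proof (rule AE_I2)
      fix x
      show "norm (F x (\<sigma> n)) \<le> ?\<phi> x * \<rho> x * M"
      proof (cases "norm x \<le> m")
        case True
        have "exp (- \<kappa> * \<sigma> n) * level_fun \<delta> (u x (\<sigma> n)) \<le> 1 * M"
          using \<kappa> \<sigma>[of n] \<tau> \<delta> M[of "\<sigma> n" x] True order_trans[OF level_fun_le_abs[of \<delta> "u x (\<sigma> n)"]]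
          by (intro mult_mono) auto
        then have "(?\<phi> x * \<rho> x) * (exp (- \<kappa> * \<sigma> n) * level_fun \<delta> (u x (\<sigma> n))) \<le> (?\<phi> x * \<rho> x) * (1 * M)"
          using rho_pos[of x] test_fun_nonneg[of \<beta> m x] by (intro mult_left_mono) auto
        then show ?thesis
          using rho_pos[of x] test_fun_nonneg[of \<beta> m x] by (simp add: F_def abs_mult mult.assoc)
      qed (simp add: F_def test_fun_vanishing m)
    qed
  qed auto
  have R: "(\<lambda>n. \<integral>y. indicator {\<sigma> n..\<tau>} (fst y) * g y \<partial>(lborel \<Otimes>\<^sub>M lborel)) \<longlonglongrightarrow>
      (\<integral>y. indicator {0<..\<tau>} (fst y) * g y \<partial>(lborel \<Otimes>\<^sub>M lborel))"
  proof (rule integral_dominated_convergence[where w = "\<lambda>y. \<bar>g y\<bar>"])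
    show "integrable (lborel \<Otimes>\<^sub>M lborel) (\<lambda>y. \<bar>g y\<bar>)" using ig by (rule integrable_abs)
    show "AE y in lborel \<Otimes>\<^sub>M lborel. (\<lambda>n. indicator {\<sigma> n..\<tau>} (fst y) * g y) \<longlonglongrightarrow> indicator {0<..\<tau>} (fst y) * g y"
    proof (rule AE_I2)
      fix y :: "real \<times> 'a"
      show "(\<lambda>n. indicator {\<sigma> n..\<tau>} (fst y) * g y) \<longlonglongrightarrow> indicator {0<..\<tau>} (fst y) * g y"
      proof (cases "0 < fst y")
        case True
        have "eventually (\<lambda>n. \<sigma> n < fst y) sequentially"
          by (rule order_tendstoD(2)[OF \<sigma>lim True])
        then have "eventually (\<lambda>n. indicator {\<sigma> n..\<tau>} (fst y) * g y = indicator {0<..\<tau>} (fst y) * g y) sequentially"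
          by eventually_elim (use True in \<open>auto simp: indicator_def\<close>)
        then show ?thesis by (rule tendsto_eventually)
      next
        case False
        then have "\<not> \<sigma> n \<le> fst y" for n using \<sigma>(1)[of n] by linarith
        with False show ?thesis by (simp add: indicator_def)
      qed
    qed
    show "AE y in lborel \<Otimes>\<^sub>M lborel. norm (indicator {\<sigma> n..\<tau>} (fst y) * g y) \<le> \<bar>g y\<bar>" for n
      by (intro AE_I2) (auto simp: indicator_def)
  qed measurable
  have "(\<integral>x. F x \<tau> \<partial>lborel) - (\<integral>x. 0 \<partial>(lborel :: 'a measure)) \<le> (\<integral>y. indicator {0<..\<tau>} (fst y) * g y \<partial>(lborel \<Otimes>\<^sub>M lborel))"
    using \<sigma> by (intro LIMSEQ_le[OF L R] exI[of _ 0] allI impI step)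
  then show "(\<integral>x. ?\<phi> x * \<rho> x * exp (- \<kappa> * \<tau>) * level_fun \<delta> (u x \<tau>) \<partial>lborel) \<le>
      (\<integral>y. indicator {0<..\<tau>} (fst y) * g y \<partial>(lborel \<Otimes>\<^sub>M lborel))"
    by (simp add: F_def)
qed

end

section \<open>Uniqueness\<close>

context fractional_solution
begin

text \<open>Passage to the limit in the test functions.\<close>

lemma level_fun_vanishes:
  assumes \<tau>: "0 < \<tau>" "\<tau> \<le> T" and \<beta>: "0 < \<beta>" and \<delta>: "0 \<le> \<delta>"
    and fin: "integrable (lborel \<Otimes>\<^sub>M lborel) (\<lambda>y. level_weight \<delta> 0 y * op_weight s \<beta> (snd y))"
    and alt: "\<beta> = real DIM('a) - 2 * s \<or>
      (\<exists>C\<ge>0. \<forall>x. op_weight s \<beta> x \<le> C * (\<rho> x * bracket x powr (- \<beta>)))"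
  shows "level_fun \<delta> (u x \<tau>) = 0"
proof -
  let ?c = "frac_const TYPE('a) s"
  define \<psi> where "\<psi> = (\<lambda>y::'a. bracket y powr (- \<beta>))"
  define \<phi> where "\<phi> = (\<lambda>n. test_fun \<beta> (real (Suc n)) :: 'a \<Rightarrow> real)"
  define w where "w = (op_weight s \<beta> :: 'a \<Rightarrow> real)"
  have c0: "0 \<le> ?c" by (rule frac_const_nonneg)
  have w0: "0 \<le> w x" for x by (simp add: w_def op_weight_nonneg)
  note borel_measurable_level_weight[OF \<delta>, measurable]
  have [measurable]: "\<rho> \<in> borel_measurable borel" by (rule borel_measurable_continuous_onI[OF rho_cont])
  have [measurable]: "w \<in> borel_measurable borel" "\<psi> \<in> borel_measurable borel" "\<phi> n \<in> borel_measurable borel" for n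
    unfolding w_def \<psi>_def \<phi>_def by measurable
  obtain K where K: "0 \<le> K"
    "\<And>m x. 0 < m \<Longrightarrow> \<bar>frac_op s (test_fun \<beta> m) (x::'a)\<bar> \<le> K * op_weight s \<beta> x"
    "\<And>x. integrable lborel (\<lambda>z. second_diff \<psi> x z * frac_kernel s z)"
    "\<And>x. (\<lambda>n. frac_op s (\<phi> n) x) \<longlonglongrightarrow> frac_op s \<psi> x"
    using frac_op_test_fun_bounds[OF s \<beta>, where 'a = 'a] unfolding \<psi>_def \<phi>_def by blast
  have Kpsi: "\<bar>frac_op s \<psi> x\<bar> \<le> K * w x" for x
    using K(2) by (intro tendsto_upperbound[OF tendsto_rabs[OF K(4)]] always_eventually allI) (auto simp: \<phi>_def w_def)
  \<comment> \<open>In the critical case \<kappa> = 0 works by superharmonicity; otherwise \<kappa> = c K C does.\<close>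
  obtain \<kappa> where \<kappa>: "0 \<le> \<kappa>" "\<And>x. - ?c * frac_op s \<psi> x \<le> min (\<kappa> * (\<rho> x * \<psi> x)) (?c * K * w x)"
  proof -
    have le: "- ?c * frac_op s \<psi> x \<le> ?c * K * w x" for x
    proof -
      have "?c * (- frac_op s \<psi> x) \<le> ?c * (K * w x)" using Kpsi[of x] c0 by (intro mult_left_mono) auto
      then show ?thesis by (simp add: mult.assoc)
    qed
    show ?thesis
      using alt
    proof
      assume b: "\<beta> = real DIM('a) - 2 * s"
      have "0 \<le> frac_op s \<psi> x" for x
        using frac_op_bracket_nonneg[OF s(1), of x] K(3)[of x] b \<beta> by (simp add: \<psi>_def)
      then have "- ?c * frac_op s \<psi> x \<le> 0" for x using c0 by (simp add: mult_nonneg_nonneg)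
      then show ?thesis using that[of 0] le by simp
    next
      assume "\<exists>C\<ge>0. \<forall>x. op_weight s \<beta> x \<le> C * (\<rho> x * bracket x powr (- \<beta>))"
      then obtain C where C: "C \<ge> 0" "\<And>x. w x \<le> C * (\<rho> x * \<psi> x)" by (auto simp: w_def \<psi>_def)
      have "?c * K * w x \<le> ?c * K * (C * (\<rho> x * \<psi> x))" for x
        using C(2) c0 K(1) by (intro mult_left_mono) auto
      then have "- ?c * frac_op s \<psi> x \<le> (?c * K * C) * (\<rho> x * \<psi> x)" for x
        using le[of x] by (metis mult.assoc order_trans)
      then show ?thesis using that[of "?c * K * C"] le c0 K(1) C(1) by simp
    qed
  qed
  define F where "F = (\<lambda>n x. \<phi> n x * \<rho> x * exp (- \<kappa> * \<tau>) * level_fun \<delta> (u x \<tau>))"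
  have cF: "continuous_on UNIV (F n)" for n
    unfolding F_def \<phi>_def using \<tau> by (intro continuous_intros rho_cont continuous_on_test_fun) auto
  have iF: "integrable lborel (F n)" for n
    by (rule integrable_continuous_vanishing[OF cF, where R = "real (Suc n)"]) (simp add: F_def \<phi>_def test_fun_vanishing)
  have F0: "0 \<le> F n x" for n x
    using rho_pos[of x] by (simp add: F_def \<phi>_def test_fun_nonneg)
  have Fmono: "F n x \<le> F k x" if "n \<le> k" for n k x
    unfolding F_def \<phi>_def using that rho_pos[of x]
    by (intro mult_right_mono test_fun_mono) auto
  \<comment> \<open>The term with \<rho> need not be integrable in the limit. Replacing it by its minimum with c K w only
    increases the right-hand side and makes dominated convergence applicable.\<close>
  define h where "h = (\<lambda>n y. indicator {0<..\<tau>} (fst y) * (level_weight \<delta> \<kappa> y *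
      (- ?c * frac_op s (\<phi> n) (snd y) - min (\<kappa> * (\<rho> (snd y) * \<phi> n (snd y))) (?c * K * w (snd y)))))"
  define h_lim where "h_lim = (\<lambda>y. indicator {0<..\<tau>} (fst y) * (level_weight \<delta> \<kappa> y *
      (- ?c * frac_op s \<psi> (snd y) - min (\<kappa> * (\<rho> (snd y) * \<psi> (snd y))) (?c * K * w (snd y)))))"
  have hm [measurable]: "h n \<in> borel_measurable (lborel \<Otimes>\<^sub>M lborel)" "h_lim \<in> borel_measurable (lborel \<Otimes>\<^sub>M lborel)" for n
    unfolding h_def h_lim_def by measurable
  define D where "D = (\<lambda>y. 2 * ?c * K * (level_weight \<delta> 0 y * op_weight s \<beta> (snd y)))"
  have iD: "integrable (lborel \<Otimes>\<^sub>M lborel) D"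
    unfolding D_def by (rule integrable_mult_right[OF fin])
  have lw_le: "level_weight \<delta> \<kappa> y \<le> level_weight \<delta> 0 y" for y
    using \<kappa> by (auto simp: level_weight_def indicator_def mult_left_le_one_le split: prod.split)
  have hD: "\<bar>h n y\<bar> \<le> D y" for n y
  proof -
    let ?m = "min (\<kappa> * (\<rho> (snd y) * \<phi> n (snd y))) (?c * K * w (snd y))"
    have "0 \<le> \<kappa> * (\<rho> (snd y) * \<phi> n (snd y))" "0 \<le> ?c * K * w (snd y)"
      using \<kappa>(1) less_imp_le[OF rho_pos[of "snd y"]] c0 K(1) w0 by (auto simp: \<phi>_def test_fun_nonneg)
    then have m: "0 \<le> ?m" "?m \<le> ?c * K * w (snd y)" by auto
    have "?c * \<bar>frac_op s (\<phi> n) (snd y)\<bar> \<le> ?c * (K * w (snd y))"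
      using K(2)[of "real (Suc n)" "snd y"] c0 by (intro mult_left_mono) (auto simp: \<phi>_def w_def)
    then have "\<bar>- ?c * frac_op s (\<phi> n) (snd y)\<bar> \<le> ?c * K * w (snd y)"
      using c0 by (simp add: abs_mult mult.assoc)
    then have a: "\<bar>- ?c * frac_op s (\<phi> n) (snd y) - ?m\<bar> \<le> 2 * ?c * K * w (snd y)"
      using m by linarith
    have "\<bar>h n y\<bar> \<le> 1 * (level_weight \<delta> 0 y * (2 * ?c * K * w (snd y)))"
      unfolding h_def abs_mult using a level_weight_nonneg lw_le[of y]
      by (intro mult_mono) (auto simp: indicator_def)
    also have "\<dots> = D y" by (simp add: D_def w_def)
    finally show ?thesis .
  qed
  have le_h: "(\<integral>x. F n x \<partial>lborel) \<le> (\<integral>y. h n y \<partial>(lborel \<Otimes>\<^sub>M lborel))" for n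
  proof -
    have n: "0 < real (Suc n)" by simp
    note I = integrated_weak_inequality[OF \<tau> \<beta> n \<delta> \<kappa>(1) fin, folded \<phi>_def]
    have "(\<integral>x. F n x \<partial>lborel) \<le> (\<integral>y. indicator {0<..\<tau>} (fst y) * (level_weight \<delta> \<kappa> y *
      (- ?c * frac_op s (\<phi> n) (snd y) - \<kappa> * (\<rho> (snd y) * \<phi> n (snd y)))) \<partial>(lborel \<Otimes>\<^sub>M lborel))"
      using I(2) by (simp add: F_def \<phi>_def)
    also have "\<dots> \<le> (\<integral>y. h n y \<partial>(lborel \<Otimes>\<^sub>M lborel))"
    proof (rule integral_mono)
      have i: "integrable (lborel \<Otimes>\<^sub>M lborel) (\<lambda>y. level_weight \<delta> \<kappa> y *
          (- ?c * frac_op s (\<phi> n) (snd y) - \<kappa> * (\<rho> (snd y) * \<phi> n (snd y))))"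
        using I(1) by (simp add: \<phi>_def)
      show "integrable (lborel \<Otimes>\<^sub>M lborel) (\<lambda>y. indicator {0<..\<tau>} (fst y) * (level_weight \<delta> \<kappa> y *
          (- ?c * frac_op s (\<phi> n) (snd y) - \<kappa> * (\<rho> (snd y) * \<phi> n (snd y)))))"
        by (rule Bochner_Integration.integrable_bound[OF i]) (measurable, auto simp: indicator_def)
      show "integrable (lborel \<Otimes>\<^sub>M lborel) (h n)"
        using order_trans[OF hD abs_ge_self]
        by (intro Bochner_Integration.integrable_bound[OF iD hm(1)] AE_I2) (simp only: real_norm_def)
      show "indicator {0<..\<tau>} (fst y) * (level_weight \<delta> \<kappa> y *
          (- ?c * frac_op s (\<phi> n) (snd y) - \<kappa> * (\<rho> (snd y) * \<phi> n (snd y)))) \<le> h n y" for y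
        unfolding h_def by (intro mult_left_mono diff_left_mono min.cobounded1 level_weight_nonneg) auto
    qed
    finally show ?thesis .
  qed
  have lim: "(\<lambda>n. \<integral>y. h n y \<partial>(lborel \<Otimes>\<^sub>M lborel)) \<longlonglongrightarrow> (\<integral>y. h_lim y \<partial>(lborel \<Otimes>\<^sub>M lborel))"
  proof (rule integral_dominated_convergence[where w = D])
    have "(\<lambda>n. \<phi> n x) \<longlonglongrightarrow> \<psi> x" for x
      unfolding \<phi>_def \<psi>_def by (rule tendsto_test_fun)
    then show "AE y in lborel \<Otimes>\<^sub>M lborel. (\<lambda>n. h n y) \<longlonglongrightarrow> h_lim y"
      unfolding h_def h_lim_def by (intro AE_I2 tendsto_intros tendsto_min K(4))
    show "AE y in lborel \<Otimes>\<^sub>M lborel. norm (h n y) \<le> D y" for n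
      using hD by simp
  qed (use iD in auto)
  have "h_lim y \<le> 0" for y
    unfolding h_lim_def using \<kappa>(2)[of "snd y"]
    by (intro mult_nonneg_nonpos level_weight_nonneg) auto
  then have lim0: "(\<integral>y. h_lim y \<partial>(lborel \<Otimes>\<^sub>M lborel)) \<le> 0"
    using Bochner_Integration.integral_nonneg[of "lborel \<Otimes>\<^sub>M lborel" "\<lambda>y. - h_lim y"] by simp
  obtain n where n: "(bracket x)\<^sup>2 < real (Suc n)"
    using reals_Archimedean2[of "(bracket x)\<^sup>2"] by (metis less_trans of_nat_less_iff lessI)
  have "(\<integral>x. F n x \<partial>lborel) \<le> (\<integral>y. h k y \<partial>(lborel \<Otimes>\<^sub>M lborel))" if "n \<le> k" for k
    using integral_mono[OF iF iF Fmono[OF that]] le_h[of k] by (rule order_trans)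
  then have "(\<integral>x. F n x \<partial>lborel) \<le> (\<integral>y. h_lim y \<partial>(lborel \<Otimes>\<^sub>M lborel))"
    by (intro LIMSEQ_le_const[OF lim]) auto
  then have "(\<integral>x. F n x \<partial>lborel) = 0"
    using lim0 Bochner_Integration.integral_nonneg[of lborel "F n"] F0 by fastforce
  then have "AE x in lborel. F n x = 0"
    using integral_nonneg_eq_0_iff_AE[OF iF[of n]] F0 by simp
  then have "F n x = 0" by (rule continuous_AE_zero[OF cF])
  moreover have "0 < \<phi> n x" unfolding \<phi>_def by (rule test_fun_pos) (use n in auto)
  ultimately show ?thesis using rho_pos[of x] by (simp add: F_def)
qed

text \<open>The integral of G(u) over the slab against the weight with exponent -\<beta>.\<close>

definition level_mass :: "real \<Rightarrow> real \<Rightarrow> ennreal" where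
  "level_mass \<delta> \<beta> = (\<integral>\<^sup>+y. ennreal (level_weight \<delta> 0 y * bracket (snd y) powr (- \<beta>)) \<partial>(lborel \<Otimes>\<^sub>M lborel))"

lemma level_mass_antimono:
  assumes "\<beta> \<le> \<beta>'"
  shows "level_mass \<delta> \<beta>' \<le> level_mass \<delta> \<beta>"
  unfolding level_mass_def
  using assms bracket_ge_1
  by (intro nn_integral_mono ennreal_leI mult_left_mono powr_mono level_weight_nonneg) auto

lemma integrable_level_op_weight:
  assumes \<delta>: "0 \<le> \<delta>" and \<beta>: "\<beta> \<le> real DIM('a) + 2 * s" and fin: "level_mass \<delta> \<beta> < \<infinity>"
  shows "integrable (lborel \<Otimes>\<^sub>M lborel) (\<lambda>y. level_weight \<delta> 0 y * op_weight s \<beta> (snd y))"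
proof -
  note borel_measurable_level_weight[OF \<delta>, measurable]
  obtain C where C: "C > 0" "\<And>x::'a. op_weight s \<beta> x \<le> C * bracket x powr (- \<beta>)"
    using op_weight_le[OF s(1) \<beta>] by blast
  have "integrable (lborel \<Otimes>\<^sub>M lborel) (\<lambda>y. level_weight \<delta> 0 y * bracket (snd y) powr (- \<beta>))"
    using fin by (intro integrableI_nonneg) (auto simp: level_mass_def level_weight_nonneg)
  then have "integrable (lborel \<Otimes>\<^sub>M lborel) (\<lambda>y. C * (level_weight \<delta> 0 y * bracket (snd y) powr (- \<beta>)))"
    by (rule integrable_mult_right)
  then show ?thesis
  proof (rule Bochner_Integration.integrable_bound)
    show "AE y in lborel \<Otimes>\<^sub>M lborel. norm (level_weight \<delta> 0 y * op_weight s \<beta> (snd y)) \<le>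
        norm (C * (level_weight \<delta> 0 y * bracket (snd y) powr (- \<beta>)))"
    proof (rule AE_I2)
      fix y :: "real \<times> 'a"
      have "level_weight \<delta> 0 y * op_weight s \<beta> (snd y) \<le> level_weight \<delta> 0 y * (C * bracket (snd y) powr (- \<beta>))"
        by (intro mult_left_mono C(2) level_weight_nonneg)
      then show "norm (level_weight \<delta> 0 y * op_weight s \<beta> (snd y)) \<le>
        norm (C * (level_weight \<delta> 0 y * bracket (snd y) powr (- \<beta>)))"
        using C(1) level_weight_nonneg[of \<delta> 0 y] op_weight_nonneg[of s \<beta> "snd y"] by (simp add: abs_mult mult.left_commute)
    qed
  qed measurable
qed

lemma level_mass_eq_iterated:
  assumes \<delta>: "0 \<le> \<delta>"
  shows "level_mass \<delta> \<beta> = (\<integral>\<^sup>+t. indicator {0<..T} t *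
     (\<integral>\<^sup>+x. ennreal (level_fun \<delta> (u x t) * bracket x powr (- \<beta>)) \<partial>lborel) \<partial>lborel)"
proof -
  note borel_measurable_level_weight[OF \<delta>, measurable]
  have "level_mass \<delta> \<beta> = (\<integral>\<^sup>+t. (\<integral>\<^sup>+x. ennreal (level_weight \<delta> 0 (t, x) * bracket x powr (- \<beta>)) \<partial>lborel) \<partial>lborel)"
  proof -
    have "(\<lambda>y. ennreal (level_weight \<delta> 0 y * bracket (snd y) powr (- \<beta>))) \<in> borel_measurable (lborel \<Otimes>\<^sub>M lborel)"
      by measurable
    from lborel.nn_integral_fst[OF this] show ?thesis by (simp add: level_mass_def)
  qed
  also have "\<dots> = (\<integral>\<^sup>+t. indicator {0<..T} t *
     (\<integral>\<^sup>+x. ennreal (level_fun \<delta> (u x t) * bracket x powr (- \<beta>)) \<partial>lborel) \<partial>lborel)"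
    by (intro nn_integral_cong) (auto simp: level_weight_def split: split_indicator)
  finally show ?thesis .
qed

lemma level_mass_finite_weighted:
  assumes \<delta>: "0 < \<delta>" and p: "1 \<le> p" and u: "u \<in> weighted_Lp p (\<lambda>x. bracket x powr (- \<beta>)) T"
  shows "level_mass \<delta> \<beta> < \<infinity>"
proof -
  let ?C = "\<delta> powr (1 - p)"
  have fin: "(\<integral>\<^sup>+t. (\<integral>\<^sup>+x. ennreal (\<bar>u x t\<bar> powr p * bracket x powr (- \<beta>)) \<partial>lebesgue) * indicator {0<..T} t \<partial>lebesgue) < \<infinity>"
    using u by (simp add: weighted_Lp_def)
  have "level_mass \<delta> \<beta> \<le> (\<integral>\<^sup>+t. ennreal ?C * ((\<integral>\<^sup>+x. ennreal (\<bar>u x t\<bar> powr p * bracket x powr (- \<beta>)) \<partial>lborel) * indicator {0<..T} t) \<partial>lborel)"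
    unfolding level_mass_eq_iterated[OF less_imp_le[OF \<delta>]]
  proof (rule nn_integral_mono)
    fix t :: real
    show "indicator {0<..T} t * (\<integral>\<^sup>+x. ennreal (level_fun \<delta> (u x t) * bracket x powr (- \<beta>)) \<partial>lborel) \<le>
      ennreal ?C * ((\<integral>\<^sup>+x. ennreal (\<bar>u x t\<bar> powr p * bracket x powr (- \<beta>)) \<partial>lborel) * indicator {0<..T} t)"
    proof (cases "t \<in> {0<..T}")
      case True
      have [measurable]: "(\<lambda>x. u x t) \<in> borel_measurable borel"
        using True by (intro borel_measurable_continuous_onI continuous_intros) auto
      have "(\<integral>\<^sup>+x. ennreal (level_fun \<delta> (u x t) * bracket x powr (- \<beta>)) \<partial>lborel) \<le>
          (\<integral>\<^sup>+x. ennreal ?C * ennreal (\<bar>u x t\<bar> powr p * bracket x powr (- \<beta>)) \<partial>lborel)"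
        using mult_right_mono[OF level_fun_le_powr[OF \<delta> p]]
        by (intro nn_integral_mono) (simp add: ennreal_mult'[symmetric] mult.assoc[symmetric] ennreal_leI)
      also have "\<dots> = ennreal ?C * (\<integral>\<^sup>+x. ennreal (\<bar>u x t\<bar> powr p * bracket x powr (- \<beta>)) \<partial>lborel)"
        by (intro nn_integral_cmult) measurable
      finally show ?thesis using True by simp
    qed simp
  qed
  also have "\<dots> = ennreal ?C * (\<integral>\<^sup>+t. (\<integral>\<^sup>+x. ennreal (\<bar>u x t\<bar> powr p * bracket x powr (- \<beta>)) \<partial>lborel) * indicator {0<..T} t \<partial>lborel)"
  proof (rule nn_integral_cmult)
    note borel_measurable_solution [measurable]
    have "(\<lambda>t. (\<integral>\<^sup>+x. ennreal (\<bar>u x t\<bar> powr p * bracket x powr (- \<beta>)) \<partial>lborel) * indicator {0<..T} t) =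
      (\<lambda>t. (\<integral>\<^sup>+x. ennreal (\<bar>(\<lambda>(t, x). indicator {0<..T} t * u x t) (t, x)\<bar> powr p * bracket x powr (- \<beta>)) \<partial>lborel) * indicator {0<..T} t)"
      by (auto simp: fun_eq_iff indicator_def)
    also have "\<dots> \<in> borel_measurable lborel"
      using borel_measurable_solution by measurable
    finally show "(\<lambda>t. (\<integral>\<^sup>+x. ennreal (\<bar>u x t\<bar> powr p * bracket x powr (- \<beta>)) \<partial>lborel) * indicator {0<..T} t) \<in> borel_measurable lborel" .
  qed
  also have "\<dots> < \<infinity>"
    using fin by (simp add: nn_integral_completion ennreal_mult_less_top)
  finally show ?thesis .
qed

text \<open>The membership of u in L^1(0,T; L^s) provides the exponent N + 2s.\<close>

lemma level_mass_finite_Ls: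
  assumes \<delta>: "0 \<le> \<delta>"
  shows "level_mass \<delta> (real DIM('a) + 2 * s) < \<infinity>"
proof -
  define q where "q = real DIM('a) + 2 * s"
  have q: "0 < q" using s by (simp add: q_def add_pos_pos)
  have L: "u \<in> L1_time_Ls s T" using sol by (simp add: solves_problem_def)
  have ae: "AE t in lebesgue. t \<in> {0<..<T} \<longrightarrow> (\<lambda>x. u x t) \<in> Ls_space s"
    using L by (simp add: L1_time_Ls_def)
  have int: "integrable lebesgue (\<lambda>t. indicator {0<..<T} t *\<^sub>R Ls_norm s (\<lambda>x. u x t))"
    using L by (simp add: L1_time_Ls_def set_integrable_def)
  have ker: "bracket x powr (- q) \<le> 2 * (1 / (1 + norm x powr q))" for x :: 'a
  proof -
    have "1 + norm x powr q \<le> 2 * bracket x powr q"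
      using ge_one_powr_ge_zero[OF bracket_ge_1[of x], of q] powr_mono2[OF _ norm_ge_zero norm_le_bracket[of x], of q] q by simp
    moreover have "0 < 1 + norm x powr q" by (simp add: add_pos_nonneg)
    moreover have "0 < bracket x powr q" using bracket_pos[of x] by (simp del: bracket_pos)
    ultimately show ?thesis by (simp add: powr_minus_divide field_simps)
  qed
  have "level_mass \<delta> q = (\<integral>\<^sup>+t. indicator {0<..T} t *
     (\<integral>\<^sup>+x. ennreal (level_fun \<delta> (u x t) * bracket x powr (- q)) \<partial>lborel) \<partial>lebesgue)"
    unfolding level_mass_eq_iterated[OF \<delta>] by (simp add: nn_integral_completion)
  also have "\<dots> \<le> (\<integral>\<^sup>+t. ennreal (2 * (indicator {0<..<T} t *\<^sub>R Ls_norm s (\<lambda>x. u x t))) \<partial>lebesgue)"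
  proof (rule nn_integral_mono_AE)
    have "AE t in lebesgue. t \<noteq> T"
      using AE_lborel_singleton[of T] by (rule AE_completion)
    with ae show "AE t in lebesgue. indicator {0<..T} t *
       (\<integral>\<^sup>+x. ennreal (level_fun \<delta> (u x t) * bracket x powr (- q)) \<partial>lborel) \<le>
        ennreal (2 * (indicator {0<..<T} t *\<^sub>R Ls_norm s (\<lambda>x. u x t)))"
    proof eventually_elim
      case (elim t)
      show ?case
      proof (cases "t \<in> {0<..<T}")
        case True
        then have i: "integrable lebesgue (\<lambda>x. \<bar>u x t\<bar> / (1 + norm x powr q))"
          using elim by (simp add: Ls_space_def q_def)
        have "(\<integral>\<^sup>+x. ennreal (level_fun \<delta> (u x t) * bracket x powr (- q)) \<partial>lborel) \<le>
           (\<integral>\<^sup>+x. ennreal (2 * (\<bar>u x t\<bar> / (1 + norm x powr q))) \<partial>lborel)"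
        proof (intro nn_integral_mono ennreal_leI)
          fix x
          have "level_fun \<delta> (u x t) * bracket x powr (- q) \<le> \<bar>u x t\<bar> * (2 * (1 / (1 + norm x powr q)))"
            using level_fun_le_abs[OF \<delta>] ker by (intro mult_mono) auto
          then show "level_fun \<delta> (u x t) * bracket x powr (- q) \<le> 2 * (\<bar>u x t\<bar> / (1 + norm x powr q))"
            by (simp add: mult.commute)
        qed
        also have "\<dots> = (\<integral>\<^sup>+x. ennreal (2 * (\<bar>u x t\<bar> / (1 + norm x powr q))) \<partial>lebesgue)"
          by (simp add: nn_integral_completion)
        also have "\<dots> = ennreal (\<integral>x. 2 * (\<bar>u x t\<bar> / (1 + norm x powr q)) \<partial>lebesgue)"
        proof (rule nn_integral_eq_integral)
          show "integrable lebesgue (\<lambda>x. 2 * (\<bar>u x t\<bar> / (1 + norm x powr q)))"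
            by (rule integrable_mult_right[OF i])
          show "AE x in lebesgue. 0 \<le> 2 * (\<bar>u x t\<bar> / (1 + norm x powr q))"
            by (simp add: add_nonneg_nonneg)
        qed
        also have "(\<integral>x. 2 * (\<bar>u x t\<bar> / (1 + norm x powr q)) \<partial>lebesgue) = 2 * Ls_norm s (\<lambda>x. u x t)"
          unfolding Ls_norm_def q_def[symmetric] by (rule integral_mult_right_zero)
        finally show ?thesis using True by simp
      next
        case False
        with elim have "t \<notin> {0<..T}" by auto
        then show ?thesis by simp
      qed
    qed
  qed
  also have "\<dots> < \<infinity>"
  proof -
    have "integrable lebesgue (\<lambda>t. 2 * (indicator {0<..<T} t *\<^sub>R Ls_norm s (\<lambda>x. u x t)))"
      by (rule integrable_mult_right[OF int])
    then have "(\<integral>\<^sup>+t. ennreal (norm (2 * (indicator {0<..<T} t *\<^sub>R Ls_norm s (\<lambda>x. u x t)))) \<partial>lebesgue) < \<infinity>"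
      by (simp only: integrable_iff_bounded)
    then show ?thesis
      by (rule le_less_trans[rotated]) (intro nn_integral_mono ennreal_leI, simp)
  qed
  finally show ?thesis by (simp only: q_def)
qed

end

lemma op_weight_le_below:
  assumes "\<beta> < real DIM('a)" "\<alpha> \<le> 2 * s" "0 < K" "K * bracket x powr (- \<alpha>) \<le> r"
  shows "op_weight s \<beta> (x::'a::euclidean_space) \<le> 1 / K * (r * bracket x powr (- \<beta>))"
proof -
  have "op_weight s \<beta> x = bracket x powr (- \<beta>) * bracket x powr (- (2 * s))"
    using assms(1) by (simp add: op_weight_def mass_growth_def powr_add[symmetric] algebra_simps)
  also have "\<dots> \<le> bracket x powr (- \<beta>) * bracket x powr (- \<alpha>)"
    using assms(2) bracket_ge_1[of x] by (intro mult_left_mono powr_mono) auto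
  also have "\<dots> \<le> bracket x powr (- \<beta>) * (r / K)"
    using assms(3,4) by (intro mult_left_mono) (auto simp: field_simps)
  finally show ?thesis by (simp add: mult.commute)
qed

lemma op_weight_le_above:
  assumes "real DIM('a) < \<beta>" "\<alpha> + \<beta> \<le> real DIM('a) + 2 * s" "0 < K" "K * bracket x powr (- \<alpha>) \<le> r"
  shows "op_weight s \<beta> (x::'a::euclidean_space) \<le> 1 / K * (r * bracket x powr (- \<beta>))"
proof -
  have "op_weight s \<beta> x = bracket x powr (- real DIM('a) - 2 * s)"
    using assms(1) by (simp add: op_weight_def mass_growth_def)
  also have "\<dots> \<le> bracket x powr (- \<beta> + - \<alpha>)"
    using assms(2) bracket_ge_1[of x] by (intro powr_mono) auto
  also have "\<dots> = bracket x powr (- \<beta>) * bracket x powr (- \<alpha>)" by (rule powr_add)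
  also have "\<dots> \<le> bracket x powr (- \<beta>) * (r / K)"
    using assms(3,4) by (intro mult_left_mono) (auto simp: field_simps)
  finally show ?thesis by (simp add: mult.commute)
qed

text \<open>The case of the logarithmic lower bound. It gives no information where the bracket is small, where the
  positivity and continuity of \<rho> are used instead.\<close>

lemma op_weight_le_critical:
  fixes \<rho> :: "'a::euclidean_space \<Rightarrow> real"
  assumes s: "0 < s" and \<rho>: "continuous_on UNIV \<rho>" "\<And>x. 0 < \<rho> x" and K: "0 < K"
    and low: "\<And>x. K * (1 + (norm x)\<^sup>2) powr (- s) * ln (1 + (norm x)\<^sup>2) \<le> \<rho> x"
  shows "\<exists>C\<ge>0. \<forall>x. op_weight s (real DIM('a)) x \<le> C * (\<rho> x * bracket x powr (- real DIM('a)))"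
proof -
  have "\<exists>x\<in>cball (0::'a) 3. \<forall>y\<in>cball 0 3. \<rho> x \<le> \<rho> y"
    by (intro continuous_attains_inf continuous_on_subset[OF \<rho>(1)]) auto
  then obtain x0 where "\<forall>y\<in>cball 0 3. \<rho> x0 \<le> \<rho> y"
    by (rule bexE)
  then have x0: "\<rho> x0 \<le> \<rho> y" if "norm y \<le> 3" for y
    using that by simp
  define r where "r = \<rho> x0"
  have r: "r > 0" "\<And>y. norm y \<le> 3 \<Longrightarrow> r \<le> \<rho> y"
    using \<rho>(2) x0 by (auto simp: r_def)
  define C where "C = 3 / r + 1 / K"
  have C: "0 \<le> C" using r K by (simp add: C_def)
  have key: "bracket x powr (- (2 * s)) * (1 + ln (bracket x)) \<le> C * \<rho> x" for x
  proof (cases "bracket x \<le> 3")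
    case True
    have b: "1 \<le> bracket x" by (rule bracket_ge_1)
    have "norm x \<le> 3" using True norm_le_bracket[of x] by linarith
    then have "r \<le> \<rho> x" by (rule r(2))
    have "bracket x powr (- (2 * s)) \<le> 1"
      using s b powr_mono[of "- (2 * s)" 0 "bracket x"] by simp
    moreover have "ln (bracket x) \<le> 2" using ln_le_minus_one[of "bracket x"] True by simp
    ultimately have "bracket x powr (- (2 * s)) * (1 + ln (bracket x)) \<le> 1 * 3"
      using b by (intro mult_mono) auto
    also have "\<dots> \<le> 3 / r * \<rho> x" using r(1) \<open>r \<le> \<rho> x\<close> by (simp add: field_simps)
    also have "\<dots> \<le> C * \<rho> x" using K \<rho>(2)[of x] by (intro mult_right_mono) (auto simp: C_def)
    finally show ?thesis .
  next
    case False
    then have b: "3 \<le> bracket x" by simp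
    have "exp 1 \<le> bracket x" using b exp_le by linarith
    then have l: "1 \<le> ln (bracket x)" by (simp add: ln_ge_iff)
    have sq: "1 + (norm x)\<^sup>2 = (bracket x)\<^sup>2" by (simp add: bracket_sq)
    have "(1 + (norm x)\<^sup>2) powr (- s) = bracket x powr (- (2 * s))"
      using powr_bracket[of x "- (2 * s)"] by simp
    moreover have "ln (1 + (norm x)\<^sup>2) = 2 * ln (bracket x)"
      unfolding sq by (simp add: ln_realpow)
    ultimately have "K * (bracket x powr (- (2 * s)) * (2 * ln (bracket x))) \<le> \<rho> x"
      using low[of x] by simp
    then have "bracket x powr (- (2 * s)) * (2 * ln (bracket x)) \<le> 1 / K * \<rho> x"
      using K by (simp add: field_simps)
    also have "\<dots> \<le> C * \<rho> x" using r \<rho>(2)[of x] by (intro mult_right_mono) (auto simp: C_def)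
    finally have "bracket x powr (- (2 * s)) * (2 * ln (bracket x)) \<le> C * \<rho> x" .
    moreover have "bracket x powr (- (2 * s)) * (1 + ln (bracket x)) \<le> bracket x powr (- (2 * s)) * (2 * ln (bracket x))"
      using l by (intro mult_left_mono) auto
    ultimately show ?thesis by linarith
  qed
  have "op_weight s (real DIM('a)) x \<le> C * (\<rho> x * bracket x powr (- real DIM('a)))" for x
  proof -
    have "op_weight s (real DIM('a)) x = bracket x powr (- real DIM('a)) * (bracket x powr (- (2 * s)) * (1 + ln (bracket x)))"
      by (simp add: op_weight_def mass_growth_def powr_diff powr_minus_divide)
    also have "\<dots> \<le> bracket x powr (- real DIM('a)) * (C * \<rho> x)"
      by (intro mult_left_mono key) auto
    finally show ?thesis by (simp add: mult_ac)
  qed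
  with C show ?thesis by blast
qed

theorem theorem2p5:
  fixes s T p \<beta> :: real
    and \<rho> \<psi> :: "'a::euclidean_space \<Rightarrow> real"
    and u :: "'a \<Rightarrow> real \<Rightarrow> real"
  assumes s: "0 < s" "s < 1"
    and T: "T > 0"
    and p: "p \<ge> 1"
    and \<beta>: "\<beta> > 0"
    and \<psi>: "\<And>x. \<psi> x = (1 + (norm x)\<^sup>2) powr (- \<beta> / 2)"
    and \<rho>_cont: "continuous_on UNIV \<rho>"
    and \<rho>_pos: "\<And>x. \<rho> x > 0"
    and sol: "solves_problem s T \<rho> u"
    and up_Ls: "\<And>t. t \<in> {0<..T} \<Longrightarrow> (\<lambda>x. \<bar>u x t\<bar> powr p) \<in> Ls_space s"
    and u_Lp: "u \<in> weighted_Lp p \<psi> T"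
    and cond:
      "(\<exists>K>0. \<exists>\<alpha>. (\<forall>x. \<rho> x \<ge> K * (1 + (norm x)\<^sup>2) powr (- \<alpha> / 2)) \<and>
          (0 < \<beta> \<and> \<beta> \<le> real DIM('a) - 2 * s \<or>
           real DIM('a) - 2 * s < \<beta> \<and> \<beta> < real DIM('a) \<and> \<alpha> \<le> 2 * s \<or>
           \<beta> = real DIM('a) \<and> \<alpha> < 2 * s \<or>
           \<beta> > real DIM('a) \<and> \<alpha> + \<beta> \<le> 2 * s + real DIM('a))) \<or>
       (\<beta> = real DIM('a) \<and>
         (\<exists>K>0. \<forall>x. \<rho> x \<ge> K * (1 + (norm x)\<^sup>2) powr (- s) * ln (1 + (norm x)\<^sup>2)))"
  shows "\<forall>x. \<forall>t\<in>{0<..T}. u x t = 0"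
proof -
  interpret fractional_solution s T \<rho> u
    using s T \<rho>_cont \<rho>_pos sol by unfold_locales auto
  let ?N = "real DIM('a)"
  have "\<psi> = (\<lambda>x. bracket x powr (- \<beta>))" by (simp add: fun_eq_iff \<psi> powr_bracket)
  with u_Lp have "u \<in> weighted_Lp p (\<lambda>x. bracket x powr (- \<beta>)) T" by simp
  then have mass_\<beta>: "level_mass \<delta> \<beta> < \<infinity>" if "0 < \<delta>" for \<delta>
    using level_mass_finite_weighted[OF that p] by blast
  have mass: "level_mass \<delta> \<beta>' < \<infinity>" if "0 < \<delta>" "\<beta> \<le> \<beta>' \<or> \<beta>' = ?N + 2 * s" for \<delta> \<beta>'
    using that level_mass_antimono[of \<beta> \<beta>' \<delta>] mass_\<beta>[of \<delta>] level_mass_finite_Ls[of \<delta>]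
    by (auto intro: le_less_trans)
  have "\<exists>\<beta>'. 0 < \<beta>' \<and> \<beta>' \<le> ?N + 2 * s \<and> (\<beta> \<le> \<beta>' \<or> \<beta>' = ?N + 2 * s) \<and>
      (\<beta>' = ?N - 2 * s \<or> (\<exists>C\<ge>0. \<forall>x. op_weight s \<beta>' x \<le> C * (\<rho> x * bracket x powr (- \<beta>'))))"
    using cond
  proof (elim disjE exE conjE)
    \<comment> \<open>The exponent is increased to the critical one, for which no condition on \<rho> is needed.\<close>
    assume b: "\<beta> \<le> ?N - 2 * s"
    then show ?thesis using \<beta> s by (intro exI[of _ "?N - 2 * s"]) auto
  next
    fix K \<alpha> assume "0 < K" "\<forall>x. K * (1 + (norm x)\<^sup>2) powr (- \<alpha> / 2) \<le> \<rho> x" "\<beta> < ?N" "\<alpha> \<le> 2 * s"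
    then have "\<forall>x. op_weight s \<beta> x \<le> 1 / K * (\<rho> x * bracket x powr (- \<beta>))"
      by (intro allI op_weight_le_below[of \<beta> \<alpha>]) (auto simp: powr_bracket)
    with \<open>0 < K\<close> have "\<exists>C\<ge>0. \<forall>x. op_weight s \<beta> x \<le> C * (\<rho> x * bracket x powr (- \<beta>))"
      by (intro exI[of _ "1 / K"] conjI) simp_all
    with \<open>\<beta> < ?N\<close> \<beta> s show ?thesis
      by (intro exI[of _ \<beta>] conjI) simp_all
  next
    fix K \<alpha> assume a: "0 < K" "\<forall>x. K * (1 + (norm x)\<^sup>2) powr (- \<alpha> / 2) \<le> \<rho> x" "\<beta> = ?N" "\<alpha> < 2 * s"
    \<comment> \<open>As \<alpha> < 2s, the exponent can be increased beyond N, which avoids the logarithm.\<close>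
    define \<beta>' where "\<beta>' = min (?N + 2 * s) (?N + 2 * s - \<alpha>)"
    have b: "?N < \<beta>'" "\<beta>' \<le> ?N + 2 * s" "\<alpha> + \<beta>' \<le> ?N + 2 * s"
      using a s by (auto simp: \<beta>'_def)
    have "\<forall>x. op_weight s \<beta>' x \<le> 1 / K * (\<rho> x * bracket x powr (- \<beta>'))"
      using a(1,2) b by (intro allI op_weight_le_above[of \<beta>' \<alpha>]) (auto simp: powr_bracket)
    with \<open>0 < K\<close> have "\<exists>C\<ge>0. \<forall>x. op_weight s \<beta>' x \<le> C * (\<rho> x * bracket x powr (- \<beta>'))"
      by (intro exI[of _ "1 / K"] conjI) simp_all
    with a b \<beta> show ?thesis
      by (intro exI[of _ \<beta>'] conjI) simp_all
  next
    fix K \<alpha> assume a: "0 < K" "\<forall>x. K * (1 + (norm x)\<^sup>2) powr (- \<alpha> / 2) \<le> \<rho> x" "?N < \<beta>" "\<alpha> + \<beta> \<le> 2 * s + ?N"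
    \<comment> \<open>Beyond N + 2s the weight is replaced by the one that comes from the space L^s.\<close>
    define \<beta>' where "\<beta>' = min \<beta> (?N + 2 * s)"
    have b: "?N < \<beta>'" "\<beta>' \<le> ?N + 2 * s" "\<alpha> + \<beta>' \<le> ?N + 2 * s" "\<beta> \<le> \<beta>' \<or> \<beta>' = ?N + 2 * s"
      using a s by (auto simp: \<beta>'_def)
    have "\<forall>x. op_weight s \<beta>' x \<le> 1 / K * (\<rho> x * bracket x powr (- \<beta>'))"
      using a(1,2) b by (intro allI op_weight_le_above[of \<beta>' \<alpha>]) (auto simp: powr_bracket)
    with \<open>0 < K\<close> have "\<exists>C\<ge>0. \<forall>x. op_weight s \<beta>' x \<le> C * (\<rho> x * bracket x powr (- \<beta>'))"
      by (intro exI[of _ "1 / K"] conjI) simp_all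
    with a b \<beta> show ?thesis
      by (intro exI[of _ \<beta>'] conjI) simp_all
  next
    fix K assume "\<beta> = ?N" "0 < K" "\<forall>x. K * (1 + (norm x)\<^sup>2) powr (- s) * ln (1 + (norm x)\<^sup>2) \<le> \<rho> x"
    then show ?thesis
      using op_weight_le_critical[OF s(1) \<rho>_cont \<rho>_pos \<open>0 < K\<close>] s
      by (intro exI[of _ \<beta>]) auto
  qed
  then obtain \<beta>' where \<beta>': "0 < \<beta>'" "\<beta>' \<le> ?N + 2 * s" "\<beta> \<le> \<beta>' \<or> \<beta>' = ?N + 2 * s"
    "\<beta>' = ?N - 2 * s \<or> (\<exists>C\<ge>0. \<forall>x. op_weight s \<beta>' x \<le> C * (\<rho> x * bracket x powr (- \<beta>')))"
    by blast
  show ?thesis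
  proof (intro allI ballI)
    fix x t assume t: "t \<in> {0<..T}"
    have "\<bar>u x t\<bar> \<le> 0"
    proof (rule field_le_epsilon)
      fix \<delta> :: real assume \<delta>: "0 < \<delta>"
      have "level_fun \<delta> (u x t) = 0"
      proof (rule level_fun_vanishes[OF _ _ \<beta>'(1) _ _ \<beta>'(4)])
        show "integrable (lborel \<Otimes>\<^sub>M lborel) (\<lambda>y. level_weight \<delta> 0 y * op_weight s \<beta>' (snd y))"
          using \<delta> \<beta>'(2,3) by (intro integrable_level_op_weight mass) auto
      qed (use t \<delta> in auto)
      then show "\<bar>u x t\<bar> \<le> 0 + \<delta>" by (simp add: level_fun_eq_0_iff)
    qed
    then show "u x t = 0" by simp
  qed
qed

end
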